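(* Let $n\ge m\ge 3$ be integers and let $\tau\in\mathcal{S}_m$ be any pattern of length $m$. Let $\Sigma_n$ be a uniform random permutation of $[n]$, let $J_m$ be the set of all $m$-element subsets of $[n]$, and for $\alpha=\{i_1<\cdots<i_m\}\in J_m$ let $X_\alpha$ be the indicator random variable of the event $\{\mathrm{red}(\Sigma_n(i_1)\cdots\Sigma_n(i_m))=\tau\}$. Let $\mathbb{X}=(X_\alpha)_{\alpha\in J_m}$ and let $\mathbb{B}=(B_\alpha)_{\alpha\in J_m}$ be a collection of independent Bernoulli random variables with $\mathbb{E}B_\alpha=\mathbb{E}X_\alpha$ for all $\alpha\in J_m$. Define $$\lambda=\binom{n}{m}\frac{1}{m!},\qquad d_1=\binom{n}{m}\left(\binom{n}{m}-\binom{n-m}{m}\right)\frac{1}{m!^2},\qquad d_2=\sum_{s=1}^{m-1}\binom{n}{2m-s}\frac{2\,L_s(\tau)}{(2m-s)!},$$ and $D_{n,m}=\min(1,\lambda^{-1})(d_1+d_2)$. Then $$d_{TV}(\mathcal{L}(\mathbb{X}),\mathcal{L}(\mathbb{B}))\le 4D_{n,m}+\frac{2\lambda}{m!}.$$ Furthermore, let $W=\sum_{\alpha\in J_m}X_\alpha$ and let $Y$ be a Poisson random variable with mean $\lambda=\mathbb{E}W$. Then $$d_{TV}(\mathcal{L}(W),\mathcal{L}(Y))\le 2D_{n,m}.$$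
   Context: $\mathcal{S}_n$ is the set of permutations of $[n]=\{1,\dots,n\}$. For a sequence $w$ of $k$ distinct positive integers, $\mathrm{red}(w)\in\mathcal{S}_k$ is the permutation obtained by replacing the $i$-th smallest entry of $w$ by $i$. For $\tau\in\mathcal{S}_m$ and $s=1,\dots,m-1$, the overlap of size $s$, $L_s(\tau)$, is the number of permutations $\sigma\in\mathcal{S}_{2m-s}$ for which there are indices $1\le i_1<\cdots<i_m\le 2m-s$ and $1\le j_1<\cdots<j_m\le 2m-s$ such that $\{i_1,\dots,i_m\}$ and $\{j_1,\dots,j_m\}$ have exactly $s$ elements in common and $\mathrm{red}(\sigma_{i_1}\cdots\sigma_{i_m})=\mathrm{red}(\sigma_{j_1}\cdots\sigma_{j_m})=\tau$. $\mathcal{L}(X)$ denotes the law of $X$, and $d_{TV}(\mathcal{L}(X),\mathcal{L}(Y))=\sup_A|P(X\in A)-P(Y\in A)|$ is total variation distance, the supremum being over measurable sets (Borel subsets of $\mathbb{R}$ for real variables; all subsets of $\{0,1\}^{J_m}$ for $\mathbb{X},\mathbb{B}$). *)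

theory Defs
  imports "HOL-Probability.Probability"
begin

text \<open>
  A permutation of \<open>[k]\<close> is a function \<open>p\<close> with \<open>p permutes {1..k}\<close>, hence the identity
  outside \<open>{1..k}\<close>. Words are lists, whose positions start at 0: the entry of \<open>w\<close> at position
  \<open>i\<close> of \<open>{1..length w}\<close> is \<open>w ! (i - 1)\<close>.
\<close>

definition red :: "nat list \<Rightarrow> nat \<Rightarrow> nat" where
  "red w i = (if i \<in> {1..length w} then card {y \<in> set w. y \<le> w ! (i - 1)} else i)"

definition subword :: "(nat \<Rightarrow> nat) \<Rightarrow> nat set \<Rightarrow> nat list" where
  "subword \<sigma> I = map \<sigma> (sorted_list_of_set I)"

text \<open>
  \<open>overlap m \<tau> s\<close> is \<open>L\<^sub>s(\<tau>)\<close>, where \<open>\<tau>\<close> is a permutation of \<open>[m]\<close>. It counts permutations,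
  not triples \<open>(\<sigma>, I, J)\<close>.
\<close>

definition overlap :: "nat \<Rightarrow> (nat \<Rightarrow> nat) \<Rightarrow> nat \<Rightarrow> nat" where
  "overlap m \<tau> s = card {\<sigma>. \<sigma> permutes {1..2 * m - s} \<and>
     (\<exists>I J. I \<subseteq> {1..2 * m - s} \<and> card I = m \<and> J \<subseteq> {1..2 * m - s} \<and> card J = m \<and>
            card (I \<inter> J) = s \<and> red (subword \<sigma> I) = \<tau> \<and> red (subword \<sigma> J) = \<tau>)}"

definition lambda_mean :: "nat \<Rightarrow> nat \<Rightarrow> real" where
  "lambda_mean n m = real (n choose m) * (1 / fact m)"

definition d1 :: "nat \<Rightarrow> nat \<Rightarrow> real" where
  "d1 n m = real (n choose m) * (real (n choose m) - real ((n - m) choose m)) * (1 / (fact m)\<^sup>2)"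

definition d2 :: "nat \<Rightarrow> nat \<Rightarrow> (nat \<Rightarrow> nat) \<Rightarrow> real" where
  "d2 n m \<tau> = (\<Sum>s = 1..m - 1. real (n choose (2 * m - s)) *
                 ((2 * real (overlap m \<tau> s)) / fact (2 * m - s)))"

definition D_bound :: "nat \<Rightarrow> nat \<Rightarrow> (nat \<Rightarrow> nat) \<Rightarrow> real" where
  "D_bound n m \<tau> = min 1 (inverse (lambda_mean n m)) * (d1 n m + d2 n m \<tau>)"

text \<open>
  The total variation distance of two probability measures on the same measurable space
  (\<open>sets P = sets Q\<close>), without a factor 2; the law of \<open>X\<close> is \<^term>\<open>distr M N X\<close>.
\<close>

definition tv_dist :: "'a measure \<Rightarrow> 'a measure \<Rightarrow> real" where
  "tv_dist P Q = (SUP A\<in>sets P. \<bar>measure P A - measure Q A\<bar>)"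

end

theory Submission
  imports Defs
begin

text \<open>
  Both total variation distances compare laws that give a distinguished outcome (no occurrence of
  \<open>\<tau>\<close>, no success) a probability of at least \<open>1 - \<lambda>\<close>. So neither distance exceeds \<open>min 1 \<lambda>\<close>. The
  outcomes with exactly one occurrence or success have almost the same probabilities under both laws;
  for \<open>e = E(W; W \<ge> 2)\<close>, comparing them bounds both distances by \<open>e + \<lambda>\<^sup>2\<close> (\<open>tv_dist_le_atoms\<close>,
  \<open>tv_dist_occ_poisson\<close>, \<open>tv_dist_indicators\<close>). It remains to compare these numbers with \<open>2 * D\<close>
  (\<open>le_two_D_bound\<close>); this proves both claims, since \<open>2 * D \<le> 4 * D + 2 * \<lambda> / m!\<close>.

  If \<open>2 * d2 \<ge> \<lambda>\<close>, the trivial bound \<open>min 1 \<lambda>\<close> is enough. Otherwise overlaps are rare. Then \<open>n < 2 * m\<close>,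
  so that any two occurrences meet and \<open>d1 = \<lambda>\<^sup>2\<close>, and the whole problem is to prove \<open>e \<le> 2 * d2\<close>
  (\<open>small_d2\<close>).

  The difficulty is that \<open>d2\<close> counts permutations that contain two overlapping occurrences, not the pairs
  of occurrences in them, so the number of occurrences per permutation has to be controlled. Each
  occurrence \<open>\<alpha>\<close> of a permutation with at least two is charged to the union \<open>K\<close> of \<open>\<alpha>\<close> and a nearest
  other occurrence (\<open>card_occ_le\<close>). If \<open>K\<close> has \<open>m + j\<close> elements, the pattern of \<open>K\<close> is counted by
  \<open>L\<^sub>s(\<tau>)\<close> for \<open>s = m - j\<close>, which pays for one of the occurrences charged to \<open>K\<close>. The others have
  disjoint complements in \<open>K\<close>; each of these petals is encoded by a set of \<open>j\<close> indices of \<open>\<tau>\<close> and two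
  words that say how two complements interleave in position and in value (\<open>certificate_determines\<close>,
  \<open>petals_certificate\<close>). So the number of petals is at most \<open>binomial m j * c j\<close>, where \<open>c j\<close> does not
  depend on \<open>m\<close> and \<open>\<tau>\<close> (\<open>card_petals_le\<close>, \<open>card_codes_le\<close>).

  Conversely, at least \<open>binomial m j\<close> permutations are counted by \<open>L\<^sub>s(\<tau>)\<close>, because doubling the entries
  of \<open>\<tau>\<close> with indices in a set of size \<open>j\<close> gives such a permutation, and the doubling can be done so that
  different sets give different permutations (\<open>binomial_le_card_overlapping\<close>). As \<open>d2\<close> is small, the
  numbers \<open>binomial n (m + j) / (m + j)! * binomial m j\<close> then decay so quickly in \<open>j\<close> that
  their sum weighted by \<open>c j\<close> is at most three times their plain sum (\<open>sum_code_bound_le\<close>).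
\<close>

section \<open>Ranks and patterns\<close>

definition rk :: "nat set \<Rightarrow> nat \<Rightarrow> nat" where
  "rk A x = card {y \<in> A. y \<le> x}"

abbreviation pat :: "(nat \<Rightarrow> nat) \<Rightarrow> nat set \<Rightarrow> nat \<Rightarrow> nat" where
  "pat \<sigma> I \<equiv> red (subword \<sigma> I)"

lemma rk_mono: "finite A \<Longrightarrow> x \<le> y \<Longrightarrow> rk A x \<le> rk A y"
  unfolding rk_def by (rule card_mono) auto

lemma rk_less:
  assumes "finite A" "y \<in> A" "x < y"
  shows "rk A x < rk A y"
proof -
  have "{z \<in> A. z \<le> x} \<subseteq> {z \<in> A. z \<le> y}" using assms by auto
  moreover have "y \<in> {z \<in> A. z \<le> y} - {z \<in> A. z \<le> x}" using assms by auto
  ultimately have "{z \<in> A. z \<le> x} \<subset> {z \<in> A. z \<le> y}" by blast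
  then show ?thesis unfolding rk_def using assms(1) by (intro psubset_card_mono) auto
qed

lemma rk_less_iff: "finite A \<Longrightarrow> x \<in> A \<Longrightarrow> y \<in> A \<Longrightarrow> rk A x < rk A y \<longleftrightarrow> x < y"
  by (meson rk_mono rk_less leD not_le_imp_less)

lemma rk_le_iff: "finite A \<Longrightarrow> x \<in> A \<Longrightarrow> y \<in> A \<Longrightarrow> rk A x \<le> rk A y \<longleftrightarrow> x \<le> y"
  by (meson rk_less_iff not_less)

lemma rk_inj: "finite A \<Longrightarrow> inj_on (rk A) A"
  by (rule inj_onI) (metis rk_le_iff antisym le_refl)

lemma rk_bounds: "finite A \<Longrightarrow> x \<in> A \<Longrightarrow> rk A x \<in> {1..card A}"
proof -
  assume a: "finite A" "x \<in> A"
  have "{x} \<subseteq> {y \<in> A. y \<le> x}" using a by auto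
  then have "card {x} \<le> rk A x" unfolding rk_def using a by (intro card_mono) auto
  moreover have "rk A x \<le> card A" unfolding rk_def using a by (intro card_mono) auto
  ultimately show ?thesis by simp
qed

lemma rk_image: "finite A \<Longrightarrow> rk A ` A = {1..card A}"
  by (rule card_subset_eq) (auto simp: card_image rk_inj dest: rk_bounds)

lemma rk_bij: "finite A \<Longrightarrow> bij_betw (rk A) A {1..card A}"
  by (simp add: bij_betw_def rk_inj rk_image)

lemma rk_interval: "x \<in> {1..N} \<Longrightarrow> rk {1..N} x = x"
proof -
  assume "x \<in> {1..N}"
  then have "{y \<in> {1..N}. y \<le> x} = {1..x}" by auto
  then show ?thesis by (simp add: rk_def)
qed

lemma rk_Un: "finite A \<Longrightarrow> finite B \<Longrightarrow> A \<inter> B = {} \<Longrightarrow> rk (A \<union> B) x = rk A x + rk B x"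
proof -
  assume a: "finite A" "finite B" "A \<inter> B = {}"
  have "{y \<in> A \<union> B. y \<le> x} = {y \<in> A. y \<le> x} \<union> {y \<in> B. y \<le> x}" by auto
  then show ?thesis unfolding rk_def using a by (simp add: card_Un_disjoint disjoint_iff)
qed

lemma rk_compl:
  assumes "A \<subseteq> {1..N}" "x \<in> {1..N}"
  shows "rk A x + rk ({1..N} - A) x = x"
proof -
  have "rk (A \<union> ({1..N} - A)) x = rk A x + rk ({1..N} - A) x"
    using assms finite_subset by (intro rk_Un) auto
  moreover have "A \<union> ({1..N} - A) = {1..N}" using assms by auto
  ultimately show ?thesis using rk_interval[OF assms(2)] by simp
qed

lemma rk_image_mono:
  assumes "\<And>x y. x \<in> A \<Longrightarrow> y \<in> A \<Longrightarrow> f x \<le> f y \<longleftrightarrow> x \<le> y" "B \<subseteq> A" "x \<in> A" 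
  shows "rk (f ` B) (f x) = rk B x"
proof -
  have "{y \<in> f ` B. y \<le> f x} = f ` {y \<in> B. y \<le> x}" using assms by auto
  moreover have "inj_on f {y \<in> B. y \<le> x}"
    using assms by (intro inj_onI) (metis (mono_tags, lifting) antisym le_refl mem_Collect_eq subsetD)
  ultimately show ?thesis by (simp add: rk_def card_image)
qed

lemma rk_nth:
  assumes "finite I" "i < card I"
  shows "rk I (sorted_list_of_set I ! i) = Suc i"
proof -
  let ?xs = "sorted_list_of_set I"
  have len: "length ?xs = card I" using assms by simp
  have lt: "?xs ! a < ?xs ! b \<longleftrightarrow> a < b" if "a < card I" "b < card I" for a b
    using that sorted_list_of_set.strict_sorted_key_list_of_set[of I] len sorted_wrt_nth_less[of "(<)" ?xs]
    by (metis linorder_less_linear not_less_iff_gr_or_eq)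
  have I: "y \<in> I \<longleftrightarrow> (\<exists>a<card I. y = ?xs ! a)" for y
    using set_sorted_list_of_set[OF assms(1)] len in_set_conv_nth[of y ?xs] by auto
  have le: "?xs ! a \<le> ?xs ! i \<longleftrightarrow> a \<le> i" if "a < card I" for a
    using lt[OF assms(2) that] by linarith
  have "{y \<in> I. y \<le> ?xs ! i} = (\<lambda>a. ?xs ! a) ` {..i}"
  proof (intro set_eqI iffI)
    fix y assume "y \<in> {y \<in> I. y \<le> ?xs ! i}"
    then obtain a where "a < card I" "y = ?xs ! a" "?xs ! a \<le> ?xs ! i" using I[of y] by auto
    then show "y \<in> (\<lambda>a. ?xs ! a) ` {..i}" using le by blast
  next
    fix y assume "y \<in> (\<lambda>a. ?xs ! a) ` {..i}"
    then obtain a where a: "a \<le> i" "y = ?xs ! a" by blast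
    then have "a < card I" using assms(2) by simp
    then show "y \<in> {y \<in> I. y \<le> ?xs ! i}" using a I[of y] le[of a] by auto
  qed
  moreover have "inj_on (\<lambda>a. ?xs ! a) {..i}"
    using assms len by (intro inj_onI) (simp add: nth_eq_iff_index_eq)
  ultimately show ?thesis by (simp add: rk_def card_image)
qed

lemma set_subword: "finite I \<Longrightarrow> set (subword \<sigma> I) = \<sigma> ` I"
  by (simp add: subword_def)

lemma length_subword: "finite I \<Longrightarrow> length (subword \<sigma> I) = card I"
  by (simp add: subword_def)

lemma pat_out: "finite I \<Longrightarrow> i \<notin> {1..card I} \<Longrightarrow> pat \<sigma> I i = i"
  unfolding red_def by (auto simp: length_subword)

lemma pat_rk:
  assumes "finite I" "x \<in> I"
  shows "pat \<sigma> I (rk I x) = rk (\<sigma> ` I) (\<sigma> x)"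
proof -
  have b: "rk I x \<in> {1..card I}" using rk_bounds assms by blast
  define i where "i = rk I x - 1"
  have i: "i < card I" "rk I x = Suc i" using b by (auto simp: i_def)
  let ?y = "sorted_list_of_set I ! i"
  have y: "?y \<in> I"
    using i assms(1) nth_mem[of i "sorted_list_of_set I"] by simp
  have "rk I ?y = rk I x" using rk_nth[OF assms(1) i(1)] i(2) by simp
  then have "?y = x" using y assms(2) by (rule inj_onD[OF rk_inj[OF assms(1)]])
  moreover have "subword \<sigma> I ! i = \<sigma> ?y"
    unfolding subword_def using i assms(1) by (intro nth_map) auto
  ultimately have *: "subword \<sigma> I ! i = \<sigma> x" by simp
  have "red (subword \<sigma> I) (Suc i) = card {y \<in> set (subword \<sigma> I). y \<le> subword \<sigma> I ! i}"
    using i(1) length_subword[OF assms(1)] by (simp add: red_def)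
  then have "pat \<sigma> I (rk I x) = card {y \<in> \<sigma> ` I. y \<le> \<sigma> x}"
    unfolding i(2) * set_subword[OF assms(1)] .
  then show ?thesis unfolding rk_def[of "\<sigma> ` I"] .
qed

lemma pat_permutes:
  assumes "finite I" "inj_on \<sigma> I"
  shows "pat \<sigma> I permutes {1..card I}"
proof (rule bij_imp_permutes)
  have "bij_betw (rk (\<sigma> ` I) \<circ> \<sigma>) I {1..card (\<sigma> ` I)}"
    using assms by (intro bij_betw_trans[OF _ rk_bij]) (auto simp: bij_betw_def)
  moreover have "card (\<sigma> ` I) = card I" using assms by (simp add: card_image)
  moreover have "(rk (\<sigma> ` I) \<circ> \<sigma>) x = (pat \<sigma> I \<circ> rk I) x" if "x \<in> I" for x
    using pat_rk[OF assms(1) that] by simp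
  ultimately have "bij_betw (pat \<sigma> I \<circ> rk I) I {1..card I}"
    using bij_betw_cong[of I "rk (\<sigma> ` I) \<circ> \<sigma>" "pat \<sigma> I \<circ> rk I"] by metis
  then show "bij_betw (pat \<sigma> I) {1..card I} {1..card I}"
    using bij_betw_comp_iff[OF rk_bij[OF assms(1)], of "pat \<sigma> I" "{1..card I}"] by simp
next
  show "pat \<sigma> I i = i" if "i \<notin> {1..card I}" for i
    by (rule pat_out[OF assms(1) that])
qed

lemma pat_ext:
  assumes "finite I" "\<And>i. i \<notin> {1..card I} \<Longrightarrow> \<tau> i = i"
    and "\<And>x. x \<in> I \<Longrightarrow> \<tau> (rk I x) = rk (\<sigma> ` I) (\<sigma> x)"
  shows "pat \<sigma> I = \<tau>"
proof
  fix i
  show "pat \<sigma> I i = \<tau> i"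
  proof (cases "i \<in> {1..card I}")
    case True
    then have "i \<in> rk I ` I" using rk_image[OF assms(1)] by simp
    then obtain x where x: "x \<in> I" "i = rk I x" by blast
    show ?thesis unfolding x(2) assms(3)[OF x(1)] by (rule pat_rk[OF assms(1) x(1)])
  next
    case False
    show ?thesis unfolding assms(2)[OF False] by (rule pat_out[OF assms(1) False])
  qed
qed

text \<open>A permutation is determined by the relative order of its entries; the ranks in \<open>I\<close> translate
  positions of \<open>\<sigma>\<close> into positions of the pattern.\<close>

lemma pat_eq_iff_order:
  assumes "finite I" "inj_on \<sigma> I" "\<tau> permutes {1..card I}"
  shows "pat \<sigma> I = \<tau> \<longleftrightarrow> (\<forall>x\<in>I. \<forall>y\<in>I. \<sigma> x < \<sigma> y \<longleftrightarrow> \<tau> (rk I x) < \<tau> (rk I y))"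
proof
  assume "pat \<sigma> I = \<tau>"
  then show "\<forall>x\<in>I. \<forall>y\<in>I. \<sigma> x < \<sigma> y \<longleftrightarrow> \<tau> (rk I x) < \<tau> (rk I y)"
    using pat_rk[OF assms(1), of _ \<sigma>] rk_less_iff[OF finite_imageI[OF assms(1)], of _ \<sigma>] by force
next
  assume *: "\<forall>x\<in>I. \<forall>y\<in>I. \<sigma> x < \<sigma> y \<longleftrightarrow> \<tau> (rk I x) < \<tau> (rk I y)"
  show "pat \<sigma> I = \<tau>"
  proof (rule pat_ext[OF assms(1)])
    show "\<tau> i = i" if "i \<notin> {1..card I}" for i using that assms(3) by (meson permutes_not_in)
    fix x assume x: "x \<in> I"
    have img: "\<tau> ` rk I ` I = {1..card I}"
      using assms by (simp add: rk_image permutes_image)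
    have "{y \<in> \<sigma> ` I. y \<le> \<sigma> x} = \<sigma> ` {y \<in> I. \<sigma> y \<le> \<sigma> x}" by auto
    then have "rk (\<sigma> ` I) (\<sigma> x) = card {y \<in> I. \<sigma> y \<le> \<sigma> x}"
      unfolding rk_def using card_image[OF inj_on_subset[OF assms(2)], of "{y \<in> I. \<sigma> y \<le> \<sigma> x}"] by simp
    also have "{y \<in> I. \<sigma> y \<le> \<sigma> x} = {y \<in> I. \<tau> (rk I y) \<le> \<tau> (rk I x)}"
      using * x by (metis (no_types, lifting) not_less)
    also have "card \<dots> = card ((\<lambda>y. \<tau> (rk I y)) ` {y \<in> I. \<tau> (rk I y) \<le> \<tau> (rk I x)})"
    proof (rule card_image[symmetric])
      have "inj_on (\<tau> \<circ> rk I) I"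
        using rk_inj[OF assms(1)] inj_on_subset[OF permutes_inj[OF assms(3)] subset_UNIV] by (rule comp_inj_on)
      then show "inj_on (\<lambda>y. \<tau> (rk I y)) {y \<in> I. \<tau> (rk I y) \<le> \<tau> (rk I x)}"
        by (auto simp: inj_on_def)
    qed
    also have "(\<lambda>y. \<tau> (rk I y)) ` {y \<in> I. \<tau> (rk I y) \<le> \<tau> (rk I x)} = {i \<in> {1..card I}. i \<le> \<tau> (rk I x)}"
    proof (intro set_eqI iffI)
      fix i assume "i \<in> {i \<in> {1..card I}. i \<le> \<tau> (rk I x)}"
      then have "i \<in> \<tau> ` rk I ` I" "i \<le> \<tau> (rk I x)" unfolding img by auto
      then show "i \<in> (\<lambda>y. \<tau> (rk I y)) ` {y \<in> I. \<tau> (rk I y) \<le> \<tau> (rk I x)}" by blast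
    next
      fix i assume "i \<in> (\<lambda>y. \<tau> (rk I y)) ` {y \<in> I. \<tau> (rk I y) \<le> \<tau> (rk I x)}"
      then show "i \<in> {i \<in> {1..card I}. i \<le> \<tau> (rk I x)}" unfolding img[symmetric] by blast
    qed
    also have "card \<dots> = \<tau> (rk I x)"
    proof -
      have "\<tau> (rk I x) \<in> {1..card I}" using x img by blast
      then show ?thesis using rk_interval[of "\<tau> (rk I x)" "card I"] unfolding rk_def by simp
    qed
    finally show "\<tau> (rk I x) = rk (\<sigma> ` I) (\<sigma> x)" by simp
  qed
qed

text \<open>This reduces the counting of occurrences in large permutations to permutations of the size of
  their union.\<close>

lemma pat_pat:
  assumes K: "finite K" "inj_on \<sigma> K" and A: "A \<subseteq> K"
  shows "pat (pat \<sigma> K) (rk K ` A) = pat \<sigma> A"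
proof (rule pat_ext)
  have fA: "finite A" using K A finite_subset by blast
  have c: "card (rk K ` A) = card A"
    using rk_inj[OF K(1)] A by (meson card_image inj_on_subset)
  show "finite (rk K ` A)" using fA by simp
  show "pat \<sigma> A i = i" if "i \<notin> {1..card (rk K ` A)}" for i
    using that fA c by (simp add: pat_out)
  fix z assume "z \<in> rk K ` A"
  then obtain x where x: "x \<in> A" "z = rk K x" by blast
  have 1: "rk (rk K ` A) (rk K x) = rk A x"
    by (rule rk_image_mono[of K, OF rk_le_iff[OF K(1)] A subsetD[OF A x(1)]])
  have 2: "pat \<sigma> K ` rk K ` A = rk (\<sigma> ` K) ` \<sigma> ` A"
  proof -
    have "pat \<sigma> K (rk K y) = rk (\<sigma> ` K) (\<sigma> y)" if "y \<in> A" for y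
      using pat_rk[OF K(1)] that A by blast
    then show ?thesis unfolding image_image by (rule image_cong[OF refl])
  qed
  have 3: "rk (rk (\<sigma> ` K) ` \<sigma> ` A) (rk (\<sigma> ` K) (\<sigma> x)) = rk (\<sigma> ` A) (\<sigma> x)"
    by (rule rk_image_mono[of "\<sigma> ` K", OF rk_le_iff[OF finite_imageI[OF K(1)]] image_mono[OF A] imageI[OF subsetD[OF A x(1)]]])
  show "pat \<sigma> A (rk (rk K ` A) z) = rk (pat \<sigma> K ` rk K ` A) (pat \<sigma> K z)"
    unfolding x(2) 1 2 pat_rk[OF fA x(1)] pat_rk[OF K(1) subsetD[OF A x(1)]] 3 ..
qed

section \<open>Patterns of a uniform permutation\<close>

lemma pat_fiber_card_le:
  assumes K: "K \<subseteq> {1..n}" and \<rho>: "\<rho> permutes {1..card K}" and \<rho>': "\<rho>' permutes {1..card K}"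
  shows "card {\<sigma>. \<sigma> permutes {1..n} \<and> pat \<sigma> K = \<rho>} \<le> card {\<sigma>. \<sigma> permutes {1..n} \<and> pat \<sigma> K = \<rho>'}"
proof -
  have fK: "finite K" using K finite_subset by blast
  define \<pi> where "\<pi> = inv \<rho> \<circ> \<rho>'"
  have \<pi>: "\<pi> permutes {1..card K}" unfolding \<pi>_def using \<rho> \<rho>' permutes_inv permutes_compose by blast
  define h where "h x = (if x \<in> K then inv_into K (rk K) (\<pi> (rk K x)) else x)" for x
  have bij: "bij_betw (inv_into K (rk K) \<circ> (\<pi> \<circ> rk K)) K K"
    by (rule bij_betw_trans[OF bij_betw_trans[OF rk_bij[OF fK] permutes_imp_bij[OF \<pi>]] bij_betw_inv_into[OF rk_bij[OF fK]]])
  have "bij_betw h K K"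
    using bij bij_betw_cong[of K h "inv_into K (rk K) \<circ> (\<pi> \<circ> rk K)"] by (simp add: h_def)
  then have hK: "h permutes K" by (rule bij_imp_permutes) (simp add: h_def)
  then have hn: "h permutes {1..n}" using K permutes_subset by blast
  have rkh: "rk K (h x) = \<pi> (rk K x)" if "x \<in> K" for x
  proof -
    have "\<pi> (rk K x) \<in> rk K ` K"
      using rk_bounds[OF fK that] permutes_in_image[OF \<pi>] rk_image[OF fK] by simp
    then show ?thesis using that by (simp add: h_def f_inv_into_f)
  qed
  have key: "pat (\<sigma> \<circ> h) K = pat \<sigma> K \<circ> \<pi>" for \<sigma>
  proof (rule pat_ext[OF fK])
    show "(pat \<sigma> K \<circ> \<pi>) i = i" if "i \<notin> {1..card K}" for i
      using pat_out[OF fK that] permutes_not_in[OF \<pi> that] by simp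
    fix x assume x: "x \<in> K"
    have hx: "h x \<in> K" using permutes_in_image[OF hK] x by simp
    have "(\<sigma> \<circ> h) ` K = \<sigma> ` K" using permutes_image[OF hK] by (metis image_comp)
    then show "(pat \<sigma> K \<circ> \<pi>) (rk K x) = rk ((\<sigma> \<circ> h) ` K) ((\<sigma> \<circ> h) x)"
      using pat_rk[OF fK hx, of \<sigma>] rkh[OF x] by simp
  qed
  have inj: "inj_on (\<lambda>\<sigma>. \<sigma> \<circ> h) {\<sigma>. \<sigma> permutes {1..n} \<and> pat \<sigma> K = \<rho>}"
  proof (rule inj_onI)
    fix \<sigma> \<sigma>' assume "\<sigma> \<circ> h = \<sigma>' \<circ> h"
    then have "\<sigma> \<circ> (h \<circ> inv h) = \<sigma>' \<circ> (h \<circ> inv h)" by (simp add: o_assoc)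
    then show "\<sigma> = \<sigma>'" using permutes_inv_o(1)[OF hn] by simp
  qed
  have sub: "(\<lambda>\<sigma>. \<sigma> \<circ> h) ` {\<sigma>. \<sigma> permutes {1..n} \<and> pat \<sigma> K = \<rho>} \<subseteq> {\<sigma>. \<sigma> permutes {1..n} \<and> pat \<sigma> K = \<rho>'}"
  proof -
    have "\<rho> \<circ> \<pi> = \<rho>'" unfolding \<pi>_def using permutes_inv_o[OF \<rho>] by (simp add: o_assoc)
    then show ?thesis using key permutes_compose[OF hn] by auto
  qed
  have "finite {\<sigma>. \<sigma> permutes {1..n} \<and> pat \<sigma> K = \<rho>'}"
    using finite_permutations[of "{1..n}"] by (rule rev_finite_subset[OF _ ]) auto
  then show ?thesis using card_mono[OF _ sub] card_image[OF inj] by simp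
qed

text \<open>Permuting the entries at the positions in \<open>K\<close> acts transitively on the possible patterns, so all of
  them are equally frequent.\<close>

lemma sum_pat:
  fixes f :: "(nat \<Rightarrow> nat) \<Rightarrow> real"
  assumes K: "K \<subseteq> {1..n}"
  shows "(\<Sum>\<sigma> | \<sigma> permutes {1..n}. f (pat \<sigma> K)) =
    fact n / fact (card K) * (\<Sum>\<rho> | \<rho> permutes {1..card K}. f \<rho>)"
proof -
  let ?S = "{\<sigma>. \<sigma> permutes {1..n}}" and ?R = "{\<rho>. \<rho> permutes {1..card K}}"
  let ?F = "\<lambda>\<rho>. {\<sigma>. \<sigma> permutes {1..n} \<and> pat \<sigma> K = \<rho>}"
  have fK: "finite K" using K finite_subset by blast
  have fin: "finite ?S" "finite ?R" by (simp_all add: finite_permutations)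
  have const: "card (?F \<rho>) = card (?F id)" if "\<rho> \<in> ?R" for \<rho>
    using that pat_fiber_card_le[OF K, of \<rho> id] pat_fiber_card_le[OF K, of id \<rho>] permutes_id
    by (simp add: le_antisym)
  have sub: "(\<lambda>\<sigma>. pat \<sigma> K) ` ?S \<subseteq> ?R"
    using pat_permutes[OF fK] permutes_inj inj_on_subset by blast
  have grp: "(\<Sum>\<sigma>\<in>?S. g (pat \<sigma> K)) = real (card (?F id)) * (\<Sum>\<rho>\<in>?R. g \<rho>)" for g :: "(nat \<Rightarrow> nat) \<Rightarrow> real"
  proof -
    have "(\<Sum>\<sigma>\<in>?S. g (pat \<sigma> K)) = (\<Sum>\<rho>\<in>?R. \<Sum>\<sigma>\<in>{\<sigma> \<in> ?S. pat \<sigma> K = \<rho>}. g (pat \<sigma> K))"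
      by (rule sum.group[OF fin sub, symmetric])
    also have "\<dots> = (\<Sum>\<rho>\<in>?R. real (card (?F id)) * g \<rho>)"
    proof (rule sum.cong[OF refl])
      fix \<rho> assume "\<rho> \<in> ?R"
      have "(\<Sum>\<sigma>\<in>{\<sigma> \<in> ?S. pat \<sigma> K = \<rho>}. g (pat \<sigma> K)) = (\<Sum>\<sigma>\<in>{\<sigma> \<in> ?S. pat \<sigma> K = \<rho>}. g \<rho>)"
        by (rule sum.cong) auto
      then show "(\<Sum>\<sigma>\<in>{\<sigma> \<in> ?S. pat \<sigma> K = \<rho>}. g (pat \<sigma> K)) = real (card (?F id)) * g \<rho>"
        using const[OF \<open>\<rho> \<in> ?R\<close>] by simp
    qed
    finally show ?thesis by (simp add: sum_distrib_left)
  qed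
  have "card ?S = fact n" "card ?R = fact (card K)"
    by (simp_all add: card_permutations[OF refl])
  then have "real (fact n) = real (card (?F id)) * fact (card K)"
    using grp[of "\<lambda>_. 1"] by simp
  then have "real (card (?F id)) = fact n / fact (card K)" by (simp add: field_simps)
  then show ?thesis using grp by simp
qed

section \<open>Occurrences that share positions\<close>

definition occ :: "(nat \<Rightarrow> nat) \<Rightarrow> nat \<Rightarrow> (nat \<Rightarrow> nat) \<Rightarrow> nat set \<Rightarrow> nat set set" where
  "occ \<tau> m \<sigma> K = {\<alpha>. \<alpha> \<subseteq> K \<and> card \<alpha> = m \<and> pat \<sigma> \<alpha> = \<tau>}"

lemma finite_occ: "finite K \<Longrightarrow> finite (occ \<tau> m \<sigma> K)"
  unfolding occ_def by (rule finite_subset[of _ "Pow K"]) auto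

lemma occ_pat:
  assumes K: "finite K" "inj_on \<sigma> K"
  shows "occ \<tau> m (pat \<sigma> K) {1..card K} = (`) (rk K) ` occ \<tau> m \<sigma> K"
proof (intro set_eqI iffI)
  fix \<alpha>' assume a: "\<alpha>' \<in> occ \<tau> m (pat \<sigma> K) {1..card K}"
  then have "\<alpha>' \<subseteq> rk K ` K" using rk_image[OF K(1)] by (simp add: occ_def)
  then obtain \<alpha> where \<alpha>: "\<alpha> \<subseteq> K" "\<alpha>' = rk K ` \<alpha>" by (meson subset_imageE)
  have "card \<alpha>' = card \<alpha>" using \<alpha> rk_inj[OF K(1)] by (metis card_image inj_on_subset)
  then have "\<alpha> \<in> occ \<tau> m \<sigma> K" using a \<alpha> pat_pat[OF K \<alpha>(1)] by (simp add: occ_def)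
  then show "\<alpha>' \<in> (`) (rk K) ` occ \<tau> m \<sigma> K" using \<alpha>(2) by blast
next
  fix \<alpha>' assume "\<alpha>' \<in> (`) (rk K) ` occ \<tau> m \<sigma> K"
  then obtain \<alpha> where \<alpha>: "\<alpha> \<in> occ \<tau> m \<sigma> K" "\<alpha>' = rk K ` \<alpha>" by blast
  then have s: "\<alpha> \<subseteq> K" by (simp add: occ_def)
  have "card \<alpha>' = card \<alpha>" using \<alpha>(2) s rk_inj[OF K(1)] by (metis card_image inj_on_subset)
  moreover have "\<alpha>' \<subseteq> {1..card K}" using \<alpha>(2) s rk_image[OF K(1)] by blast
  ultimately show "\<alpha>' \<in> occ \<tau> m (pat \<sigma> K) {1..card K}"
    using \<alpha> pat_pat[OF K s] by (simp add: occ_def)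
qed

text \<open>Permutations of \<open>[m + j]\<close> that are the union of two occurrences. Two sets of size \<open>m\<close> cover \<open>[m + j]\<close>
exactly if they share \<open>m - j\<close> elements, so these are the permutations counted by \<open>L\<^sub>s(\<tau>)\<close> with
\<open>s = m - j\<close>.\<close>

definition overlapping :: "(nat \<Rightarrow> nat) \<Rightarrow> nat \<Rightarrow> nat \<Rightarrow> (nat \<Rightarrow> nat) set" where
  "overlapping \<tau> m j = {\<rho>. \<rho> permutes {1..m+j} \<and>
     (\<exists>\<alpha>\<in>occ \<tau> m \<rho> {1..m+j}. \<exists>\<beta>\<in>occ \<tau> m \<rho> {1..m+j}. \<alpha> \<union> \<beta> = {1..m+j})}"

text \<open>An occurrence \<open>\<alpha>\<close> whose complement is contained in every other occurrence, together with the
permutation. If several occurrences have this property, their complements are disjoint like the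
petals of a flower. The condition on the minima can leave out only the one whose complement starts
first, and it fixes the first letter of the interleaving word in the encoding below.\<close>

definition petals :: "(nat \<Rightarrow> nat) \<Rightarrow> nat \<Rightarrow> nat \<Rightarrow> ((nat \<Rightarrow> nat) \<times> nat set) set" where
  "petals \<tau> m j = {(\<rho>, \<alpha>). \<rho> permutes {1..m+j} \<and> \<alpha> \<in> occ \<tau> m \<rho> {1..m+j} \<and>
     (\<forall>\<gamma>\<in>occ \<tau> m \<rho> {1..m+j}. \<gamma> \<noteq> \<alpha> \<longrightarrow> {1..m+j} - \<alpha> \<subseteq> \<gamma>) \<and>
     (\<exists>\<beta>\<in>occ \<tau> m \<rho> {1..m+j}. \<beta> \<noteq> \<alpha> \<and> Min ({1..m+j} - \<beta>) < Min ({1..m+j} - \<alpha>))}"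

lemma overlap_eq_card_overlapping:
  assumes "1 \<le> j" "j < m"
  shows "overlap m \<tau> (m - j) = card (overlapping \<tau> m j)"
proof -
  have N: "2 * m - (m - j) = m + j" using assms by simp
  have *: "card (I \<inter> J) = m - j \<longleftrightarrow> I \<union> J = {1..m+j}"
    if "I \<subseteq> {1..m+j}" "card I = m" "J \<subseteq> {1..m+j}" "card J = m" for I J :: "nat set"
  proof -
    have f: "finite I" "finite J" using that finite_subset by blast+
    have "card (I \<union> J) + card (I \<inter> J) = 2 * m" using card_Un_Int[OF f] that by simp
    moreover have "I \<union> J = {1..m+j} \<longleftrightarrow> card (I \<union> J) = m + j"
      using card_subset_eq[of "{1..m+j}" "I \<union> J"] that by auto
    ultimately show ?thesis using assms by auto
  qed
  have "{\<sigma>. \<sigma> permutes {1..m+j} \<and>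
     (\<exists>I J. I \<subseteq> {1..m+j} \<and> card I = m \<and> J \<subseteq> {1..m+j} \<and> card J = m \<and>
            card (I \<inter> J) = m - j \<and> pat \<sigma> I = \<tau> \<and> pat \<sigma> J = \<tau>)} = overlapping \<tau> m j"
    (is "?A = _")
  proof (intro set_eqI iffI)
    fix \<sigma> assume "\<sigma> \<in> ?A"
    then obtain I J where "\<sigma> permutes {1..m+j}" "I \<subseteq> {1..m+j}" "card I = m" "J \<subseteq> {1..m+j}" "card J = m"
      "card (I \<inter> J) = m - j" "pat \<sigma> I = \<tau>" "pat \<sigma> J = \<tau>" by blast
    then show "\<sigma> \<in> overlapping \<tau> m j"
      unfolding overlapping_def occ_def using *[of I J] by auto
  next
    fix \<sigma> assume "\<sigma> \<in> overlapping \<tau> m j"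
    then obtain I J where "\<sigma> permutes {1..m+j}" "I \<subseteq> {1..m+j}" "card I = m" "J \<subseteq> {1..m+j}" "card J = m"
      "I \<union> J = {1..m+j}" "pat \<sigma> I = \<tau>" "pat \<sigma> J = \<tau>" unfolding overlapping_def occ_def by blast
    then show "\<sigma> \<in> ?A" using *[of I J] by blast
  qed
  then show ?thesis unfolding overlap_def N by simp
qed

section \<open>Charging occurrences to unions\<close>

text \<open>The set \<open>P\<close> stands for the occurrences charged to \<open>K\<close>. By the last premise any two of them have
disjoint complements in \<open>K\<close>, so the minima of these complements differ. The occurrence with the
smallest minimum accounts for the first summand, and it is the witness that makes all the others
petals.\<close>

lemma card_nearest_occ_le:
  fixes \<sigma> :: "nat \<Rightarrow> nat"
  assumes K: "finite K" "inj_on \<sigma> K" "card K = m + j" and j: "0 < j"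
    and P: "P \<subseteq> occ \<tau> m \<sigma> K"
    and near: "\<And>\<alpha>. \<alpha> \<in> P \<Longrightarrow> \<exists>\<beta>\<in>occ \<tau> m \<sigma> K. \<alpha> \<union> \<beta> = K"
    and iso: "\<And>\<alpha> \<gamma>. \<alpha> \<in> P \<Longrightarrow> \<gamma> \<in> occ \<tau> m \<sigma> K \<Longrightarrow> \<gamma> \<noteq> \<alpha> \<Longrightarrow> K - \<alpha> \<subseteq> \<gamma>"
  shows "card P \<le> of_bool (pat \<sigma> K \<in> overlapping \<tau> m j) + card {\<alpha>. (pat \<sigma> K, \<alpha>) \<in> petals \<tau> m j}"
proof (cases "P = {}")
  case False
  let ?r = "(`) (rk K)" and ?N = "{1..m+j}"
  have perm: "pat \<sigma> K permutes ?N" using pat_permutes[OF K(1,2)] K(3) by simp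
  have occ': "occ \<tau> m (pat \<sigma> K) ?N = ?r ` occ \<tau> m \<sigma> K" using occ_pat[OF K(1,2)] K(3) by simp
  have rN: "rk K ` K = ?N" using rk_image[OF K(1)] K(3) by simp
  have injr: "inj_on (rk K) K" using rk_inj[OF K(1)] .
  have sub: "\<alpha> \<subseteq> K" "card \<alpha> = m" if "\<alpha> \<in> occ \<tau> m \<sigma> K" for \<alpha> using that by (auto simp: occ_def)
  have compl: "?N - ?r \<alpha> = ?r (K - \<alpha>)" if "\<alpha> \<subseteq> K" for \<alpha>
    using inj_on_image_set_diff[OF injr, of K \<alpha>] rN that by auto
  have Min_r: "Min (?r A) = rk K (Min A)" if "A \<subseteq> K" "A \<noteq> {}" for A
    using mono_Min_commute[of "rk K" A] rk_mono[OF K(1)] that finite_subset[OF that(1) K(1)]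
    by (simp add: mono_def)
  have ne: "K - \<alpha> \<noteq> {}" if "\<alpha> \<in> occ \<tau> m \<sigma> K" for \<alpha>
    using sub[OF that] K(3) j by auto
  have fK: "finite (K - \<alpha>)" for \<alpha> using K(1) by simp
  have "finite P" using P finite_occ[OF K(1)] finite_subset by blast
  obtain a where "a \<in> P" using False by blast
  from ex_has_least_nat[of "\<lambda>\<alpha>. \<alpha> \<in> P", OF this, of "\<lambda>\<alpha>. Min (K - \<alpha>)"]
  obtain \<alpha>0 where \<alpha>0: "\<alpha>0 \<in> P" "\<And>\<alpha>. \<alpha> \<in> P \<Longrightarrow> Min (K - \<alpha>0) \<le> Min (K - \<alpha>)" by blast
  have in_petals: "(pat \<sigma> K, ?r \<alpha>) \<in> petals \<tau> m j" if "\<alpha> \<in> P - {\<alpha>0}" for \<alpha>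
  proof -
    have a: "\<alpha> \<in> occ \<tau> m \<sigma> K" "\<alpha>0 \<in> occ \<tau> m \<sigma> K" "\<alpha> \<noteq> \<alpha>0"
      using that subsetD[OF P, of \<alpha>] subsetD[OF P \<alpha>0(1)] by simp_all
    have M: "Min (K - \<alpha>) \<in> K - \<alpha>" "Min (K - \<alpha>0) \<in> K - \<alpha>0"
      using Min_in[OF fK ne[OF a(1)]] Min_in[OF fK ne[OF a(2)]] .
    have "K - \<alpha>0 \<subseteq> \<alpha>" using iso[OF \<alpha>0(1) a(1)] a(3) by simp
    with M have "Min (K - \<alpha>) \<noteq> Min (K - \<alpha>0)" by auto
    then have lt: "Min (K - \<alpha>0) < Min (K - \<alpha>)" using \<alpha>0(2)[of \<alpha>] that by simp
    have m0: "Min (K - \<alpha>0) \<in> K" "Min (K - \<alpha>) \<in> K" using M by simp_all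
    have "Min (?N - ?r \<alpha>0) < Min (?N - ?r \<alpha>)"
      using compl[OF sub(1)[OF a(1)]] compl[OF sub(1)[OF a(2)]] Min_r[of "K - \<alpha>"] Min_r[of "K - \<alpha>0"]
        ne[OF a(1)] ne[OF a(2)] lt rk_less_iff[OF K(1) m0] by simp
    moreover have "?r \<alpha>0 \<noteq> ?r \<alpha>"
      using inj_on_image_eq_iff[OF injr sub(1)[OF a(2)] sub(1)[OF a(1)]] a(3) by simp
    moreover have "?N - ?r \<alpha> \<subseteq> \<gamma>'" if "\<gamma>' \<in> occ \<tau> m (pat \<sigma> K) ?N" "\<gamma>' \<noteq> ?r \<alpha>" for \<gamma>'
    proof -
      from that(1) obtain \<gamma> where g: "\<gamma> \<in> occ \<tau> m \<sigma> K" "\<gamma>' = ?r \<gamma>" unfolding occ' by (rule imageE)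
      have "\<alpha> \<in> P" using \<open>\<alpha> \<in> P - {\<alpha>0}\<close> by simp
      then have "K - \<alpha> \<subseteq> \<gamma>" using that(2) g by (intro iso) auto
      then show ?thesis unfolding g(2) compl[OF sub(1)[OF a(1)]] by (rule image_mono)
    qed
    moreover have "?r \<alpha> \<in> occ \<tau> m (pat \<sigma> K) ?N" "?r \<alpha>0 \<in> occ \<tau> m (pat \<sigma> K) ?N"
      using a(1,2) unfolding occ' by simp_all
    ultimately show ?thesis using perm unfolding petals_def by blast
  qed
  have "card (P - {\<alpha>0}) \<le> card {\<alpha>. (pat \<sigma> K, \<alpha>) \<in> petals \<tau> m j}"
  proof (rule card_inj_on_le)
    show "inj_on ?r (P - {\<alpha>0})"
    proof (rule inj_onI)
      fix \<alpha> \<gamma> assume "\<alpha> \<in> P - {\<alpha>0}" "\<gamma> \<in> P - {\<alpha>0}" "?r \<alpha> = ?r \<gamma>"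
      moreover from this have "\<alpha> \<subseteq> K" "\<gamma> \<subseteq> K" using subsetD[OF P, of \<alpha>] subsetD[OF P, of \<gamma>] sub(1) by simp_all
      ultimately show "\<alpha> = \<gamma>" using inj_on_image_eq_iff[OF injr, of \<alpha> \<gamma>] by simp
    qed
    show "?r ` (P - {\<alpha>0}) \<subseteq> {\<alpha>. (pat \<sigma> K, \<alpha>) \<in> petals \<tau> m j}" using in_petals by blast
    show "finite {\<alpha>. (pat \<sigma> K, \<alpha>) \<in> petals \<tau> m j}"
      by (rule finite_subset[of _ "Pow ?N"]) (auto simp: petals_def occ_def)
  qed
  moreover have "pat \<sigma> K \<in> overlapping \<tau> m j"
  proof -
    obtain \<beta> where b: "\<beta> \<in> occ \<tau> m \<sigma> K" "\<alpha>0 \<union> \<beta> = K" using near[OF \<alpha>0(1)] by blast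
    then have "?r \<alpha>0 \<union> ?r \<beta> = ?N" using rN by (metis image_Un)
    moreover have "?r \<alpha>0 \<in> occ \<tau> m (pat \<sigma> K) ?N" "?r \<beta> \<in> occ \<tau> m (pat \<sigma> K) ?N"
      using b(1) subsetD[OF P \<alpha>0(1)] unfolding occ' by simp_all
    ultimately show ?thesis unfolding overlapping_def using perm by blast
  qed
  moreover have "card P = Suc (card (P - {\<alpha>0}))"
    using card_Suc_Diff1[OF \<open>finite P\<close> \<alpha>0(1)] by simp
  ultimately show ?thesis by simp
qed simp

text \<open>If there are at least two occurrences and any two of them meet, every occurrence \<open>\<alpha>\<close> is
  charged to its union \<open>K\<close> with a nearest other occurrence. Nearness forces every other occurrence
  inside \<open>K\<close> to contain \<open>K - \<alpha>\<close>, so the occurrences charged to \<open>K\<close> are the complements of disjoint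
  sets of the same size. The one whose complement has the smallest minimum is paid for by \<open>K\<close>,
  the others by \<open>petals\<close>.\<close>

lemma card_occ_le:
  fixes \<sigma> :: "nat \<Rightarrow> nat"
  assumes \<sigma>: "inj_on \<sigma> {1..n}" and n: "n < 2 * m" and two: "2 \<le> card (occ \<tau> m \<sigma> {1..n})"
  shows "card (occ \<tau> m \<sigma> {1..n}) \<le> (\<Sum>j = 1..m - 1. \<Sum>K | K \<subseteq> {1..n} \<and> card K = m + j.
    of_bool (pat \<sigma> K \<in> overlapping \<tau> m j) + card {\<alpha>. (pat \<sigma> K, \<alpha>) \<in> petals \<tau> m j})"
proof -
  let ?O = "occ \<tau> m \<sigma> {1..n}"
  have fO: "finite ?O" by (simp add: finite_occ)
  have sub: "\<alpha> \<subseteq> {1..n}" "card \<alpha> = m" "finite \<alpha>" if "\<alpha> \<in> ?O" for \<alpha>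
    using that finite_subset[of \<alpha> "{1..n}"] by (auto simp: occ_def)
  have "\<exists>\<beta>\<in>?O - {\<alpha>}. \<forall>\<gamma>\<in>?O - {\<alpha>}. card (\<beta> - \<alpha>) \<le> card (\<gamma> - \<alpha>)" if "\<alpha> \<in> ?O" for \<alpha>
  proof -
    have "card (?O - {\<alpha>}) > 0" using two that fO by simp
    then have "?O - {\<alpha>} \<noteq> {}" by (metis card_gt_0_iff)
    then obtain \<beta> where "\<beta> \<in> ?O - {\<alpha>}" by blast
    from ex_has_least_nat[of "\<lambda>\<beta>. \<beta> \<in> ?O - {\<alpha>}", OF this, of "\<lambda>\<beta>. card (\<beta> - \<alpha>)"]
    show ?thesis by blast
  qed
  then obtain near where near: "\<And>\<alpha>. \<alpha> \<in> ?O \<Longrightarrow> near \<alpha> \<in> ?O - {\<alpha>}"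
    "\<And>\<alpha> \<gamma>. \<alpha> \<in> ?O \<Longrightarrow> \<gamma> \<in> ?O - {\<alpha>} \<Longrightarrow> card (near \<alpha> - \<alpha>) \<le> card (\<gamma> - \<alpha>)" by metis
  define U where "U \<alpha> = \<alpha> \<union> near \<alpha>" for \<alpha>
  define P where "P K = {\<alpha> \<in> ?O. U \<alpha> = K}" for K
  let ?Ks = "\<lambda>j. {K. K \<subseteq> {1..n} \<and> card K = m + j}"
  have size: "\<exists>j\<in>{1..m-1}. U \<alpha> \<in> ?Ks j" if a: "\<alpha> \<in> ?O" for \<alpha>
  proof -
    have b: "near \<alpha> \<in> ?O" "near \<alpha> \<noteq> \<alpha>" using near(1)[OF a] by auto
    have U: "U \<alpha> \<subseteq> {1..n}" using sub a b unfolding U_def by blast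
    have "U \<alpha> = \<alpha> \<union> (near \<alpha> - \<alpha>)" unfolding U_def by auto
    then have c: "card (U \<alpha>) = m + card (near \<alpha> - \<alpha>)"
      using card_Un_disjoint[of \<alpha> "near \<alpha> - \<alpha>"] sub[OF a] sub[OF b(1)] by auto
    have "near \<alpha> - \<alpha> \<noteq> {}" using card_subset_eq[of \<alpha> "near \<alpha>"] sub[OF a] sub[OF b(1)] b(2) by auto
    then have "card (near \<alpha> - \<alpha>) > 0" using sub[OF b(1)] by (simp add: card_gt_0_iff)
    moreover have "card (U \<alpha>) \<le> n" using card_mono[OF _ U] by simp
    ultimately show ?thesis using U c n by (intro bexI[of _ "card (near \<alpha> - \<alpha>)"]) auto
  qed
  have bound: "card (P K) \<le> of_bool (pat \<sigma> K \<in> overlapping \<tau> m j) + card {\<alpha>. (pat \<sigma> K, \<alpha>) \<in> petals \<tau> m j}"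
    if K: "K \<in> ?Ks j" and j: "j \<in> {1..m-1}" for K j
  proof (rule card_nearest_occ_le)
    show "finite K" using K finite_subset by blast
    show "inj_on \<sigma> K" using K \<sigma> inj_on_subset by blast
    show "card K = m + j" "0 < j" using K j by auto
    have mem: "\<alpha> \<in> occ \<tau> m \<sigma> K" if "\<alpha> \<in> ?O" "\<alpha> \<subseteq> K" for \<alpha> using that by (simp add: occ_def)
    show "P K \<subseteq> occ \<tau> m \<sigma> K" unfolding P_def U_def using mem by blast
    show "\<exists>\<beta>\<in>occ \<tau> m \<sigma> K. \<alpha> \<union> \<beta> = K" if "\<alpha> \<in> P K" for \<alpha>
      using that near(1)[of \<alpha>] mem[of "near \<alpha>"] unfolding P_def U_def by blast
    fix \<alpha> \<gamma> assume a: "\<alpha> \<in> P K" and g: "\<gamma> \<in> occ \<tau> m \<sigma> K" "\<gamma> \<noteq> \<alpha>"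
    have aO: "\<alpha> \<in> ?O" and UK: "\<alpha> \<union> near \<alpha> = K" using a unfolding P_def U_def by auto
    have gO: "\<gamma> \<in> ?O - {\<alpha>}" using g K by (auto simp: occ_def)
    have "K - \<alpha> = near \<alpha> - \<alpha>" using UK by auto
    then have "card (K - \<alpha>) \<le> card (\<gamma> - \<alpha>)" using near(2)[OF aO gO] by simp
    moreover have "\<gamma> - \<alpha> \<subseteq> K - \<alpha>" using g by (auto simp: occ_def)
    ultimately have "\<gamma> - \<alpha> = K - \<alpha>" using card_seteq[of "K - \<alpha>" "\<gamma> - \<alpha>"] \<open>finite K\<close> by auto
    then show "K - \<alpha> \<subseteq> \<gamma>" by auto
  qed
  have fKs: "finite (?Ks j)" for j by (rule finite_subset[of _ "Pow {1..n}"]) auto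
  have "?O \<subseteq> (\<Union>j\<in>{1..m-1}. \<Union>K\<in>?Ks j. P K)" using size unfolding P_def by blast
  then have "card ?O \<le> card (\<Union>j\<in>{1..m-1}. \<Union>K\<in>?Ks j. P K)"
    using fKs fO by (intro card_mono) (auto simp: P_def)
  also have "\<dots> \<le> (\<Sum>j = 1..m-1. card (\<Union>K\<in>?Ks j. P K))" by (rule card_UN_le) simp
  also have "\<dots> \<le> (\<Sum>j = 1..m-1. \<Sum>K\<in>?Ks j. card (P K))"
    by (intro sum_mono card_UN_le fKs)
  also have "\<dots> \<le> (\<Sum>j = 1..m-1. \<Sum>K\<in>?Ks j.
      of_bool (pat \<sigma> K \<in> overlapping \<tau> m j) + card {\<alpha>. (pat \<sigma> K, \<alpha>) \<in> petals \<tau> m j})"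
    by (intro sum_mono bound)
  finally show ?thesis .
qed

text \<open>The bound of the previous lemma depends on \<open>\<sigma>\<close> only through the patterns of the sets \<open>K\<close>, and these
are uniformly distributed, so only permutations of \<open>[m + j]\<close> remain to be counted.\<close>

lemma sum_card_occ_le:
  fixes n m :: nat and \<tau> :: "nat \<Rightarrow> nat"
  defines "w \<equiv> \<lambda>\<sigma>. card (occ \<tau> m \<sigma> {1..n})"
  assumes n: "n < 2 * m"
  shows "(\<Sum>\<sigma> | \<sigma> permutes {1..n}. real (w \<sigma>) * of_bool (2 \<le> w \<sigma>)) \<le>
    fact n * (\<Sum>j = 1..m - 1. real (n choose (m + j)) *
      ((card (overlapping \<tau> m j) + card (petals \<tau> m j)) / fact (m + j)))"
proof -
  let ?S = "{\<sigma>. \<sigma> permutes {1..n}}" and ?Ks = "\<lambda>j. {K. K \<subseteq> {1..n} \<and> card K = m + j}"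
  define f where "f j \<rho> = real (of_bool (\<rho> \<in> overlapping \<tau> m j) + card {\<alpha>. (\<rho>, \<alpha>) \<in> petals \<tau> m j})" for j \<rho>
  have "real (w \<sigma>) * of_bool (2 \<le> w \<sigma>) \<le> (\<Sum>j = 1..m - 1. \<Sum>K\<in>?Ks j. f j (pat \<sigma> K))" if "\<sigma> \<in> ?S" for \<sigma>
  proof (cases "2 \<le> w \<sigma>")
    case True
    have "inj_on \<sigma> {1..n}" using that permutes_inj inj_on_subset by blast
    then have "real (w \<sigma>) \<le> real (\<Sum>j = 1..m - 1. \<Sum>K\<in>?Ks j.
       of_bool (pat \<sigma> K \<in> overlapping \<tau> m j) + card {\<alpha>. (pat \<sigma> K, \<alpha>) \<in> petals \<tau> m j})"
      using card_occ_le[OF _ n, of \<sigma> \<tau>] True unfolding w_def of_nat_le_iff by simp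
    also have "\<dots> = (\<Sum>j = 1..m - 1. \<Sum>K\<in>?Ks j. f j (pat \<sigma> K))" unfolding of_nat_sum f_def ..
    finally show ?thesis using True by simp
  qed (auto simp: f_def intro!: sum_nonneg)
  then have "(\<Sum>\<sigma>\<in>?S. real (w \<sigma>) * of_bool (2 \<le> w \<sigma>)) \<le> (\<Sum>\<sigma>\<in>?S. \<Sum>j = 1..m - 1. \<Sum>K\<in>?Ks j. f j (pat \<sigma> K))"
    by (rule sum_mono)
  also have "\<dots> = (\<Sum>j = 1..m - 1. \<Sum>K\<in>?Ks j. \<Sum>\<sigma>\<in>?S. f j (pat \<sigma> K))"
    by (subst sum.swap, rule sum.cong[OF refl], rule sum.swap)
  also have "\<dots> = (\<Sum>j = 1..m - 1. \<Sum>K\<in>?Ks j. fact n / fact (m + j) * (card (overlapping \<tau> m j) + card (petals \<tau> m j)))"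
  proof (intro sum.cong refl)
    fix j K assume K: "K \<in> ?Ks j"
    let ?R = "{\<rho>. \<rho> permutes {1..m+j}}"
    have fR: "finite ?R" by (simp add: finite_permutations)
    have "card (petals \<tau> m j) = (\<Sum>\<rho>\<in>?R. card {\<alpha>. (\<rho>, \<alpha>) \<in> petals \<tau> m j})"
    proof -
      have "finite {\<alpha>. (\<rho>, \<alpha>) \<in> petals \<tau> m j}" for \<rho>
        by (rule finite_subset[of _ "Pow {1..m+j}"]) (auto simp: petals_def occ_def)
      then have c: "card (SIGMA \<rho>:?R. {\<alpha>. (\<rho>, \<alpha>) \<in> petals \<tau> m j}) = (\<Sum>\<rho>\<in>?R. card {\<alpha>. (\<rho>, \<alpha>) \<in> petals \<tau> m j})"
        using fR by (intro card_SigmaI) auto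
      have s: "(SIGMA \<rho>:?R. {\<alpha>. (\<rho>, \<alpha>) \<in> petals \<tau> m j}) = petals \<tau> m j" by (auto simp: petals_def)
      show ?thesis using c unfolding s .
    qed
    moreover have "card (overlapping \<tau> m j) = (\<Sum>\<rho>\<in>?R. of_bool (\<rho> \<in> overlapping \<tau> m j))"
    proof -
      have "?R \<inter> overlapping \<tau> m j = overlapping \<tau> m j" by (auto simp: overlapping_def)
      then show ?thesis using fR by (simp add: of_bool_def sum.If_cases)
    qed
    ultimately have "(\<Sum>\<rho>\<in>?R. f j \<rho>) = card (overlapping \<tau> m j) + card (petals \<tau> m j)"
      unfolding f_def by (simp add: sum.distrib)
    then show "(\<Sum>\<sigma>\<in>?S. f j (pat \<sigma> K)) = fact n / fact (m + j) * (card (overlapping \<tau> m j) + card (petals \<tau> m j))"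
      using sum_pat[of K n "f j"] K by simp
  qed
  also have "\<dots> = fact n * (\<Sum>j = 1..m - 1. real (n choose (m + j)) *
      ((card (overlapping \<tau> m j) + card (petals \<tau> m j)) / fact (m + j)))"
    by (simp add: sum_distrib_left n_subsets mult_ac)
  finally show ?thesis .
qed

section \<open>Encoding petals by two words\<close>

lemma pat_order_iso:
  assumes I: "finite I" and h: "bij_betw h I J"
    and pos: "\<And>x y. x \<in> I \<Longrightarrow> y \<in> I \<Longrightarrow> h x \<le> h y \<longleftrightarrow> x \<le> y"
    and val: "\<And>x y. x \<in> I \<Longrightarrow> y \<in> I \<Longrightarrow> \<sigma> (h x) \<le> \<sigma> (h y) \<longleftrightarrow> \<sigma> x \<le> \<sigma> y"
    and inj: "inj_on \<sigma> I"
  shows "pat \<sigma> I = pat \<sigma> J"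
proof (rule pat_ext[OF I])
  have J: "J = h ` I" using h by (simp add: bij_betw_def)
  have fJ: "finite J" using I J by simp
  show "pat \<sigma> J i = i" if "i \<notin> {1..card I}" for i
    using that pat_out[OF fJ] bij_betw_same_card[OF h] by simp
  fix x assume x: "x \<in> I"
  have 1: "rk J (h x) = rk I x" unfolding J by (rule rk_image_mono[OF pos order_refl x])
  define g where "g v = \<sigma> (h (inv_into I \<sigma> v))" for v
  have g: "g (\<sigma> y) = \<sigma> (h y)" if "y \<in> I" for y using that inj by (simp add: g_def)
  have "rk (g ` \<sigma> ` I) (g (\<sigma> x)) = rk (\<sigma> ` I) (\<sigma> x)"
  proof (rule rk_image_mono[OF _ order_refl])
    show "g u \<le> g v \<longleftrightarrow> u \<le> v" if "u \<in> \<sigma> ` I" "v \<in> \<sigma> ` I" for u v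
      using that g val by auto
    show "\<sigma> x \<in> \<sigma> ` I" using x by simp
  qed
  moreover have "g ` \<sigma> ` I = \<sigma> ` J" unfolding J image_image using g by (rule image_cong[OF refl])
  ultimately show "pat \<sigma> J (rk I x) = rk (\<sigma> ` I) (\<sigma> x)"
    using pat_rk[OF fJ, of "h x" \<sigma>] 1 g[OF x] x J by simp
qed

text \<open>The interleaving of two disjoint sets, recorded by the places of the elements of \<open>X\<close> among all
elements of \<open>X \<union> B\<close>.\<close>

definition word :: "nat set \<Rightarrow> nat set \<Rightarrow> nat set" where
  "word X B = rk (X \<union> B) ` X"

lemma rk_word:
  assumes "finite X" "finite B" "X \<inter> B = {}"
  shows "word X B \<subseteq> {1..card X + card B}" "card (word X B) = card X"
    and "x \<in> X \<Longrightarrow> rk X x + rk B x \<in> word X B"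
    and "x \<in> X \<Longrightarrow> rk (word X B) (rk X x + rk B x) = rk X x"
proof -
  have f: "finite (X \<union> B)" using assms by simp
  show "word X B \<subseteq> {1..card X + card B}"
    using rk_image[OF f] card_Un_disjoint[OF assms] unfolding word_def by auto
  show "card (word X B) = card X"
    unfolding word_def by (rule card_image[OF inj_on_subset[OF rk_inj[OF f]]]) simp
  assume x: "x \<in> X"
  have *: "rk (X \<union> B) x = rk X x + rk B x" by (rule rk_Un[OF assms])
  show "rk X x + rk B x \<in> word X B" unfolding word_def *[symmetric] using x by (rule imageI)
  show "rk (word X B) (rk X x + rk B x) = rk X x"
    unfolding word_def *[symmetric]
    by (rule rk_image_mono[of "X \<union> B", OF rk_le_iff[OF f]]) (use x in auto)
qed

text \<open>The place of the element of rank \<open>r\<close> in \<open>X\<close> is \<open>r\<close> plus the number of elements of \<open>B\<close> before it.\<close>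

lemma word_determines:
  assumes "finite X" "finite B" "X \<inter> B = {}" "finite X'" "finite B'" "X' \<inter> B' = {}"
    and "word X B = word X' B'" "x \<in> X" "x' \<in> X'" "rk X x = rk X' x'"
  shows "rk B x = rk B' x'"
proof -
  have f: "finite (word X B)" unfolding word_def using assms by simp
  have "rk X x + rk B x = rk X' x' + rk B' x'"
  proof (rule inj_onD[OF rk_inj[OF f]])
    show "rk X x + rk B x \<in> word X B" using rk_word(3)[OF assms(1-3)] assms(8) .
    show "rk X' x' + rk B' x' \<in> word X B" using rk_word(3)[OF assms(4-6)] assms(7,9) by simp
    show "rk (word X B) (rk X x + rk B x) = rk (word X B) (rk X' x' + rk B' x')"
      using rk_word(4)[OF assms(1-3,8)] rk_word(4)[OF assms(4-6,9)] assms(7,10) by simp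
  qed
  then show ?thesis using assms(10) by simp
qed

text \<open>In the interleaving of \<open>X\<close> and \<open>B\<close>, the \<open>t\<close>-th element of \<open>X\<close> has \<open>t\<close> or \<open>t - 1\<close> elements of \<open>B\<close>
before it.\<close>

definition balanced :: "nat set \<Rightarrow> nat \<Rightarrow> bool" where
  "balanced P t \<longleftrightarrow> (\<exists>p\<in>P. rk P p = t \<and> (p = 2 * t \<or> Suc p = 2 * t))"

lemma balanced_word:
  assumes "finite X" "finite B" "X \<inter> B = {}" "x \<in> X"
  shows "balanced (word X B) (rk X x) \<longleftrightarrow> rk B x = rk X x \<or> Suc (rk B x) = rk X x"
proof
  have f: "finite (word X B)" unfolding word_def using assms by simp
  assume "balanced (word X B) (rk X x)"
  then obtain p where p: "p \<in> word X B" "rk (word X B) p = rk X x" "p = 2 * rk X x \<or> Suc p = 2 * rk X x"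
    unfolding balanced_def by blast
  have "p = rk X x + rk B x"
    using inj_onD[OF rk_inj[OF f], of p] p(1,2) rk_word(3,4)[OF assms] by simp
  then show "rk B x = rk X x \<or> Suc (rk B x) = rk X x" using p(3) by auto
next
  assume "rk B x = rk X x \<or> Suc (rk B x) = rk X x"
  then show "balanced (word X B) (rk X x)"
    unfolding balanced_def using rk_word(3,4)[OF assms] by (intro bexI[of _ "rk X x + rk B x"]) auto
qed

lemma adjacent_rank:
  assumes "finite A" "a \<in> A" "x \<notin> A" "rk A x = rk A a \<or> Suc (rk A x) = rk A a" "e \<in> A" "e \<noteq> a"
  shows "e \<le> x \<longleftrightarrow> e \<le> a"
proof -
  have "e \<le> x \<longleftrightarrow> rk A e \<le> rk A x"
    using rk_mono[OF assms(1), of e x] rk_less[OF assms(1,5), of x] by (meson not_le)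
  moreover have "rk A e \<noteq> rk A a" using rk_inj[OF assms(1)] assms(2,5,6) by (auto dest: inj_onD)
  moreover have "e \<le> a \<longleftrightarrow> rk A e \<le> rk A a" using rk_le_iff[OF assms(1,5,2)] by simp
  ultimately show ?thesis using assms(4) by auto
qed

text \<open>If \<open>x\<close> and \<open>a\<close> are neighbours, both in position and in value, from the point of view of all other
elements of \<open>\<alpha>\<close>, then \<open>x\<close> can take the role of \<open>a\<close>.\<close>

lemma occ_exchange:
  assumes \<rho>: "inj_on \<rho> K" and K: "finite K" and \<alpha>: "\<alpha> \<in> occ \<tau> m \<rho> K" and a: "a \<in> \<alpha>" and x: "x \<in> K - \<alpha>"
    and pos: "rk \<alpha> x = rk \<alpha> a \<or> Suc (rk \<alpha> x) = rk \<alpha> a"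
    and val: "rk (\<rho> ` \<alpha>) (\<rho> x) = rk (\<rho> ` \<alpha>) (\<rho> a) \<or> Suc (rk (\<rho> ` \<alpha>) (\<rho> x)) = rk (\<rho> ` \<alpha>) (\<rho> a)"
  shows "insert x (\<alpha> - {a}) \<in> occ \<tau> m \<rho> K"
proof -
  let ?\<gamma> = "insert x (\<alpha> - {a})"
  have sub: "\<alpha> \<subseteq> K" "card \<alpha> = m" "pat \<rho> \<alpha> = \<tau>" using \<alpha> by (auto simp: occ_def)
  have f: "finite \<alpha>" using sub K finite_subset by blast
  define h where "h y = (if y = x then a else y)" for y
  have bij: "bij_betw h ?\<gamma> \<alpha>"
    unfolding bij_betw_def h_def using a x by (auto simp: inj_on_def)
  have px: "e \<le> x \<longleftrightarrow> e \<le> a" if "e \<in> \<alpha>" "e \<noteq> a" for e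
    using adjacent_rank[OF f a _ pos that] x by simp
  have vx: "\<rho> e \<le> \<rho> x \<longleftrightarrow> \<rho> e \<le> \<rho> a" if "e \<in> \<alpha>" "e \<noteq> a" for e
  proof (rule adjacent_rank[of "\<rho> ` \<alpha>", OF _ _ _ val])
    show "\<rho> x \<notin> \<rho> ` \<alpha>" using inj_on_image_mem_iff[OF \<rho>, of x \<alpha>] x sub(1) by simp
    show "\<rho> e \<noteq> \<rho> a" using inj_onD[OF \<rho>, of e a] that a sub(1) by auto
  qed (use that a f in auto)
  have \<rho>eq: "\<rho> u = \<rho> v \<longleftrightarrow> u = v" if "u \<in> K" "v \<in> K" for u v using inj_on_eq_iff[OF \<rho> that] .
  have aK: "a \<in> K" "x \<in> K" using a x sub(1) by auto
  have "pat \<rho> ?\<gamma> = pat \<rho> \<alpha>"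
  proof (rule pat_order_iso[OF _ bij])
    show "finite ?\<gamma>" using f by simp
    show "inj_on \<rho> ?\<gamma>" using inj_on_subset[OF \<rho>] sub(1) x by blast
    fix y z assume yz: "y \<in> ?\<gamma>" "z \<in> ?\<gamma>"
    have other: "x \<le> e \<longleftrightarrow> a \<le> e" if "e \<in> \<alpha>" "e \<noteq> a" for e
      using px[OF that] that x by (metis DiffD2 antisym linear)
    have other': "\<rho> x \<le> \<rho> e \<longleftrightarrow> \<rho> a \<le> \<rho> e" if "e \<in> \<alpha>" "e \<noteq> a" for e
      using vx[OF that] that x \<rho>eq[of x e] \<rho>eq[of a e] aK sub(1) by (metis DiffD2 antisym linear subsetD)
    show "h y \<le> h z \<longleftrightarrow> y \<le> z" using yz px other x by (auto simp: h_def)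
    show "\<rho> (h y) \<le> \<rho> (h z) \<longleftrightarrow> \<rho> y \<le> \<rho> z" using yz vx other' x by (auto simp: h_def)
  qed
  moreover have "card ?\<gamma> = m" using f a x sub(2) by (simp add: card_gt_0_iff) (metis Suc_pred card_gt_0_iff empty_iff)
  ultimately show ?thesis using sub x unfolding occ_def by auto
qed

definition words :: "nat \<Rightarrow> nat set set" where
  "words j = {P. P \<subseteq> {1..2*j} \<and> card P = j}"

text \<open>Pairs of words that can arise from a petal: \<open>P\<close> interleaves two complements in position and \<open>P'\<close> in
value, and \<open>\<delta>\<close> sends the rank in position of an element of the complement to its rank in value. The
first letter of \<open>P\<close> is fixed by the condition on the minima. Simultaneous balance is excluded
because it would allow an exchange; for \<open>j = 1\<close> the exchanged occurrence still contains the
complement of \<open>\<alpha>\<close>, and no contradiction arises.\<close>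

definition codes :: "nat \<Rightarrow> (nat \<Rightarrow> nat) \<Rightarrow> (nat set \<times> nat set) set" where
  "codes j \<delta> = {(P, P'). P \<in> words j \<and> 1 \<notin> P \<and> P' \<in> words j \<and>
     (2 \<le> j \<longrightarrow> (\<forall>t\<in>{1..j}. \<not> (balanced P t \<and> balanced P' (\<delta> t))))}"

lemma finite_words: "finite (words j)"
  unfolding words_def by (rule finite_subset[of _ "Pow {1..2*j}"]) auto

text \<open>Here \<open>X\<close> and \<open>B\<close> are the complements of two occurrences, \<open>D\<close> is the set of indices of \<open>\<tau>\<close> whose
roles the elements of \<open>X\<close> play in the occurrence that avoids \<open>B\<close>, and \<open>P\<close>, \<open>P'\<close> are the interleavings of the two
complements in position and in value.\<close>

definition certificate ::
  "(nat \<Rightarrow> nat) \<Rightarrow> nat \<Rightarrow> nat \<Rightarrow> (nat \<Rightarrow> nat) \<Rightarrow> nat set \<Rightarrow> nat set \<Rightarrow> nat set \<Rightarrow> nat set \<Rightarrow> nat set \<Rightarrow> bool" where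
  "certificate \<tau> m j \<rho> X B D P P' \<longleftrightarrow> \<rho> permutes {1..m+j} \<and>
     X \<subseteq> {1..m+j} \<and> B \<subseteq> {1..m+j} \<and> X \<inter> B = {} \<and>
     {1..m+j} - X \<in> occ \<tau> m \<rho> {1..m+j} \<and> {1..m+j} - B \<in> occ \<tau> m \<rho> {1..m+j} \<and>
     D = rk ({1..m+j} - B) ` X \<and> P = word X B \<and> P' = word (\<rho> ` X) (\<rho> ` B)"

lemma certificate_facts:
  assumes c: "certificate \<tau> m j \<rho> X B D P P'"
  shows "card X = j" "card B = j" "finite X" "finite B" "inj \<rho>"
    and "x \<in> X \<Longrightarrow> rk X x = rk D (rk ({1..m+j} - B) x)"
    and "x \<in> X \<Longrightarrow> x = rk ({1..m+j} - B) x + rk B x"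
    and "x \<in> X \<Longrightarrow> rk (\<rho> ` X) (\<rho> x) = rk (\<tau> ` D) (\<tau> (rk ({1..m+j} - B) x))"
    and "x \<in> X \<Longrightarrow> \<rho> x = \<tau> (rk ({1..m+j} - B) x) + rk (\<rho> ` B) (\<rho> x)"
    and "D \<subseteq> {1..m}" "card D = j"
    and "P \<subseteq> {1..2*j}" "card P = j" "P' \<subseteq> {1..2*j}" "card P' = j"
proof -
  let ?N = "{1..m+j}" and ?b = "{1..m+j} - B"
  have \<rho>: "\<rho> permutes ?N" and X: "X \<subseteq> ?N" and B: "B \<subseteq> ?N" and XB: "X \<inter> B = {}"
    and a: "card (?N - X) = m" and b: "card ?b = m" "pat \<rho> ?b = \<tau>"
    and D: "D = rk ?b ` X" and P: "P = word X B" and P': "P' = word (\<rho> ` X) (\<rho> ` B)"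
    using c by (auto simp: certificate_def occ_def)
  show f: "finite X" "finite B" using X B finite_subset by blast+
  show inj: "inj \<rho>" using permutes_inj[OF \<rho>] .
  show cX: "card X = j" using a card_Diff_subset[OF f(1) X] card_mono[OF _ X] by simp
  show cB: "card B = j" using b(1) card_Diff_subset[OF f(2) B] card_mono[OF _ B] by simp
  have fb: "finite ?b" by simp
  have Xb: "X \<subseteq> ?b" using X XB by auto
  show "D \<subseteq> {1..m}" unfolding D using image_mono[OF Xb, of "rk ?b"] rk_image[OF fb] b(1) by simp
  show "card D = j" unfolding D using card_image[OF inj_on_subset[OF rk_inj[OF fb] Xb]] cX by simp
  have cim: "card (\<rho> ` X) = j" "card (\<rho> ` B) = j"
    using cX cB card_image[OF inj_on_subset[OF inj subset_UNIV]] by simp_all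
  have im: "\<rho> ` X \<inter> \<rho> ` B = {}" using image_Int[OF inj, of X B] XB by simp
  show "P \<subseteq> {1..2*j}" "card P = j"
    unfolding P using rk_word(1,2)[OF f XB] cX cB by (simp_all add: mult_2)
  show "P' \<subseteq> {1..2*j}" "card P' = j"
    unfolding P' using rk_word(1,2)[OF finite_imageI[OF f(1)] finite_imageI[OF f(2)] im] cim by (simp_all add: mult_2)
  assume x: "x \<in> X"
  have xb: "x \<in> ?b" and xN: "x \<in> ?N" using x Xb X by auto
  show "rk X x = rk D (rk ?b x)"
    unfolding D by (rule rk_image_mono[of ?b, OF rk_le_iff[OF fb] Xb xb, symmetric])
  show "x = rk ?b x + rk B x" using rk_compl[OF B xN] by simp
  have role: "rk (\<rho> ` ?b) (\<rho> y) = \<tau> (rk ?b y)" if "y \<in> ?b" for y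
    using pat_rk[OF fb that, of \<rho>] b(2) by simp
  have "\<tau> ` D = rk (\<rho> ` ?b) ` \<rho> ` X"
  proof -
    have "\<tau> (rk ?b y) = rk (\<rho> ` ?b) (\<rho> y)" if "y \<in> X" for y using role[of y] that Xb by auto
    then show ?thesis unfolding D image_image by (rule image_cong[OF refl])
  qed
  moreover have "rk (rk (\<rho> ` ?b) ` \<rho> ` X) (rk (\<rho> ` ?b) (\<rho> x)) = rk (\<rho> ` X) (\<rho> x)"
    by (rule rk_image_mono[of "\<rho> ` ?b", OF rk_le_iff[OF finite_imageI[OF fb]] image_mono[OF Xb] imageI[OF xb]])
  ultimately show "rk (\<rho> ` X) (\<rho> x) = rk (\<tau> ` D) (\<tau> (rk ?b x))" using role[OF xb] by simp
  have "\<rho> ` ?b = ?N - \<rho> ` B"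
    using image_set_diff[OF inj, of ?N B] permutes_image[OF \<rho>] by simp
  moreover have "\<rho> ` B \<subseteq> ?N" "\<rho> x \<in> ?N" using B permutes_image[OF \<rho>] xN by blast+
  ultimately show "\<rho> x = \<tau> (rk ?b x) + rk (\<rho> ` B) (\<rho> x)"
    using rk_compl[of "\<rho> ` B" "m+j" "\<rho> x"] role[OF xb] by simp
qed

text \<open>The role of \<open>x\<close> is its position minus the number of elements of \<open>B\<close> before it. Hence the
position is recovered from the role and the first word, and in the same way the value from the
value of the role under \<open>\<tau>\<close> and the second word.\<close>

lemma certificate_subset:
  assumes c: "certificate \<tau> m j \<rho> X B D P P'" and c': "certificate \<tau> m j \<rho>' X' B' D P P'" and x: "x \<in> X"
  shows "x \<in> X' \<and> \<rho> x = \<rho>' x"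
proof -
  note F = certificate_facts[OF c] and F' = certificate_facts[OF c']
  let ?d = "rk ({1..m+j} - B) x"
  have eqs: "D = rk ({1..m+j} - B) ` X" "D = rk ({1..m+j} - B') ` X'"
    "P = word X B" "P = word X' B'" "P' = word (\<rho> ` X) (\<rho> ` B)" "P' = word (\<rho>' ` X') (\<rho>' ` B')"
    "X \<inter> B = {}" "X' \<inter> B' = {}"
    using c c' by (auto simp: certificate_def)
  have "?d \<in> rk ({1..m+j} - B') ` X'" using eqs(1,2) x by blast
  then obtain x' where x': "x' \<in> X'" "rk ({1..m+j} - B') x' = ?d" by force
  have "rk B x = rk B' x'"
    using word_determines[OF F(3,4) eqs(7) F'(3,4) eqs(8) _ x x'(1)] eqs(3,4) F(6)[OF x] F'(6)[OF x'(1)] x'(2) by simp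
  then have xx: "x = x'" using F(7)[OF x] F'(7)[OF x'(1)] x'(2) by linarith
  have im: "\<rho> ` X \<inter> \<rho> ` B = {}" "\<rho>' ` X' \<inter> \<rho>' ` B' = {}"
    using image_Int[OF F(5), of X B] image_Int[OF F'(5), of X' B'] eqs(7,8) by simp_all
  have "rk (\<rho> ` B) (\<rho> x) = rk (\<rho>' ` B') (\<rho>' x')"
    using word_determines[OF finite_imageI[OF F(3)] finite_imageI[OF F(4)] im(1) finite_imageI[OF F'(3)] finite_imageI[OF F'(4)] im(2) _ imageI[OF x] imageI[OF x'(1)]]
      eqs(5,6) F(8)[OF x] F'(8)[OF x'(1)] x'(2) by simp
  then have "\<rho> x = \<rho>' x'"
    using F(9)[OF x] F'(9)[OF x'(1)] arg_cong[OF x'(2), of \<tau>] by linarith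
  then show ?thesis using xx x'(1) by simp
qed

text \<open>The entries on \<open>X\<close> are recovered by the previous lemma. The remaining entries form an occurrence
  of \<open>\<tau>\<close>, so their order is known, and their values are those not taken on \<open>X\<close>.\<close>

lemma certificate_determines:
  assumes c: "certificate \<tau> m j \<rho> X B D P P'" and c': "certificate \<tau> m j \<rho>' X' B' D P P'"
  shows "\<rho> = \<rho>' \<and> X = X'"
proof -
  let ?N = "{1..m+j}"
  have X: "X = X'" 
  proof (intro equalityI subsetI)
    show "x \<in> X'" if "x \<in> X" for x using certificate_subset[OF c c' that] by simp
    show "x \<in> X" if "x \<in> X'" for x using certificate_subset[OF c' c that] by simp
  qed
  have \<rho>X: "\<rho> x = \<rho>' x" if "x \<in> X" for x using certificate_subset[OF c c' that] by simp
  have perm: "\<rho> permutes ?N" "\<rho>' permutes ?N" and sub: "X \<subseteq> ?N"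
    and p: "pat \<rho> (?N - X) = \<tau>" "pat \<rho>' (?N - X) = \<tau>"
    using c c' X by (auto simp: certificate_def occ_def)
  have im: "\<rho> ` (?N - X) = ?N - \<rho> ` X" "\<rho>' ` (?N - X) = ?N - \<rho>' ` X"
    using image_set_diff[OF permutes_inj[OF perm(1)]] image_set_diff[OF permutes_inj[OF perm(2)]]
      permutes_image[OF perm(1)] permutes_image[OF perm(2)] by simp_all
  have "\<rho> ` X = \<rho>' ` X" using \<rho>X by (rule image_cong[OF refl])
  then have ims: "\<rho> ` (?N - X) = \<rho>' ` (?N - X)" using im by simp
  have f: "finite (?N - X)" by simp
  have "\<rho> y = \<rho>' y" for y
  proof (cases "y \<in> ?N - X")
    case True
    have "rk (\<rho> ` (?N - X)) (\<rho> y) = rk (\<rho> ` (?N - X)) (\<rho>' y)"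
      using pat_rk[OF f True, of \<rho>] pat_rk[OF f True, of \<rho>'] p ims by simp
    moreover have "\<rho> y \<in> \<rho> ` (?N - X)" "\<rho>' y \<in> \<rho> ` (?N - X)" using True ims by blast+
    ultimately show ?thesis using rk_inj[OF finite_imageI[OF f], of \<rho>] by (auto dest: inj_onD)
  next
    case False
    then show ?thesis using \<rho>X permutes_not_in[OF perm(1)] permutes_not_in[OF perm(2)] by (cases "y \<in> X") auto
  qed
  then show ?thesis using X by auto
qed

text \<open>The first letter of \<open>P\<close> belongs to \<open>B\<close>, because the minimum of \<open>B\<close> lies below \<open>X\<close>. If both words
  were balanced at the element \<open>x\<close> of \<open>X\<close>, then \<open>x\<close> would be a neighbour, in position and in value, of
  the element \<open>a\<close> of \<open>\<alpha>\<close> that plays in \<open>\<alpha>\<close> the role that \<open>x\<close> plays in \<open>\<beta>\<close>. Exchanging \<open>a\<close> for \<open>x\<close>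
  gives another occurrence, which contains only one element of the complement of \<open>\<alpha>\<close>; for
  \<open>j \<ge> 2\<close> this is impossible.\<close>

lemma petals_certificate:
  assumes q: "(\<rho>, \<alpha>) \<in> petals \<tau> m j" and \<tau>: "\<tau> permutes {1..m}" and j: "1 \<le> j"
  shows "\<exists>B D P P'. certificate \<tau> m j \<rho> ({1..m+j} - \<alpha>) B D P P' \<and> (P, P') \<in> codes j (pat \<tau> D)"
proof -
  let ?N = "{1..m+j}"
  define X where "X = ?N - \<alpha>"
  have \<rho>: "\<rho> permutes ?N" and \<alpha>: "\<alpha> \<in> occ \<tau> m \<rho> ?N"
    and iso: "\<And>\<gamma>. \<gamma> \<in> occ \<tau> m \<rho> ?N \<Longrightarrow> \<gamma> \<noteq> \<alpha> \<Longrightarrow> X \<subseteq> \<gamma>"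
    using q by (auto simp: petals_def X_def)
  obtain \<beta> where \<beta>: "\<beta> \<in> occ \<tau> m \<rho> ?N" "\<beta> \<noteq> \<alpha>" "Min (?N - \<beta>) < Min X"
    using q by (auto simp: petals_def X_def)
  define B where "B = ?N - \<beta>"
  have s: "\<alpha> \<subseteq> ?N" "\<beta> \<subseteq> ?N" "card \<alpha> = m" using \<alpha> \<beta> by (auto simp: occ_def)
  have \<alpha>X: "?N - X = \<alpha>" and \<beta>B: "?N - B = \<beta>" using s by (auto simp: X_def B_def)
  have XB: "X \<inter> B = {}" using iso[OF \<beta>(1,2)] by (auto simp: B_def)
  define D where "D = rk \<beta> ` X"
  have c: "certificate \<tau> m j \<rho> X B D (word X B) (word (\<rho> ` X) (\<rho> ` B))"
    unfolding certificate_def \<alpha>X \<beta>B D_def using \<rho> \<alpha> \<beta> XB by (auto simp: X_def B_def)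
  note F = certificate_facts[OF c]
  have im: "\<rho> ` X \<inter> \<rho> ` B = {}" using image_Int[OF F(5), of X B] XB by simp
  have "(word X B, word (\<rho> ` X) (\<rho> ` B)) \<in> codes j (pat \<tau> D)"
    unfolding codes_def words_def mem_Collect_eq prod.case
  proof (intro conjI F impI ballI notI)
    assume "1 \<in> word X B"
    then obtain x where x: "x \<in> X" "rk X x + rk B x = 1"
      unfolding word_def using rk_Un[OF F(3,4) XB] by auto
    have "B \<noteq> {}" using F(2) j by auto
    then have "Min B \<in> B" using F(4) by simp
    moreover have "Min B < x" using \<beta>(3) x(1) F(3) unfolding B_def[symmetric] by (meson Min_le order_less_le_trans)
    ultimately have "{Min B} \<subseteq> {y \<in> B. y \<le> x}" by auto
    then have "1 \<le> rk B x" unfolding rk_def using card_mono[of "{y \<in> B. y \<le> x}" "{Min B}"] F(4) by simp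
    moreover have "1 \<le> rk X x" using rk_bounds[OF F(3) x(1)] by simp
    ultimately show False using x(2) by simp
  next
    fix t assume j2: "2 \<le> j" and t: "t \<in> {1..j}"
      and bal: "balanced (word X B) t \<and> balanced (word (\<rho> ` X) (\<rho> ` B)) (pat \<tau> D t)"
    have "t \<in> rk X ` X" using rk_image[OF F(3)] F(1) t by simp
    then obtain x where x: "x \<in> X" "t = rk X x" by blast
    let ?d = "rk \<beta> x"
    have d: "?d \<in> D" unfolding D_def using x(1) by (rule imageI)
    have fD: "finite D" unfolding D_def using F(3) by simp
    have td: "t = rk D ?d" using F(6)[OF x(1)] x(2) \<beta>B by simp
    have "pat \<tau> D t = rk (\<rho> ` X) (\<rho> x)"
      unfolding td using pat_rk[OF fD d, of \<tau>] F(8)[OF x(1)] \<beta>B by simp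
    with bal have b: "balanced (word X B) (rk X x)" "balanced (word (\<rho> ` X) (\<rho> ` B)) (rk (\<rho> ` X) (\<rho> x))"
      using x(2) by simp_all
    have b1: "rk B x = rk X x \<or> Suc (rk B x) = rk X x"
      using b(1) balanced_word[OF F(3,4) XB x(1)] by simp
    have b2: "rk (\<rho> ` B) (\<rho> x) = rk (\<rho> ` X) (\<rho> x) \<or> Suc (rk (\<rho> ` B) (\<rho> x)) = rk (\<rho> ` X) (\<rho> x)"
      using b(2) balanced_word[OF finite_imageI[OF F(3)] finite_imageI[OF F(4)] im imageI[OF x(1)]] by simp
    have f\<alpha>: "finite \<alpha>" using s(1) finite_subset by blast
    have "?d \<in> rk \<alpha> ` \<alpha>" using rk_image[OF f\<alpha>] F(10) d s(3) by auto
    then obtain a where a: "a \<in> \<alpha>" "rk \<alpha> a = ?d" by force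
    have xN: "x \<in> ?N" using x(1) by (simp add: X_def)
    have X\<alpha>: "x = rk X x + rk \<alpha> x" using rk_compl[of X "m+j" x] xN \<alpha>X by (auto simp: X_def)
    have pos: "rk \<alpha> x = rk \<alpha> a \<or> Suc (rk \<alpha> x) = rk \<alpha> a"
      using b1 X\<alpha> F(7)[OF x(1)] a(2) \<beta>B by auto
    have im\<alpha>: "\<rho> ` \<alpha> = ?N - \<rho> ` X"
      using image_set_diff[OF F(5), of ?N X] permutes_image[OF \<rho>] \<alpha>X by simp
    have "\<rho> ` X \<subseteq> ?N" "\<rho> x \<in> ?N" using permutes_image[OF \<rho>] xN by (auto simp: X_def)
    then have V: "\<rho> x = rk (\<rho> ` X) (\<rho> x) + rk (\<rho> ` \<alpha>) (\<rho> x)" using rk_compl[of "\<rho> ` X" "m+j" "\<rho> x"] im\<alpha> by simp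
    have ra: "rk (\<rho> ` \<alpha>) (\<rho> a) = \<tau> ?d" using pat_rk[OF f\<alpha> a(1), of \<rho>] \<alpha> a(2) by (simp add: occ_def)
    have val: "rk (\<rho> ` \<alpha>) (\<rho> x) = rk (\<rho> ` \<alpha>) (\<rho> a) \<or> Suc (rk (\<rho> ` \<alpha>) (\<rho> x)) = rk (\<rho> ` \<alpha>) (\<rho> a)"
      using b2 V F(9)[OF x(1)] \<beta>B unfolding ra by auto
    have "insert x (\<alpha> - {a}) \<in> occ \<tau> m \<rho> ?N"
      using inj_on_subset[OF F(5) subset_UNIV] _ \<alpha> a(1) _ pos val
      by (rule occ_exchange) (use x(1) in \<open>auto simp: X_def\<close>)
    moreover have "insert x (\<alpha> - {a}) \<noteq> \<alpha>" using x(1) by (auto simp: X_def)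
    ultimately have "X \<subseteq> insert x (\<alpha> - {a})" using iso by blast
    then have "X \<subseteq> {x}" by (auto simp: X_def)
    then have "card X \<le> 1" using card_mono[of "{x}" X] by simp
    then show False using F(1) j2 by simp
  qed
  then show ?thesis using c unfolding X_def by blast
qed

lemma card_petals_le:
  assumes \<tau>: "\<tau> permutes {1..m}" and j: "1 \<le> j"
    and c: "\<And>\<delta>. \<delta> permutes {1..j} \<Longrightarrow> card (codes j \<delta>) \<le> c"
  shows "card (petals \<tau> m j) \<le> (m choose j) * c"
proof -
  let ?Ds = "{D. D \<subseteq> {1..m} \<and> card D = j}"
  let ?T = "SIGMA D:?Ds. codes j (pat \<tau> D)"
  have fDs: "finite ?Ds" by (rule finite_subset[of _ "Pow {1..m}"]) auto
  have fc: "finite (codes j \<delta>)" for \<delta>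
    by (rule finite_subset[of _ "words j \<times> words j"]) (auto simp: codes_def finite_words)
  have "\<forall>q\<in>petals \<tau> m j. \<exists>z. z \<in> ?T \<and> (\<exists>B. certificate \<tau> m j (fst q) ({1..m+j} - snd q) B (fst z) (fst (snd z)) (snd (snd z)))"
  proof
    fix q assume "q \<in> petals \<tau> m j"
    then have "(fst q, snd q) \<in> petals \<tau> m j" by simp
    from petals_certificate[OF this \<tau> j] obtain B D P P'
      where *: "certificate \<tau> m j (fst q) ({1..m+j} - snd q) B D P P'" "(P, P') \<in> codes j (pat \<tau> D)" by blast
    then have "(D, P, P') \<in> ?T" using certificate_facts(10,11)[OF *(1)] by simp
    then show "\<exists>z. z \<in> ?T \<and> (\<exists>B. certificate \<tau> m j (fst q) ({1..m+j} - snd q) B (fst z) (fst (snd z)) (snd (snd z)))"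
      using *(1) by (intro exI[of _ "(D, P, P')"]) auto
  qed
  from bchoice[OF this] obtain z where z': "\<forall>q\<in>petals \<tau> m j. z q \<in> ?T \<and>
    (\<exists>B. certificate \<tau> m j (fst q) ({1..m+j} - snd q) B (fst (z q)) (fst (snd (z q))) (snd (snd (z q))))" by (rule exE)
  have z: "z q \<in> ?T"
    "\<exists>B. certificate \<tau> m j (fst q) ({1..m+j} - snd q) B (fst (z q)) (fst (snd (z q))) (snd (snd (z q)))"
    if "q \<in> petals \<tau> m j" for q using bspec[OF z' that] by simp_all
  have "inj_on z (petals \<tau> m j)"
  proof (rule inj_onI)
    fix q q' assume q: "q \<in> petals \<tau> m j" "q' \<in> petals \<tau> m j" "z q = z q'"
    from z(2)[OF q(1)] obtain B where
      B: "certificate \<tau> m j (fst q) ({1..m+j} - snd q) B (fst (z q)) (fst (snd (z q))) (snd (snd (z q)))" by (rule exE)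
    from z(2)[OF q(2), folded q(3)] obtain B' where
      B': "certificate \<tau> m j (fst q') ({1..m+j} - snd q') B' (fst (z q)) (fst (snd (z q))) (snd (snd (z q)))" by (rule exE)
    note * = conjunct1[OF certificate_determines[OF B B']] conjunct2[OF certificate_determines[OF B B']]
    have "snd p \<subseteq> {1..m+j}" if "p \<in> petals \<tau> m j" for p
      using that unfolding petals_def occ_def by (cases p) simp
    from this[OF q(1)] this[OF q(2)] have "snd q = snd q'" using *(2) by blast
    with *(1) show "q = q'" by (rule prod_eqI)
  qed
  moreover have "z ` petals \<tau> m j \<subseteq> ?T" using z(1) by (rule image_subsetI)
  moreover have "finite ?T" using fDs fc by (rule finite_SigmaI)
  ultimately have "card (petals \<tau> m j) \<le> card ?T" by (rule card_inj_on_le)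
  also have "\<dots> = (\<Sum>D\<in>?Ds. card (codes j (pat \<tau> D)))"
    using fDs fc by (intro card_SigmaI) auto
  also have "\<dots> \<le> (\<Sum>D\<in>?Ds. c)"
  proof (rule sum_mono)
    fix D assume D: "D \<in> ?Ds"
    then have "finite D" using finite_subset by blast
    then have "pat \<tau> D permutes {1..j}"
      using pat_permutes[of D \<tau>] D inj_on_subset[OF permutes_inj[OF \<tau>] subset_UNIV] by simp
    then show "card (codes j (pat \<tau> D)) \<le> c" by (rule c)
  qed
  also have "\<dots> = (m choose j) * c" by (simp add: n_subsets)
  finally show ?thesis .
qed

section \<open>Counting the codes\<close>

lemma card_words: "card (words j) = (2 * j) choose j"
  unfolding words_def using n_subsets[of "{1..2*j}" j] by simp

lemma card_codes_le_binomial: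
  assumes "1 \<le> j"
  shows "card (codes j \<delta>) \<le> ((2 * j - 1) choose j) * ((2 * j) choose j)"
proof -
  have "codes j \<delta> \<subseteq> {P. P \<subseteq> {2..2*j} \<and> card P = j} \<times> words j"
  proof
    fix z assume "z \<in> codes j \<delta>"
    then obtain P P' where z: "z = (P, P')" "P \<subseteq> {1..2*j}" "card P = j" "1 \<notin> P" "P' \<in> words j"
      unfolding codes_def words_def by blast
    have "P \<subseteq> {2..2*j}"
    proof
      fix p assume "p \<in> P"
      then have "p \<in> {1..2*j}" "p \<noteq> 1" using z by auto
      then show "p \<in> {2..2*j}" by auto
    qed
    then show "z \<in> {P. P \<subseteq> {2..2*j} \<and> card P = j} \<times> words j" using z by simp
  qed
  moreover have "finite {P. P \<subseteq> {2..2*j} \<and> card P = j}" by (rule finite_subset[of _ "Pow {2..2*j}"]) auto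
  ultimately have "card (codes j \<delta>) \<le> card ({P. P \<subseteq> {2..2*j} \<and> card P = j} \<times> words j)"
    using finite_words by (intro card_mono) auto
  then show ?thesis using n_subsets[of "{2..2*j}" j] by (simp add: card_words card_cartesian_product)
qed

text \<open>A word \<open>P\<close> is read in blocks of two letters; the height after \<open>t\<close> blocks is
  \<open>rk P (2 * t) - t\<close>, a path with steps \<open>-1, 0, 0, 1\<close> that starts and ends at \<open>0\<close>. The word is
  balanced at \<open>t\<close> if the \<open>t\<close>-th step leads from a height \<open>\<le> 0\<close> to a height \<open>\<ge> 0\<close>.\<close>

definition ht :: "int \<Rightarrow> bool \<times> bool \<Rightarrow> int" where
  "ht e z = e + of_bool (fst z) + of_bool (snd z) - 1"

fun bals :: "int \<Rightarrow> (bool \<times> bool) list \<Rightarrow> bool list" where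
  "bals e [] = []"
| "bals e (z # l) = (e \<le> 0 \<and> 0 \<le> ht e z) # bals (ht e z) l"

definition nbal :: "int \<Rightarrow> (bool \<times> bool) list \<Rightarrow> nat" where
  "nbal e l = length (filter id (bals e l))"

definition adm :: "int \<Rightarrow> nat \<Rightarrow> nat \<Rightarrow> (bool \<times> bool) list \<Rightarrow> bool" where
  "adm e q i l \<longleftrightarrow> foldl ht e l = 0 \<and> nbal e l \<le> q \<and> \<not> (1 \<le> i \<and> i \<le> length l \<and> bals e l ! (i - 1))"

text \<open>The total weight of the step sequences of length \<open>n\<close> that lead from height \<open>e\<close> to \<open>0\<close>, are balanced
at most \<open>q\<close> times and not at the \<open>i\<close>-th step; a sequence that is balanced \<open>r\<close> times has weight
\<open>w (q - r)\<close>. The index \<open>i = 0\<close> stays \<open>0\<close> under truncated subtraction and imposes no condition.\<close>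

fun paths :: "(nat \<Rightarrow> nat) \<Rightarrow> nat \<Rightarrow> int \<Rightarrow> nat \<Rightarrow> nat \<Rightarrow> nat" where
  "paths w 0 e q i = (if e = 0 then w q else 0)"
| "paths w (Suc n) e q i =
    (let f = (\<lambda>e'. if e \<le> 0 \<and> 0 \<le> e' then (if i = 1 \<or> q = 0 then 0 else paths w n e' (q - 1) (i - 1))
                   else paths w n e' q (i - 1))
     in f (e - 1) + 2 * f e + f (e + 1))"

lemma length_bals [simp]: "length (bals e l) = length l"
  by (induction l arbitrary: e) auto

lemma finite_lists_length_bool: "finite {l :: (bool \<times> bool) list. length l = n}"
  using finite_lists_length_eq[of "UNIV :: (bool \<times> bool) set" n] by simp

lemma sum_lists_Suc:
  fixes f :: "(bool \<times> bool) list \<Rightarrow> nat"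
  shows "(\<Sum>l | length l = Suc n. f l) = (\<Sum>z\<in>UNIV. \<Sum>l | length l = n. f (z # l))"
proof -
  have "(\<Sum>z\<in>UNIV. \<Sum>l | length l = n. f (z # l)) = (\<Sum>(z, l)\<in>UNIV \<times> {l. length l = n}. f (z # l))"
    by (rule sum.cartesian_product)
  also have "\<dots> = (\<Sum>l | length l = Suc n. f l)"
    by (rule sum.reindex_bij_witness[of _ "\<lambda>l. (hd l, tl l)" "\<lambda>(z, l). z # l"]) (auto simp: length_Suc_conv)
  finally show ?thesis by simp
qed

lemma adm_Cons:
  "adm e q i (z # l) \<longleftrightarrow> (if e \<le> 0 \<and> 0 \<le> ht e z then i \<noteq> 1 \<and> q \<noteq> 0 \<and> adm (ht e z) (q - 1) (i - 1) l
     else adm (ht e z) q (i - 1) l)"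
  by (cases "e \<le> 0 \<and> 0 \<le> ht e z"; cases i; cases "i - 1") (auto simp: adm_def nbal_def)

lemma sum_adm_eq_paths:
  "(\<Sum>l | length l = n. if adm e q i l then w (q - nbal e l) else 0) = paths w n e q i"
proof (induction n arbitrary: e q i)
  case 0
  have "{l :: (bool \<times> bool) list. length l = 0} = {[]}" by auto
  then show ?case by (simp add: adm_def nbal_def)
next
  case (Suc n)
  define F where "F e' = (if e \<le> 0 \<and> 0 \<le> e' then (if i = 1 \<or> q = 0 then 0 else paths w n e' (q - 1) (i - 1))
                   else paths w n e' q (i - 1))" for e'
  have step: "(\<Sum>l | length l = n. if adm e q i (z # l) then w (q - nbal e (z # l)) else 0) = F (ht e z)" for z
  proof (cases "e \<le> 0 \<and> 0 \<le> ht e z")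
    case True
    then have "nbal e (z # l) = Suc (nbal (ht e z) l)" for l by (simp add: nbal_def)
    then have "(if adm e q i (z # l) then w (q - nbal e (z # l)) else 0) =
      (if i = 1 \<or> q = 0 then 0 else if adm (ht e z) (q - 1) (i - 1) l then w (q - 1 - nbal (ht e z) l) else 0)" for l
      using True by (simp add: adm_Cons)
    then show ?thesis using True Suc.IH[of "ht e z" "q - 1" "i - 1"] by (simp add: F_def)
  next
    case False
    then have "nbal e (z # l) = nbal (ht e z) l" for l by (auto simp: nbal_def)
    then have "(if adm e q i (z # l) then w (q - nbal e (z # l)) else 0) =
      (if adm (ht e z) q (i - 1) l then w (q - nbal (ht e z) l) else 0)" for l
      using False by (auto simp: adm_Cons)
    then show ?thesis using False Suc.IH[of "ht e z" q "i - 1"] by (auto simp: F_def)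
  qed
  have "(\<Sum>l | length l = Suc n. if adm e q i l then w (q - nbal e l) else 0) = (\<Sum>z\<in>UNIV. F (ht e z))"
    unfolding sum_lists_Suc step ..
  also have "\<dots> = F (e - 1) + 2 * F e + F (e + 1)"
    by (simp add: UNIV_Times_UNIV[symmetric] UNIV_bool ht_def add.commute del: UNIV_Times_UNIV)
  finally show ?case by (simp add: F_def Let_def)
qed

definition letters :: "nat \<Rightarrow> nat set \<Rightarrow> (bool \<times> bool) list" where
  "letters j P = map (\<lambda>t. (2 * t + 1 \<in> P, 2 * t + 2 \<in> P)) [0..<j]"

lemma rk_Suc: "rk P (Suc x) = rk P x + of_bool (Suc x \<in> P)"
proof -
  have "{y \<in> P. y \<le> Suc x} = (if Suc x \<in> P then insert (Suc x) {y \<in> P. y \<le> x} else {y \<in> P. y \<le> x})"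
    by (auto simp: le_Suc_eq)
  then show ?thesis by (simp add: rk_def)
qed

lemma foldl_letters: "0 \<notin> P \<Longrightarrow> foldl ht 0 (letters j P) = int (rk P (2 * j)) - int j"
proof (induction j)
  case 0
  then have "{y \<in> P. y \<le> 0} = {}" by auto
  then show ?case by (simp add: letters_def rk_def)
next
  case (Suc j)
  have "letters (Suc j) P = letters j P @ [(2 * j + 1 \<in> P, 2 * j + 2 \<in> P)]" by (simp add: letters_def)
  then show ?case using Suc rk_Suc[of P "2 * j"] rk_Suc[of P "2 * j + 1"] by (simp add: ht_def)
qed

lemma bals_append: "bals e (l @ [z]) = bals e l @ [foldl ht e l \<le> 0 \<and> 0 \<le> ht (foldl ht e l) z]"
  by (induction l arbitrary: e) auto

lemma balanced_Suc_iff: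
  assumes "finite P"
  shows "balanced P (Suc t) \<longleftrightarrow> rk P (2 * t) \<le> t \<and> Suc t \<le> rk P (2 * Suc t)"
proof
  assume "balanced P (Suc t)"
  then obtain p where p: "p \<in> P" "rk P p = Suc t" "p = 2 * Suc t \<or> Suc p = 2 * Suc t"
    unfolding balanced_def by blast
  have "rk P (2 * t) < rk P p" using p by (intro rk_less assms) auto
  moreover have "rk P p \<le> rk P (2 * Suc t)" using p by (intro rk_mono assms) auto
  ultimately show "rk P (2 * t) \<le> t \<and> Suc t \<le> rk P (2 * Suc t)" using p(2) by simp
next
  assume *: "rk P (2 * t) \<le> t \<and> Suc t \<le> rk P (2 * Suc t)"
  have "rk P (2 * Suc t) \<le> card P" unfolding rk_def using assms by (intro card_mono) auto
  then have "Suc t \<in> rk P ` P" using * rk_image[OF assms] by simp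
  then obtain p where p: "p \<in> P" "rk P p = Suc t" by force
  have "p \<le> 2 * Suc t"
  proof (rule ccontr)
    assume "\<not> p \<le> 2 * Suc t"
    then have "rk P (2 * Suc t) < rk P p" by (intro rk_less[OF assms p(1)]) simp
    then show False using p(2) * by simp
  qed
  moreover have "2 * t < p"
  proof (rule ccontr)
    assume "\<not> 2 * t < p"
    then have "rk P p \<le> rk P (2 * t)" by (intro rk_mono[OF assms]) simp
    then show False using p(2) * by simp
  qed
  ultimately have "p = 2 * Suc t \<or> Suc p = 2 * Suc t" by auto
  then show "balanced P (Suc t)" unfolding balanced_def using p by blast
qed

lemma bals_letters:
  assumes "finite P" "0 \<notin> P"
  shows "bals 0 (letters j P) = map (\<lambda>t. balanced P (Suc t)) [0..<j]"
proof (induction j)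
  case (Suc j)
  have l: "letters (Suc j) P = letters j P @ [(2 * j + 1 \<in> P, 2 * j + 2 \<in> P)]" by (simp add: letters_def)
  then have "ht (foldl ht 0 (letters j P)) (2 * j + 1 \<in> P, 2 * j + 2 \<in> P) = int (rk P (2 * Suc j)) - int (Suc j)"
    using foldl_letters[OF assms(2), of "Suc j"] by simp
  then show ?case using Suc l foldl_letters[OF assms(2), of j] balanced_Suc_iff[OF assms(1), of j]
    by (simp add: bals_append) linarith
qed (simp add: letters_def)

definition nbalanced :: "nat \<Rightarrow> nat set \<Rightarrow> nat" where
  "nbalanced j P = card {t \<in> {1..j}. balanced P t}"

lemma words_letters:
  assumes P: "P \<in> words j"
  shows "length (letters j P) = j" "foldl ht 0 (letters j P) = 0" "nbal 0 (letters j P) = nbalanced j P"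
    and "u \<in> {1..j} \<Longrightarrow> bals 0 (letters j P) ! (u - 1) = balanced P u"
proof -
  have f: "finite P" "0 \<notin> P" "P \<subseteq> {1..2*j}" "card P = j" using P finite_subset by (auto simp: words_def)
  show "length (letters j P) = j" by (simp add: letters_def)
  have "{y \<in> P. y \<le> 2 * j} = P" using f(3) by auto
  then have "rk P (2 * j) = j" using f(4) by (simp add: rk_def)
  then show "foldl ht 0 (letters j P) = 0" using foldl_letters[OF f(2)] by simp
  note b = bals_letters[OF f(1,2), of j]
  show "u \<in> {1..j} \<Longrightarrow> bals 0 (letters j P) ! (u - 1) = balanced P u"
    unfolding b by (cases u) auto
  have "nbal 0 (letters j P) = card {t. t < j \<and> balanced P (Suc t)}"
    unfolding nbal_def b by (simp add: length_filter_conv_card) (rule arg_cong[of _ _ card], auto)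
  also have "\<dots> = card (Suc ` {t. t < j \<and> balanced P (Suc t)})" by (simp add: card_image)
  also have "Suc ` {t. t < j \<and> balanced P (Suc t)} = {t \<in> {1..j}. balanced P t}"
  proof (intro set_eqI iffI)
    fix u assume "u \<in> {t \<in> {1..j}. balanced P t}"
    then show "u \<in> Suc ` {t. t < j \<and> balanced P (Suc t)}" by (cases u) auto
  qed auto
  finally show "nbal 0 (letters j P) = nbalanced j P" by (simp add: nbalanced_def)
qed

lemma inj_letters: "inj_on (letters j) (words j)"
proof (rule inj_onI)
  fix P Q assume PQ: "P \<in> words j" "Q \<in> words j" "letters j P = letters j Q"
  have *: "(2 * t + 1 \<in> P \<longleftrightarrow> 2 * t + 1 \<in> Q) \<and> (2 * t + 2 \<in> P \<longleftrightarrow> 2 * t + 2 \<in> Q)" if "t < j" for t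
    using arg_cong[OF PQ(3), of "\<lambda>l. l ! t"] that by (simp add: letters_def)
  have "p \<in> P \<longleftrightarrow> p \<in> Q" if p: "p \<in> {1..2*j}" for p
  proof (cases "even p")
    case True
    then obtain t where "p = 2 * t" by blast
    then have "p = 2 * (t - 1) + 2" "t - 1 < j" using p by auto
    then show ?thesis using *[of "t - 1"] by metis
  next
    case False
    then obtain t where "p = 2 * t + 1" by (rule oddE)
    then show ?thesis using *[of t] p by simp
  qed
  then show "P = Q" using PQ(1,2) unfolding words_def by blast
qed

lemma sum_words_le:
  fixes F :: "(bool \<times> bool) list \<Rightarrow> nat"
  assumes "A \<subseteq> words j"
  shows "(\<Sum>P\<in>A. F (letters j P)) \<le> (\<Sum>l | length l = j. F l)"
proof -
  have "(\<Sum>P\<in>A. F (letters j P)) = (\<Sum>l\<in>letters j ` A. F l)"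
    by (subst sum.reindex[OF inj_on_subset[OF inj_letters assms]]) simp
  also have "\<dots> \<le> (\<Sum>l | length l = j. F l)"
    using words_letters(1) assms by (intro sum_mono2 finite_lists_length_bool) auto
  finally show ?thesis .
qed

lemma card_words_unbalanced_le:
  assumes "u \<in> {1..j}"
  shows "card {P \<in> words j. nbalanced j P \<le> q \<and> \<not> balanced P u} \<le> paths (\<lambda>_. 1) j 0 q u"
proof -
  let ?A = "{P \<in> words j. nbalanced j P \<le> q \<and> \<not> balanced P u}"
  have "card ?A = (\<Sum>P\<in>?A. if adm 0 q u (letters j P) then 1 else 0)"
  proof -
    have "adm 0 q u (letters j P)" if "P \<in> ?A" for P
      using that assms words_letters[of P j] by (simp add: adm_def)
    then show ?thesis by simp
  qed
  also have "\<dots> \<le> (\<Sum>l | length l = j. if adm 0 q u l then 1 else 0)"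
    by (rule sum_words_le) auto
  also have "\<dots> = paths (\<lambda>_. 1) j 0 q u" by (rule sum_adm_eq_paths)
  finally show ?thesis .
qed

lemma sum_words_weight_le:
  assumes "1 \<le> j"
  shows "(\<Sum>P | P \<in> words j \<and> 1 \<notin> P. w (j - nbalanced j P)) \<le>
    paths w (j - 1) (-1) j 0 + paths w (j - 1) 0 (j - 1) 0"
proof -
  obtain n where n: "j = Suc n" using assms by (cases j) auto
  let ?F = "\<lambda>l. if \<not> fst (hd l) \<and> adm 0 j 0 l then w (j - nbal 0 l) else 0"
  have "(\<Sum>P | P \<in> words j \<and> 1 \<notin> P. w (j - nbalanced j P)) = (\<Sum>P | P \<in> words j \<and> 1 \<notin> P. ?F (letters j P))"
  proof (rule sum.cong[OF refl])
    fix P assume P: "P \<in> {P \<in> words j. 1 \<notin> P}"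
    have "fst (hd (letters j P)) \<longleftrightarrow> 1 \<in> P" unfolding letters_def n by (simp add: upt_conv_Cons del: upt_Suc)
    moreover have "nbalanced j P \<le> j"
    proof -
      have "card {t \<in> {1..j}. balanced P t} \<le> card {1..j}" by (rule card_mono) auto
      then show ?thesis by (simp add: nbalanced_def)
    qed
    ultimately show "w (j - nbalanced j P) = ?F (letters j P)"
      using P words_letters[of P j] by (simp add: adm_def)
  qed
  also have "\<dots> \<le> (\<Sum>l | length l = j. ?F l)" by (rule sum_words_le) auto
  also have "\<dots> = (\<Sum>z\<in>UNIV. \<Sum>l | length l = n. if \<not> fst z \<and> adm 0 j 0 (z # l) then w (j - nbal 0 (z # l)) else 0)"
    unfolding n sum_lists_Suc by simp
  also have "\<dots> = (\<Sum>l | length l = n. if adm 0 j 0 ((False, False) # l) then w (j - nbal 0 ((False, False) # l)) else 0)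
     + (\<Sum>l | length l = n. if adm 0 j 0 ((False, True) # l) then w (j - nbal 0 ((False, True) # l)) else 0)"
    by (simp add: UNIV_Times_UNIV[symmetric] UNIV_bool del: UNIV_Times_UNIV)
  also have "\<dots> = (\<Sum>l | length l = n. if adm (-1) j 0 l then w (j - nbal (-1) l) else 0)
     + (\<Sum>l | length l = n. if adm 0 n 0 l then w (n - nbal 0 l) else 0)"
    by (simp add: adm_Cons ht_def nbal_def n cong: if_cong)
  finally show ?thesis unfolding sum_adm_eq_paths using n by simp
qed

text \<open>If \<open>P\<close> is balanced at \<open>t\<close>, its partners are not balanced at \<open>\<delta> t\<close>; if it is balanced at \<open>b\<close> places,
  its partners are balanced at no more than \<open>j - b\<close>. So \<open>w (j - b)\<close> bounds the number of partners, and
  the sum of these bounds over all \<open>P\<close> is again a weighted number of paths. Since \<open>1\<close> is not in \<open>P\<close>, the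
  first step leads to \<open>-1\<close>, or it stays at \<open>0\<close> and is balanced; this gives the two summands.\<close>

lemma card_codes_le_weight:
  assumes j: "2 \<le> j" and \<delta>: "\<delta> permutes {1..j}"
    and w: "\<And>u q. u \<in> {1..j} \<Longrightarrow> q < j \<Longrightarrow> paths (\<lambda>_. 1) j 0 q u \<le> w q"
    and w0: "(2 * j) choose j \<le> w j"
  shows "card (codes j \<delta>) \<le> paths w (j - 1) (-1) j 0 + paths w (j - 1) 0 (j - 1) 0"
proof -
  let ?R = "{P \<in> words j. 1 \<notin> P}"
  let ?C = "\<lambda>P. {P' \<in> words j. \<forall>t\<in>{1..j}. \<not> (balanced P t \<and> balanced P' (\<delta> t))}"
  have fR: "finite ?R" using finite_words by simp
  have fC: "finite (?C P)" for P using finite_words by simp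
  have C: "card (?C P) \<le> w (j - nbalanced j P)" for P
  proof (cases "\<exists>t\<in>{1..j}. balanced P t")
    case True
    then obtain t where t: "t \<in> {1..j}" "balanced P t" by blast
    let ?G = "{t \<in> {1..j}. balanced P t}"
    have g1: "1 \<le> nbalanced j P" unfolding nbalanced_def using t card_mono[of ?G "{t}"] by simp
    have "?C P \<subseteq> {P' \<in> words j. nbalanced j P' \<le> j - nbalanced j P \<and> \<not> balanced P' (\<delta> t)}"
    proof (intro subsetI CollectI conjI)
      fix P' assume P': "P' \<in> ?C P"
      show "P' \<in> words j" "\<not> balanced P' (\<delta> t)" using P' t by auto
      let ?G' = "{t \<in> {1..j}. balanced P' (\<delta> t)}"
      have "\<delta> ` ?G' = {t \<in> {1..j}. balanced P' t}"
        using permutes_in_image[OF \<delta>] permutes_image[OF \<delta>] by (auto simp: image_iff) (metis imageE atLeastAtMost_iff)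
      then have "card ?G' = nbalanced j P'"
        unfolding nbalanced_def using card_image[OF inj_on_subset[OF permutes_inj[OF \<delta>] subset_UNIV]] by metis
      moreover have "card (?G \<union> ?G') = card ?G + card ?G'" using P' by (intro card_Un_disjoint) auto
      moreover have "card (?G \<union> ?G') \<le> card {1..j}" by (rule card_mono) auto
      ultimately show "nbalanced j P' \<le> j - nbalanced j P" unfolding nbalanced_def by simp
    qed
    then have "card (?C P) \<le> card {P' \<in> words j. nbalanced j P' \<le> j - nbalanced j P \<and> \<not> balanced P' (\<delta> t)}"
      using finite_words by (intro card_mono) auto
    also have "\<dots> \<le> paths (\<lambda>_. 1) j 0 (j - nbalanced j P) (\<delta> t)"
      using permutes_in_image[OF \<delta>] t by (intro card_words_unbalanced_le) auto
    also have "\<dots> \<le> w (j - nbalanced j P)"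
      using permutes_in_image[OF \<delta>] t g1 j by (intro w) auto
    finally show ?thesis .
  next
    case False
    then have "{t \<in> {1..j}. balanced P t} = {}" by blast
    then have "nbalanced j P = 0" by (simp add: nbalanced_def)
    moreover have "card (?C P) \<le> card (words j)" using finite_words by (intro card_mono) auto
    ultimately show ?thesis using w0 by (simp add: card_words)
  qed
  have "codes j \<delta> = (SIGMA P:?R. ?C P)" using j by (auto simp: codes_def)
  then have "card (codes j \<delta>) = (\<Sum>P\<in>?R. card (?C P))" using fR fC by simp
  also have "\<dots> \<le> (\<Sum>P\<in>?R. w (j - nbalanced j P))" by (intro sum_mono C)
  also have "\<dots> \<le> paths w (j - 1) (-1) j 0 + paths w (j - 1) 0 (j - 1) 0"
    using sum_words_weight_le[of j w] j by simp
  finally show ?thesis .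
qed

lemma card_codes_le_check:
  assumes "2 \<le> j" "\<delta> permutes {1..j}"
    and "\<forall>u\<in>set [1..<Suc j]. \<forall>q\<in>set [0..<j]. paths (\<lambda>_. 1) j 0 q u \<le> ws ! q"
    and "(2 * j) choose j \<le> ws ! j"
    and "paths (\<lambda>q. ws ! q) (j - 1) (-1) j 0 + paths (\<lambda>q. ws ! q) (j - 1) 0 (j - 1) 0 \<le> c"
  shows "card (codes j \<delta>) \<le> c"
  using card_codes_le_weight[of j \<delta> "\<lambda>q. ws ! q"] assms by force

text \<open>A path that is too far from \<open>0\<close> to return has no weight. Cutting these branches keeps the evaluation
of the recursion small.\<close>

lemma paths_step:
  assumes "n = Suc k"
  shows "paths w n e q i = (if int n < \<bar>e\<bar> then 0 else
    (let f = (\<lambda>e'. if e \<le> 0 \<and> 0 \<le> e' then (if i = 1 \<or> q = 0 then 0 else paths w k e' (q - 1) (i - 1))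
                   else paths w k e' q (i - 1))
     in f (e - 1) + 2 * f e + f (e + 1)))"
proof -
  have "paths w n e q i = 0" if "int n < \<bar>e\<bar>" for n e q i
    using that
    by (induction w n e q i rule: paths.induct) (auto simp: Let_def)
  then show ?thesis by (cases "int n < \<bar>e\<bar>"; simp add: assms Let_def)
qed

lemmas paths_eval = paths_step[OF numeral_eq_Suc] paths_step[of "Suc 0" 0, OF refl]

text \<open>For \<open>q < j\<close>, the weight \<open>ws ! q\<close> bounds the number of words that are balanced at most \<open>q\<close> times
and not at one given place; the last weight is the number of all words.\<close>

lemma card_codes_2: "\<delta> permutes {1..2} \<Longrightarrow> card (codes 2 \<delta>) \<le> 1"
  by (rule card_codes_le_check[where ws = "[0, 1, 6]"])
    (simp_all add: paths_eval upt_rec binomial_fact' fact_numeral del: paths.simps(2))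

lemma card_codes_3: "\<delta> permutes {1..3} \<Longrightarrow> card (codes 3 \<delta>) \<le> 32"
  by (rule card_codes_le_check[where ws = "[0, 4, 8, 20]"])
    (simp_all add: paths_eval upt_rec binomial_fact' fact_numeral del: paths.simps(2))

lemma card_codes_4: "\<delta> permutes {1..4} \<Longrightarrow> card (codes 4 \<delta>) \<le> 520"
  by (rule card_codes_le_check[where ws = "[0, 10, 24, 32, 70]"])
    (simp_all add: paths_eval upt_rec binomial_fact' fact_numeral del: paths.simps(2))

lemma card_codes_5: "\<delta> permutes {1..5} \<Longrightarrow> card (codes 5 \<delta>) \<le> 8728"
  by (rule card_codes_le_check[where ws = "[0, 28, 76, 116, 132, 252]"])
    (simp_all add: paths_eval upt_rec binomial_fact' fact_numeral del: paths.simps(2))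

lemma card_codes_6: "\<delta> permutes {1..6} \<Longrightarrow> card (codes 6 \<delta>) \<le> 138236"
  by (rule card_codes_le_check[where ws = "[0, 84, 234, 386, 482, 514, 924]"])
    (simp_all add: paths_eval upt_rec binomial_fact' fact_numeral del: paths.simps(2))

section \<open>A lower bound for the number of overlaps\<close>

text \<open>For a set \<open>D\<close> of indices, a permutation of \<open>[m + card D]\<close> is built from \<open>\<tau>\<close> by putting a twin directly
to the right of each entry with index in \<open>D\<close>, directly above or below it in value. Entry \<open>i\<close> sits at
\<open>2 * i\<close>, its twin at \<open>2 * i + 1\<close>; values are spaced by three so that a twin fits on either side. The
twin is put above if the next entry of \<open>\<tau>\<close> is one smaller, and below otherwise. This way a pair of
twins never looks like two consecutive entries of \<open>\<tau>\<close>.\<close>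

definition twin_key :: "(nat \<Rightarrow> nat) \<Rightarrow> nat \<Rightarrow> nat" where
  "twin_key \<tau> x = 3 * \<tau> (x div 2) +
     (if even x then 1 else if \<tau> (Suc (x div 2)) + 1 = \<tau> (x div 2) then 2 else 0)"

definition twinned :: "nat \<Rightarrow> nat set \<Rightarrow> nat set" where
  "twinned m D = (\<lambda>i. 2 * i) ` {1..m} \<union> (\<lambda>i. 2 * i + 1) ` D"

lemma twin_key_div: "twin_key \<tau> x div 3 = \<tau> (x div 2)"
  by (simp add: twin_key_def)

lemma mem_twinned: "x \<in> twinned m D \<longleftrightarrow> (if even x then x div 2 \<in> {1..m} else x div 2 \<in> D)"
proof (cases "even x")
  case True
  then have "x \<noteq> 2 * i + 1" "x = 2 * i \<longleftrightarrow> x div 2 = i" for i by presburger+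
  then show ?thesis using True by (auto simp: twinned_def image_iff)
next
  case False
  then have "x \<noteq> 2 * i" "x = 2 * i + 1 \<longleftrightarrow> x div 2 = i" for i by presburger+
  then show ?thesis using False by (auto simp: twinned_def image_iff)
qed

lemma finite_twinned: "finite D \<Longrightarrow> finite (twinned m D)"
  by (simp add: twinned_def)

lemma card_twinned:
  assumes "D \<subseteq> {1..m}"
  shows "card (twinned m D) = m + card D"
proof -
  have fD: "finite D" using assms finite_subset by blast
  have "(\<lambda>i::nat. 2 * i) ` {1..m} \<inter> (\<lambda>i. 2 * i + 1) ` D = {}" by (auto; presburger)
  then have "card (twinned m D) = card ((\<lambda>i::nat. 2 * i) ` {1..m}) + card ((\<lambda>i. 2 * i + 1) ` D)"
    unfolding twinned_def by (intro card_Un_disjoint) (auto simp: fD)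
  also have "\<dots> = m + card D" by (simp add: card_image inj_on_def)
  finally show ?thesis .
qed

lemma inj_twin_key:
  assumes "inj \<tau>"
  shows "inj (twin_key \<tau>)"
proof (rule injI)
  fix x y assume eq: "twin_key \<tau> x = twin_key \<tau> y"
  then have "\<tau> (x div 2) = \<tau> (y div 2)" using twin_key_div by metis
  then have d: "x div 2 = y div 2" using assms by (simp add: inj_eq)
  with eq have "even x = even y"
    unfolding twin_key_def by (auto split: if_splits)
  then show "x = y" using d by presburger
qed

lemma pat_twin_key:
  assumes \<tau>: "\<tau> permutes {1..m}" and g: "\<And>i. g i div 2 = i"
  shows "pat (twin_key \<tau>) (g ` {1..m}) = \<tau>"
proof (subst pat_eq_iff_order)
  have mono: "g i \<le> g k \<longleftrightarrow> i \<le> k" for i k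
    using g[of i] g[of k] by (metis div_le_mono linorder_le_cases antisym)
  have inj: "inj_on g A" for A by (rule inj_onI) (metis g)
  have c: "card (g ` {1..m}) = m" using inj by (simp add: card_image)
  show "finite (g ` {1..m})" by simp
  show "inj_on (twin_key \<tau>) (g ` {1..m})"
    using inj_twin_key[OF permutes_inj[OF \<tau>]] inj_on_subset by blast
  show "\<tau> permutes {1..card (g ` {1..m})}" unfolding c by (rule \<tau>)
  have r: "rk (g ` {1..m}) (g i) = i" if "i \<in> {1..m}" for i
    using rk_image_mono[of "{1..m}" g "{1..m}" i] mono that rk_interval[OF that] by simp
  have less: "twin_key \<tau> (g i) < twin_key \<tau> (g k) \<longleftrightarrow> \<tau> i < \<tau> k" for i k
  proof (cases "i = k")
    case False
    then have "\<tau> i \<noteq> \<tau> k" using permutes_inj[OF \<tau>] by (simp add: inj_eq)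
    moreover have "twin_key \<tau> (g i) div 3 = \<tau> i" "twin_key \<tau> (g k) div 3 = \<tau> k"
      by (simp_all add: twin_key_div g)
    ultimately show ?thesis by linarith
  qed simp
  show "\<forall>x\<in>g ` {1..m}. \<forall>y\<in>g ` {1..m}. twin_key \<tau> x < twin_key \<tau> y \<longleftrightarrow>
      \<tau> (rk (g ` {1..m}) x) < \<tau> (rk (g ` {1..m}) y)"
    using r less by simp
qed

text \<open>The original entries form an occurrence of \<open>\<tau>\<close>, and so do the entries in which those on \<open>D\<close> are
replaced by their twins.\<close>

lemma twinned_overlapping:
  assumes \<tau>: "\<tau> permutes {1..m}" and D: "D \<subseteq> {1..m}"
  shows "pat (twin_key \<tau>) (twinned m D) \<in> overlapping \<tau> m (card D)"
proof -
  let ?K = "twinned m D" and ?g = "\<lambda>i. 2 * i + of_bool (i \<in> D) :: nat"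
  let ?\<rho> = "pat (twin_key \<tau>) ?K"
  have fK: "finite ?K" using D finite_subset finite_twinned by blast
  have inj: "inj_on (twin_key \<tau>) A" for A
    using inj_twin_key[OF permutes_inj[OF \<tau>]] inj_on_subset by blast
  have c: "card ?K = m + card D" by (rule card_twinned[OF D])
  have "?\<rho> permutes {1..m + card D}" using pat_permutes[OF fK inj] c by simp
  moreover have occs: "rk ?K ` g ` {1..m} \<in> occ \<tau> m ?\<rho> {1..m + card D}"
    if g: "\<And>i. g i div 2 = i" and sub: "g ` {1..m} \<subseteq> ?K" for g
  proof -
    have "inj_on g {1..m}" by (rule inj_onI) (metis g)
    from card_image[OF this] have "card (g ` {1..m}) = m" by simp
    with sub pat_twin_key[OF \<tau> g] have "g ` {1..m} \<in> occ \<tau> m (twin_key \<tau>) ?K"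
      unfolding occ_def by simp
    then show ?thesis using occ_pat[OF fK inj, of \<tau> m] unfolding c by (metis imageI)
  qed
  have g1: "2 * i div 2 = i" and g2: "?g i div 2 = i" for i by simp_all
  have s1: "(\<lambda>i. 2 * i) ` {1..m} \<subseteq> ?K" by (auto simp: twinned_def)
  have s2: "?g ` {1..m} \<subseteq> ?K" by (auto simp: twinned_def)
  have "?K \<subseteq> (\<lambda>i. 2 * i) ` {1..m} \<union> ?g ` {1..m}"
  proof
    fix x assume "x \<in> ?K"
    then consider "x \<in> (\<lambda>i. 2 * i) ` {1..m}" | i where "i \<in> D" "x = ?g i" by (auto simp: twinned_def)
    then show "x \<in> (\<lambda>i. 2 * i) ` {1..m} \<union> ?g ` {1..m}" using D by cases blast+
  qed
  then have "(\<lambda>i. 2 * i) ` {1..m} \<union> ?g ` {1..m} = ?K" using s1 s2 by blast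
  then have "rk ?K ` (\<lambda>i. 2 * i) ` {1..m} \<union> rk ?K ` ?g ` {1..m} = {1..m + card D}"
    using rk_image[OF fK] c by (metis image_Un)
  ultimately show ?thesis
    using occs[OF g1 s1] occs[OF g2 s2] unfolding overlapping_def by blast
qed

lemma rk_next:
  assumes "finite A" "y \<in> A" "x < y" "\<And>z. z \<in> A \<Longrightarrow> z < y \<Longrightarrow> z \<le> x"
  shows "rk A y = Suc (rk A x)"
proof -
  have "{z \<in> A. z \<le> y} = insert y {z \<in> A. z \<le> x}" using assms by force
  then show ?thesis unfolding rk_def using assms by simp
qed

text \<open>Let \<open>d\<close> be the first index in which the two sets differ. In the permutation for \<open>D\<close>, the entry \<open>d\<close>
is followed by its twin, at distance one in value. In the permutation for \<open>D'\<close>, the same place is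
followed by the entry \<open>d + 1\<close>. If the twin is above, the entry \<open>d + 1\<close> is below. If the twin is below,
the entry \<open>d + 1\<close> is above or some entry lies between them in value.\<close>

lemma twinned_neq:
  assumes \<tau>: "\<tau> permutes {1..m}" and D: "D \<subseteq> {1..m}" "D' \<subseteq> {1..m}" "card D = card D'"
    and d: "d \<in> D" "d \<notin> D'" "\<And>i. i < d \<Longrightarrow> i \<in> D \<longleftrightarrow> i \<in> D'"
  shows "pat (twin_key \<tau>) (twinned m D) \<noteq> pat (twin_key \<tau>) (twinned m D')"
proof
  let ?f = "twin_key \<tau>" and ?K = "twinned m D" and ?K' = "twinned m D'"
  assume eq: "pat ?f ?K = pat ?f ?K'"
  have fD: "finite D" "finite D'" using D finite_subset by blast+
  note fK = finite_twinned[OF fD(1), of m] and fK' = finite_twinned[OF fD(2), of m]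
  have inj: "inj \<tau>" using \<tau> permutes_inj by blast
  have "d < m"
  proof (rule ccontr)
    assume "\<not> d < m"
    then have "d = m" using d(1) D(1) by force
    have "D' \<subseteq> D"
    proof
      fix i assume "i \<in> D'"
      then have "i < d" using D(2) d(2) \<open>d = m\<close> by (metis atLeastAtMost_iff le_neq_implies_less subsetD)
      then show "i \<in> D" using d(3) \<open>i \<in> D'\<close> by blast
    qed
    then have "D' \<subset> D" using d by blast
    from psubset_card_mono[OF fD(1) this] show False using D(3) by simp
  qed
  have d1: "d \<in> {1..m}" using d(1) D(1) by blast
  have K: "2 * d \<in> ?K" "2 * d + 1 \<in> ?K" using d d1 by (simp_all add: mem_twinned)
  have K': "2 * d \<in> ?K'" "2 * d + 2 \<in> ?K'" "2 * d + 1 \<notin> ?K'"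
    using d d1 \<open>d < m\<close> by (simp_all add: mem_twinned)
  have p: "rk ?K (2 * d + 1) = Suc (rk ?K (2 * d))" using K by (intro rk_next fK) auto
  have p': "rk ?K' (2 * d + 2) = Suc (rk ?K' (2 * d))"
  proof (intro rk_next fK' K')
    fix z assume "z \<in> ?K'" "z < 2 * d + 2"
    then show "z \<le> 2 * d" using K'(3) by (cases "z = 2 * d + 1") auto
  qed auto
  have pp: "rk ?K (2 * d) = rk ?K' (2 * d)"
  proof -
    have "y \<in> ?K \<longleftrightarrow> y \<in> ?K'" if "y \<le> 2 * d" for y
    proof (cases "even y")
      case False
      then have "y div 2 < d" using that by (auto elim!: oddE)
      then show ?thesis using d(3) by (simp add: mem_twinned)
    qed (simp add: mem_twinned)
    then have "{y \<in> ?K. y \<le> 2 * d} = {y \<in> ?K'. y \<le> 2 * d}" by blast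
    then show ?thesis by (simp add: rk_def)
  qed
  have v: "rk (?f ` ?K) (?f (2 * d)) = rk (?f ` ?K') (?f (2 * d))"
    using pat_rk[OF fK K(1), of ?f] pat_rk[OF fK' K'(1), of ?f] eq pp by simp
  have v': "rk (?f ` ?K) (?f (2 * d + 1)) = rk (?f ` ?K') (?f (2 * d + 2))"
    using pat_rk[OF fK K(2), of ?f] pat_rk[OF fK' K'(2), of ?f] eq p p' pp by simp
  note fin = finite_imageI[OF fK, of ?f] and fin' = finite_imageI[OF fK', of ?f]
  note im = imageI[OF K(1), of ?f] imageI[OF K(2), of ?f] imageI[OF K'(1), of ?f] imageI[OF K'(2), of ?f]
  have f0: "?f (2 * d) = 3 * \<tau> d + 1" "?f (2 * d + 2) = 3 * \<tau> (Suc d) + 1" by (simp_all add: twin_key_def)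
  have gap: "z div 3 = \<tau> d \<longrightarrow> z = ?f (2 * d) \<or> z = ?f (2 * d + 1)" if "z \<in> ?f ` ?K" for z
  proof
    assume z: "z div 3 = \<tau> d"
    from that obtain x where x: "x \<in> ?K" "z = ?f x" by blast
    then have "\<tau> (x div 2) = \<tau> d" using z twin_key_div by metis
    then have "x div 2 = d" using inj by (simp add: inj_eq)
    then have "x = 2 * d \<or> x = 2 * d + 1" by presburger
    then show "z = ?f (2 * d) \<or> z = ?f (2 * d + 1)" using x by blast
  qed
  show False
  proof (cases "\<tau> (Suc d) + 1 = \<tau> d")
    case True
    then have "?f (2 * d) < ?f (2 * d + 1)" "?f (2 * d + 2) < ?f (2 * d)" by (simp_all add: twin_key_def)
    then have "rk (?f ` ?K) (?f (2 * d)) < rk (?f ` ?K) (?f (2 * d + 1))"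
      "rk (?f ` ?K') (?f (2 * d + 2)) < rk (?f ` ?K') (?f (2 * d))"
      using rk_less[OF fin im(2)] rk_less[OF fin' im(3)] by blast+
    then show False using v v' by simp
  next
    case False
    then have f1: "?f (2 * d + 1) = 3 * \<tau> d" by (simp add: twin_key_def)
    have s: "rk (?f ` ?K) (?f (2 * d)) = Suc (rk (?f ` ?K) (?f (2 * d + 1)))"
    proof (rule rk_next[OF fin im(1)])
      show "?f (2 * d + 1) < ?f (2 * d)" using f0 f1 by simp
      fix z assume z: "z \<in> ?f ` ?K" "z < ?f (2 * d)"
      show "z \<le> ?f (2 * d + 1)"
      proof (cases "z div 3 = \<tau> d")
        case True
        then show ?thesis using gap[OF z(1)] z(2) by auto
      next
        case False
        then show ?thesis using z(2) f0 f1 by linarith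
      qed
    qed
    then have s': "rk (?f ` ?K') (?f (2 * d)) = Suc (rk (?f ` ?K') (?f (2 * d + 2)))" using v v' by simp
    then have "?f (2 * d + 2) < ?f (2 * d)"
      using rk_mono[OF fin', of "?f (2 * d)" "?f (2 * d + 2)"] by linarith
    then have lt: "\<tau> (Suc d) + 1 < \<tau> d" using f0 False by simp
    have "\<tau> d \<in> {1..m}" using permutes_in_image[OF \<tau>] d1 by blast
    then have "\<tau> (Suc d) + 1 \<in> \<tau> ` {1..m}" using lt permutes_image[OF \<tau>] by simp
    then obtain e where e: "e \<in> {1..m}" "\<tau> e = \<tau> (Suc d) + 1" by force
    have "2 * e \<in> ?K'" using e by (simp add: mem_twinned)
    then have ie: "?f (2 * e) \<in> ?f ` ?K'" by (rule imageI)
    have fe: "?f (2 * e) = 3 * \<tau> e + 1" by (simp add: twin_key_def)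
    have "rk (?f ` ?K') (?f (2 * d + 2)) < rk (?f ` ?K') (?f (2 * e))"
      using f0 fe e by (intro rk_less[OF fin' ie]) simp
    moreover have "rk (?f ` ?K') (?f (2 * e)) < rk (?f ` ?K') (?f (2 * d))"
      using f0 fe e lt by (intro rk_less[OF fin' im(3)]) simp
    ultimately show False using s' by linarith
  qed
qed

lemma binomial_le_card_overlapping:
  assumes \<tau>: "\<tau> permutes {1..m}"
  shows "m choose j \<le> card (overlapping \<tau> m j)"
proof -
  let ?T = "{D. D \<subseteq> {1..m} \<and> card D = j}" and ?\<rho> = "\<lambda>D. pat (twin_key \<tau>) (twinned m D)"
  have "inj_on ?\<rho> ?T"
  proof (rule inj_onI, rule ccontr)
    fix D D' assume D: "D \<in> ?T" "D' \<in> ?T" and eq: "?\<rho> D = ?\<rho> D'" and "D \<noteq> D'"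
    then have "\<exists>d. d \<in> D \<longleftrightarrow> d \<notin> D'" by blast
    then have "\<exists>d. (d \<in> D \<longleftrightarrow> d \<notin> D') \<and> (\<forall>i. (i \<in> D \<longleftrightarrow> i \<notin> D') \<longrightarrow> d \<le> i)"
      by (rule ex_has_least_nat[of "\<lambda>d. d \<in> D \<longleftrightarrow> d \<notin> D'" _ "\<lambda>d. d", simplified, OF someI_ex])
    then obtain d where d: "d \<in> D \<longleftrightarrow> d \<notin> D'" "\<And>i. i < d \<Longrightarrow> i \<in> D \<longleftrightarrow> i \<in> D'"
      by (meson not_less)
    show False
    proof (cases "d \<in> D")
      case True
      then show False using twinned_neq[OF \<tau>, of D D' d] D d eq by simp
    next
      case False
      then show False using twinned_neq[OF \<tau>, of D' D d] D d eq by simp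
    qed
  qed
  then have "card ?T = card (?\<rho> ` ?T)" by (rule card_image[symmetric])
  moreover have "card (?\<rho> ` ?T) \<le> card (overlapping \<tau> m j)"
  proof (rule card_mono)
    show "finite (overlapping \<tau> m j)"
      unfolding overlapping_def by (rule finite_subset[OF _ finite_permutations[of "{1..m+j}"]]) auto
    show "?\<rho> ` ?T \<subseteq> overlapping \<tau> m j" using twinned_overlapping[OF \<tau>] by auto
  qed
  ultimately show ?thesis using n_subsets[of "{1..m}" j] by simp
qed

section \<open>Codes against overlaps\<close>

text \<open>The crude count suffices for \<open>j = 1\<close> and for large \<open>j\<close>; in between the sharper counts pay for the small
constant in the comparison below.\<close>

definition code_bound :: "nat \<Rightarrow> nat" where
  "code_bound j = (if j \<in> {2..6} then [1, 32, 520, 8728, 138236] ! (j - 2)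
     else ((2 * j - 1) choose j) * ((2 * j) choose j))"

lemma code_bound_small:
  "code_bound 1 = 2" "code_bound 2 = 1" "code_bound 3 = 32" "code_bound 4 = 520"
  "code_bound 5 = 8728" "code_bound 6 = 138236" "code_bound 7 = 5889312"
  by (simp_all add: code_bound_def binomial_fact' fact_numeral)

lemma card_codes_le:
  assumes "1 \<le> j" and \<delta>: "\<delta> permutes {1..j}"
  shows "card (codes j \<delta>) \<le> code_bound j"
proof -
  consider "j \<notin> {2..6}" | "j = 2" | "j = 3" | "j = 4" | "j = 5" | "j = 6" by force
  then show ?thesis
  proof cases
    case 1
    then show ?thesis using card_codes_le_binomial[OF assms(1)] unfolding code_bound_def by (simp only: if_False)
  next
    case 2 then show ?thesis using card_codes_2 \<delta> code_bound_small by simp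
  next
    case 3 then show ?thesis using card_codes_3 \<delta> code_bound_small by simp
  next
    case 4 then show ?thesis using card_codes_4 \<delta> code_bound_small by simp
  next
    case 5 then show ?thesis using card_codes_5 \<delta> code_bound_small by simp
  next
    case 6 then show ?thesis using card_codes_6 \<delta> code_bound_small by simp
  qed
qed

lemma Suc_times_binomial_Suc: "Suc k * (n choose Suc k) = (n - k) * (n choose k)"
  by (simp only: binomial_absorption binomial_absorb_comp)

lemma code_bound_Suc_le:
  assumes "7 \<le> j"
  shows "code_bound (Suc j) \<le> 16 * code_bound j"
proof -
  have half: "(2 * i) choose i = 2 * ((2 * i - 1) choose i)" if "1 \<le> i" for i :: nat
  proof -
    from that obtain k where k: "i = Suc k" by (cases i) auto
    have "Suc (2 * k) choose k = Suc (2 * k) choose Suc k"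
      using binomial_symmetric[of k "Suc (2 * k)"] by (simp add: Suc_diff_le mult_2)
    then show ?thesis unfolding k by simp
  qed
  have "(2 * Suc j - 1) choose Suc j = (2 * j choose j) + (2 * j choose Suc j)" by simp
  also have "\<dots> \<le> 2 * (2 * j choose j)" using binomial_maximum'[of j "Suc j"] by simp
  finally have le: "(2 * Suc j - 1) choose Suc j \<le> 4 * ((2 * j - 1) choose j)"
    using half[of j] assms by simp
  have "(2 * Suc j) choose Suc j \<le> 4 * (2 * j choose j)"
    using half[of j] half[of "Suc j"] le assms by simp
  with le have "((2 * Suc j - 1) choose Suc j) * ((2 * Suc j) choose Suc j) \<le>
      (4 * ((2 * j - 1) choose j)) * (4 * (2 * j choose j))"
    by (rule mult_le_mono)
  then show ?thesis using assms unfolding code_bound_def by simp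
qed

text \<open>The polynomial arises in the next lemma. Up to \<open>y = 23/100\<close> the bound \<open>v \<le> y\<^sup>2 / 2\<close> is strong enough;
beyond that, \<open>y + v \<le> 1/4\<close> leaves almost no room for \<open>v\<close>.\<close>

lemma weighted_tail_le:
  fixes v y :: real
  assumes y: "0 \<le> y" and v: "0 \<le> v" "v \<le> y\<^sup>2 / 2" "y + v \<le> 1/4"
  shows "v * (29/3 * y + 517/12 * y^2 + 8725/60 * y^3 + 138233/360 * y^4 + 11778624/2520 * y^5) \<le> y + 2 * v"
proof -
  let ?H = "\<lambda>y::real. 29/3 * y + 517/12 * y^2 + 8725/60 * y^3 + 138233/360 * y^4 + 11778624/2520 * y^5"
  have mono: "?H y \<le> ?H c" if "y \<le> c" for c
    using that y by (intro add_mono mult_left_mono power_mono) auto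
  show ?thesis
  proof (cases "y \<le> 23/100")
    case True
    from mono[OF True] have H: "?H y - 2 \<le> 836/100" by (simp add: power_divide)
    have "v * (?H y - 2) \<le> v * (836/100)" using H v(1) by (rule mult_left_mono)
    also have "\<dots> \<le> y\<^sup>2 / 2 * (836/100)" using v(2) by simp
    also have "\<dots> = y * (y * (418/100))" by (simp add: power2_eq_square)
    also have "\<dots> \<le> y * 1" using True y by (intro mult_left_mono) auto
    finally show ?thesis by (simp add: algebra_simps)
  next
    case False
    then have "v \<le> 2/100" using v(3) by simp
    have "y \<le> 1/4" using v by simp
    from mono[OF this] have H: "?H y - 2 \<le> 1146/100" by (simp add: power_divide)
    have "v * (?H y - 2) \<le> v * (1146/100)" using H v(1) by (rule mult_left_mono)
    also have "\<dots> \<le> 2/100 * (1146/100)" using \<open>v \<le> 2/100\<close> by simp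
    also have "\<dots> \<le> y" using False by simp
    finally show ?thesis by (simp add: algebra_simps)
  qed
qed

text \<open>The terms \<open>u j\<close> decay like \<open>y ^ j / j!\<close> with \<open>y < 1/4\<close>, while the code bounds grow like \<open>16 ^ j\<close>. The first
two terms have coefficients below \<open>3\<close> and leave a surplus of \<open>y + 2 * u 2\<close>. It covers the terms up to
\<open>j = 6\<close>, which are expressed through \<open>u 2\<close>, and the tail, in which each term is at most half of the one
before.\<close>

lemma sum_code_bound_le:
  fixes u :: "nat \<Rightarrow> real" and y :: real
  assumes u0: "\<And>j. 0 \<le> u j" and u1: "u 1 = y"
    and step: "\<And>j. 1 \<le> j \<Longrightarrow> u (Suc j) * real (Suc j) \<le> y * u j"
    and N: "2 \<le> N" and small: "y + u 2 \<le> 1/4"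
  shows "(\<Sum>j = 1..N. code_bound j * u j) \<le> 3 * (\<Sum>j = 1..N. u j)"
proof -
  define v where "v = u 2"
  have y: "0 \<le> y" "y \<le> 1/4" using u0[of 1] u0[of 2] u1 small by simp_all
  have v: "0 \<le> v" "v \<le> y\<^sup>2 / 2"
    using u0[of 2] step[of 1] u1 by (simp_all add: v_def power2_eq_square numeral_2_eq_2)
  have st: "u k \<le> y * u (k - 1) / k" if "2 \<le> k" for k
    using step[of "k - 1"] that by (simp add: field_simps)
  have next': "u k \<le> y * b / k" if "2 \<le> k" "u (k - 1) \<le> b" for k b
  proof -
    have "y * u (k - 1) / k \<le> y * b / k" using that y by (intro divide_right_mono mult_left_mono) auto
    then show ?thesis using st[OF that(1)] by simp
  qed
  have u3: "u 3 \<le> v * y / 3" using st[of 3] by (simp add: v_def mult.commute)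
  have u4: "u 4 \<le> v * y^2 / 12" using next'[of 4 "v * y / 3"] u3 by (simp add: power2_eq_square mult_ac)
  have u5: "u 5 \<le> v * y^3 / 60" using next'[of 5 "v * y^2 / 12"] u4 by (simp add: power_def mult_ac)
  have u6: "u 6 \<le> v * y^4 / 360" using next'[of 6 "v * y^3 / 60"] u5 by (simp add: eval_nat_numeral mult_ac)
  have u7: "u 7 \<le> v * y^5 / 2520" using next'[of 7 "v * y^4 / 360"] u6 by (simp add: eval_nat_numeral mult_ac)
  define w where "w j = code_bound j * u j" for j
  have w0: "0 \<le> w j" for j using u0 by (simp add: w_def)
  have half: "2 * w (Suc j) \<le> w j" if "7 \<le> j" for j
  proof -
    have c: "real (code_bound (Suc j)) \<le> 16 * real (code_bound j)"
      using code_bound_Suc_le[OF that] by (metis of_nat_le_iff of_nat_mult of_nat_numeral)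
    have "u (Suc j) * 8 \<le> u (Suc j) * real (Suc j)" using that u0 by (intro mult_left_mono) auto
    also have "\<dots> \<le> y * u j" using step[of j] that by simp
    also have "\<dots> \<le> 1/4 * u j" using y u0 by (intro mult_right_mono) auto
    finally have "32 * u (Suc j) \<le> u j" by simp
    have "2 * w (Suc j) \<le> 2 * (16 * real (code_bound j) * u (Suc j))"
      unfolding w_def using mult_right_mono[OF c u0[of "Suc j"]] by (simp add: mult_ac)
    also have "\<dots> = real (code_bound j) * (32 * u (Suc j))" by simp
    also have "\<dots> \<le> w j" unfolding w_def using \<open>32 * u (Suc j) \<le> u j\<close> by (intro mult_left_mono) auto
    finally show ?thesis .
  qed
  have tail: "(\<Sum>j = 7..7 + i. w j) + w (7 + i) \<le> 2 * w 7" for i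
  proof (induction i)
    case (Suc i)
    have "(\<Sum>j = 7..Suc (7 + i). w j) = (\<Sum>j = 7..7 + i. w j) + w (Suc (7 + i))"
      by (subst sum.nat_ivl_Suc') linarith+
    moreover have "2 * w (Suc (7 + i)) \<le> w (7 + i)" by (rule half) simp
    ultimately show ?case using Suc unfolding add_Suc_right by linarith
  qed simp
  \<comment> \<open>The coefficient of \<open>g j\<close> is \<open>-1\<close> for \<open>j = 1\<close>, \<open>-2\<close> for \<open>j = 2\<close> and nonnegative afterwards.\<close>
  define g where "g j = (real (code_bound j) - 3) * u j" for j
  have g0: "0 \<le> g j" if "3 \<le> j" for j
  proof -
    have "3 \<le> code_bound j"
    proof (cases "j \<le> 6")
      case True
      then have "j \<in> {3, 4, 5, 6}" using that by auto
      then show ?thesis using code_bound_small by auto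
    next
      case False
      then have "1 \<le> (2 * j - 1) choose j" "(2 * j) choose 1 \<le> (2 * j) choose j"
        using binomial_maximum'[of j 1] by (auto simp: Suc_le_eq)
      then have "1 * (2 * j) \<le> ((2 * j - 1) choose j) * ((2 * j) choose j)"
        by (intro mult_le_mono) auto
      then show ?thesis using False by (simp add: code_bound_def)
    qed
    then show ?thesis using u0 by (simp add: g_def)
  qed
  have "(\<Sum>j = 1..N. g j) \<le> (\<Sum>j = 1..N + 7. g j)"
    using N g0 by (intro sum_mono2) auto
  also have "{1..N + 7} = {1, 2, 3, 4, 5, 6} \<union> {7..7 + N}" by auto
  also have "sum g \<dots> = g 1 + g 2 + g 3 + g 4 + g 5 + g 6 + (\<Sum>j = 7..7 + N. g j)"
    by (subst sum.union_disjoint) auto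
  also have "(\<Sum>j = 7..7 + N. g j) \<le> (\<Sum>j = 7..7 + N. w j)"
    using u0 by (intro sum_mono) (simp add: g_def w_def algebra_simps)
  also have "\<dots> \<le> 2 * w 7" using tail[of N] w0[of "7 + N"] by linarith
  also have "g 1 + g 2 + g 3 + g 4 + g 5 + g 6 + 2 * w 7 =
      29 * u 3 + 517 * u 4 + 8725 * u 5 + 138233 * u 6 + 11778624 * u 7 - y - 2 * v"
    using u1 by (simp add: g_def w_def code_bound_small v_def del: One_nat_def)
  also have "\<dots> \<le> v * (29/3 * y + 517/12 * y^2 + 8725/60 * y^3 + 138233/360 * y^4 + 11778624/2520 * y^5) - y - 2 * v"
    using u3 u4 u5 u6 u7 by (simp add: algebra_simps)
  also have "\<dots> \<le> 0" using weighted_tail_le[of y v] y v small by (simp add: v_def)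
  finally have "(\<Sum>j = 1..N. g j) \<le> 0" by simp
  then show ?thesis by (simp add: g_def left_diff_distrib sum_subtractf sum_distrib_left)
qed

lemma d2_eq_sum_overlapping:
  "d2 n m \<tau> = 2 * (\<Sum>j = 1..m - 1. real (n choose (m + j)) / fact (m + j) * card (overlapping \<tau> m j))"
proof -
  have "d2 n m \<tau> = (\<Sum>j = 1..m - 1. real (n choose (m + j)) * (2 * real (card (overlapping \<tau> m j)) / fact (m + j)))"
    unfolding d2_def
    by (rule sum.reindex_bij_witness[of _ "\<lambda>j. m - j" "\<lambda>s. m - s"])
      (auto simp: overlap_eq_card_overlapping[symmetric] Suc_le_eq intro!: arg_cong2[of _ _ _ _ "(*)"] arg_cong2[of _ _ _ _ "(/)"] arg_cong[of _ _ "\<lambda>k. n choose k"] arg_cong[of _ _ fact])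
  also have "\<dots> = 2 * (\<Sum>j = 1..m - 1. real (n choose (m + j)) / fact (m + j) * card (overlapping \<tau> m j))"
    unfolding sum_distrib_left by (intro sum.cong) auto
  finally show ?thesis .
qed

text \<open>With \<open>\<lambda> * u j = binomial n (m + j) / (m + j)! * binomial m j\<close>, the lower bound for the overlaps turns the
hypothesis into \<open>4 * (u 1 + \<dots> + u (m - 1)) < 1\<close>. Since \<open>u 1 = (n - m) * m / (m + 1)\<^sup>2\<close>, this forces
\<open>n < 2 * m\<close>, so that any two occurrences meet. The same lower bound absorbs the petals: they contribute
at most \<open>3\<close> times as much as the overlaps do, hence the total is at most \<open>4\<close> times the contribution of
the overlaps, which is \<open>2 * d2\<close>.\<close>

lemma small_d2:
  fixes n m :: nat and \<tau> :: "nat \<Rightarrow> nat"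
  defines "w \<equiv> \<lambda>\<sigma>. card (occ \<tau> m \<sigma> {1..n})"
  assumes m: "3 \<le> m" "m \<le> n" and \<tau>: "\<tau> permutes {1..m}"
    and small: "2 * d2 n m \<tau> < lambda_mean n m"
  shows "n < 2 * m"
    and "(\<Sum>\<sigma> | \<sigma> permutes {1..n}. real (w \<sigma>) * of_bool (2 \<le> w \<sigma>)) \<le> fact n * (2 * d2 n m \<tau>)"
proof -
  let ?l = "lambda_mean n m"
  define a where "a j = real (n choose (m + j)) / fact (m + j)" for j
  define u where "u j = a j * real (m choose j) / ?l" for j
  define y where "y = real (n - m) * real m / (real m + 1)^2"
  let ?L = "\<lambda>j. real (card (overlapping \<tau> m j))"
  have l: "?l > 0" "a 0 = ?l" using m by (simp_all add: lambda_mean_def a_def)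
  have a0: "0 \<le> a j" for j by (simp add: a_def)
  have u0: "0 \<le> u j" for j using a0 l by (simp add: u_def)
  have au: "a j * real (m choose j) = ?l * u j" for j using l by (simp add: u_def)
  have eq: "u (Suc j) * real (Suc j) = u j * (real (n - m - j) * real (m - j) / (real (m + j + 1))^2)" for j
  proof -
    define t where "t = real (m + j + 1)"
    have t: "t > 0" by (simp add: t_def)
    have "real (Suc (m + j) * (n choose Suc (m + j))) = real ((n - (m + j)) * (n choose (m + j)))"
      by (simp only: Suc_times_binomial_Suc)
    then have "t * real (n choose (m + Suc j)) = real (n - m - j) * real (n choose (m + j))"
      by (simp add: t_def distrib_right add_ac)
    then have "real (n choose (m + Suc j)) = real (n - m - j) * real (n choose (m + j)) / t"
      using t by (simp add: field_simps)
    moreover have "fact (m + Suc j) = t * (fact (m + j) :: real)" by (simp add: t_def)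
    ultimately have ra: "a (Suc j) = a j * real (n - m - j) / t^2"
      unfolding a_def by (simp add: power2_eq_square mult_ac)
    have "real (Suc j * (m choose Suc j)) = real ((m - j) * (m choose j))"
      by (simp only: Suc_times_binomial_Suc)
    then have "real (Suc j) * real (m choose Suc j) = real (m - j) * real (m choose j)" by (simp only: of_nat_mult)
    note rm = this
    have "u (Suc j) * real (Suc j) =
        a j * real (n - m - j) / t^2 * (real (Suc j) * real (m choose Suc j)) / ?l"
      unfolding u_def ra by (simp add: mult_ac)
    then show ?thesis
      unfolding u_def rm t_def[symmetric] by (simp add: mult_ac)
  qed
  have "real (n - m - j) * real (m - j) / (real (m + j + 1))^2 \<le> y" for j
    unfolding y_def by (intro frac_le mult_mono power_mono) auto
  from mult_left_mono[OF this u0] have step: "u (Suc j) * real (Suc j) \<le> y * u j" for j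
    unfolding eq by (simp only: mult.commute[of y])
  have "u 0 = 1" using l by (simp add: u_def)
  then have u1: "u 1 = y" using eq[of 0] by (simp add: y_def add.commute)
  have L: "a j * real (m choose j) \<le> a j * ?L j" for j
    using binomial_le_card_overlapping[OF \<tau>, of j] a0 by (intro mult_left_mono) auto
  have d2: "d2 n m \<tau> = 2 * (\<Sum>j = 1..m - 1. a j * ?L j)"
    unfolding d2_eq_sum_overlapping a_def ..
  have "?l * (\<Sum>j = 1..m - 1. u j) \<le> (\<Sum>j = 1..m - 1. a j * ?L j)"
    unfolding sum_distrib_left au[symmetric] by (intro sum_mono L)
  then have "?l * (4 * (\<Sum>j = 1..m - 1. u j)) < ?l * 1" using small d2 by simp
  then have "4 * (\<Sum>j = 1..m - 1. u j) < 1" using l(1) by (simp only: mult_less_cancel_left_pos)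
  moreover have "(\<Sum>j\<in>{1,2}. u j) \<le> (\<Sum>j = 1..m - 1. u j)" using m u0 by (intro sum_mono2) auto
  ultimately have y2: "y + u 2 < 1/4" using u1 by simp
  then have y4: "y < 1/4" using u0[of 2] by simp
  have "n - m < m"
  proof (rule ccontr)
    assume "\<not> n - m < m"
    then have "real m * real m / (real m + 1)^2 \<le> y" unfolding y_def
      by (intro divide_right_mono mult_right_mono) auto
    then have "real m * real m / (real m + 1)^2 < 1/4" using y4 by linarith
    moreover have "0 < (real m + 1)^2" by simp
    ultimately have "4 * (real m * real m) < (real m + 1)^2"
      using pos_divide_less_eq[of "(real m + 1)^2" "real m * real m" "1/4"] by linarith
    moreover have "(real m + 1)^2 \<le> (2 * real m)^2" using m by (intro power_mono) auto
    ultimately show False by (simp add: power2_eq_square)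
  qed
  then show nm: "n < 2 * m" by simp
  have P: "a j * card (petals \<tau> m j) \<le> ?l * (code_bound j * u j)" if "j \<in> {1..m-1}" for j
  proof -
    have "card (petals \<tau> m j) \<le> (m choose j) * code_bound j"
      using card_petals_le[OF \<tau>] card_codes_le that by simp
    then have "real (card (petals \<tau> m j)) \<le> real (m choose j) * real (code_bound j)"
      by (metis of_nat_le_iff of_nat_mult)
    then have "a j * card (petals \<tau> m j) \<le> a j * (real (m choose j) * real (code_bound j))"
      using a0 by (rule mult_left_mono)
    also have "\<dots> = ?l * u j * code_bound j" unfolding au[symmetric] by simp
    finally show ?thesis by (simp add: mult_ac)
  qed
  have "(\<Sum>j = 1..m - 1. a j * card (petals \<tau> m j)) \<le> ?l * (\<Sum>j = 1..m - 1. code_bound j * u j)"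
    unfolding sum_distrib_left by (intro sum_mono P)
  also have "\<dots> \<le> ?l * (3 * (\<Sum>j = 1..m - 1. u j))"
    using sum_code_bound_le[of u y "m - 1"] u0 u1 step m y2 l by (intro mult_left_mono) auto
  also have "\<dots> = 3 * (\<Sum>j = 1..m - 1. a j * real (m choose j))"
    unfolding au by (simp add: sum_distrib_left mult_ac)
  also have "\<dots> \<le> 3 * (\<Sum>j = 1..m - 1. a j * ?L j)" by (intro mult_left_mono sum_mono L) auto
  finally have pet: "(\<Sum>j = 1..m - 1. a j * card (petals \<tau> m j)) \<le> 3 * (\<Sum>j = 1..m - 1. a j * ?L j)" .
  have "(\<Sum>\<sigma> | \<sigma> permutes {1..n}. real (w \<sigma>) * of_bool (2 \<le> w \<sigma>)) \<le>
      fact n * (\<Sum>j = 1..m - 1. real (n choose (m + j)) *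
        ((card (overlapping \<tau> m j) + card (petals \<tau> m j)) / fact (m + j)))"
    unfolding w_def by (rule sum_card_occ_le[OF nm])
  also have "(\<Sum>j = 1..m - 1. real (n choose (m + j)) *
        ((card (overlapping \<tau> m j) + card (petals \<tau> m j)) / fact (m + j))) =
      (\<Sum>j = 1..m - 1. a j * ?L j) + (\<Sum>j = 1..m - 1. a j * card (petals \<tau> m j))"
    unfolding sum.distrib[symmetric] a_def by (intro sum.cong) (auto simp: field_simps)
  also have "fact n * \<dots> \<le> fact n * (2 * d2 n m \<tau>)"
    using pet d2 by (intro mult_left_mono) auto
  finally show "(\<Sum>\<sigma> | \<sigma> permutes {1..n}. real (w \<sigma>) * of_bool (2 \<le> w \<sigma>)) \<le> fact n * (2 * d2 n m \<tau>)" .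
qed

section \<open>Total variation distance near a point mass\<close>

text \<open>Outside of \<open>z\<close> and \<open>F\<close> the measure \<open>P\<close> has at most the mass \<open>sum p F - measure P F\<close>. On \<open>F\<close> both
measures are compared with \<open>p\<close>.\<close>

lemma measure_diff_le_atoms:
  fixes p :: "'a \<Rightarrow> real"
  assumes P: "prob_space P" and Q: "prob_space Q" and sets: "sets P = sets Q"
    and F: "finite F" "z \<notin> F" "\<And>x. x \<in> insert z F \<Longrightarrow> {x} \<in> sets P"
    and pQ: "\<And>x. x \<in> F \<Longrightarrow> measure P {x} \<le> p x \<and> measure Q {x} \<le> p x"
    and z: "1 - sum p F \<le> measure P {z}"
    and A: "A \<in> sets P" "z \<notin> A"
  shows "measure P A - measure Q A \<le> (sum p F - measure P F) + (sum p F - measure Q F)"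
    and "measure P A - measure Q A \<le> sum p F"
proof -
  interpret P: prob_space P by (rule P)
  interpret Q: prob_space Q by (rule Q)
  have G: "G \<in> sets P" "measure P G = (\<Sum>x\<in>G. measure P {x})" "measure Q G = (\<Sum>x\<in>G. measure Q {x})"
    if "G \<subseteq> F" for G
  proof -
    have f: "finite G" using that F(1) finite_subset by blast
    have s: "{x} \<in> sets P" if "x \<in> G" for x using that \<open>G \<subseteq> F\<close> F(3) by blast
    have "(\<Union>x\<in>G. {x}) \<in> sets P" by (intro sets.finite_UN f s)
    then show "G \<in> sets P" by simp
    show "measure P G = (\<Sum>x\<in>G. measure P {x})" by (rule P.finite_measure_eq_sum_singleton[OF f s])
    show "measure Q G = (\<Sum>x\<in>G. measure Q {x})"
      by (rule Q.finite_measure_eq_sum_singleton[OF f]) (use s sets in auto)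
  qed
  have zs: "{z} \<in> sets P" using F(3) by blast
  have zF: "{z} \<union> F \<in> sets P" using zs G(1)[of F] by blast
  have "measure P (A - F) \<le> measure P (space P - ({z} \<union> F))"
    using A sets.sets_into_space[OF A(1)] zF by (intro P.finite_measure_mono) auto
  also have "\<dots> = 1 - measure P ({z} \<union> F)" by (rule P.prob_compl[OF zF])
  also have "measure P ({z} \<union> F) = measure P {z} + measure P F"
    using F(2) by (intro P.finite_measure_Union zs G(1)) auto
  finally have rest: "measure P (A - F) \<le> sum p F - measure P F" using z by simp
  have "measure P A = measure P ((A \<inter> F) \<union> (A - F))" by (simp add: Int_Diff_Un)
  also have "\<dots> = measure P (A \<inter> F) + measure P (A - F)"
    using A(1) G(1)[of F] by (intro P.finite_measure_Union) auto
  finally have PA: "measure P A = measure P (A \<inter> F) + measure P (A - F)" .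
  have QA: "measure Q (A \<inter> F) \<le> measure Q A"
    using A(1) sets by (intro Q.finite_measure_mono) auto
  have "measure P (A \<inter> F) - measure Q (A \<inter> F) \<le> (\<Sum>x\<in>A \<inter> F. p x - measure Q {x})"
    unfolding G(2)[OF Int_lower2] G(3)[OF Int_lower2] sum_subtractf[symmetric]
    using pQ by (intro sum_mono) auto
  also have "\<dots> \<le> (\<Sum>x\<in>F. p x - measure Q {x})"
    using F(1) pQ by (intro sum_mono2) auto
  also have "\<dots> = sum p F - measure Q F" by (simp add: G(3)[OF order_refl] sum_subtractf)
  finally have "measure P (A \<inter> F) - measure Q (A \<inter> F) \<le> sum p F - measure Q F" .
  then show "measure P A - measure Q A \<le> (sum p F - measure P F) + (sum p F - measure Q F)"
    using PA QA rest by simp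
  have "measure P A \<le> measure P (space P - {z})"
    using A sets.sets_into_space[OF A(1)] zs by (intro P.finite_measure_mono) auto
  also have "\<dots> = 1 - measure P {z}" by (rule P.prob_compl[OF zs])
  finally show "measure P A - measure Q A \<le> sum p F" using z measure_nonneg[of Q A] by linarith
qed

text \<open>The set \<open>A\<close> and its complement give the same difference up to sign, and one of them avoids \<open>z\<close>.\<close>

lemma tv_dist_le_atoms:
  fixes p :: "'a \<Rightarrow> real"
  assumes P: "prob_space P" and Q: "prob_space Q" and sets: "sets P = sets Q"
    and F: "finite F" "z \<notin> F" "\<And>x. x \<in> insert z F \<Longrightarrow> {x} \<in> sets P"
    and p: "\<And>x. x \<in> F \<Longrightarrow> measure P {x} \<le> p x" "\<And>x. x \<in> F \<Longrightarrow> measure Q {x} \<le> p x"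
    and z: "1 - sum p F \<le> measure P {z}" "1 - sum p F \<le> measure Q {z}"
  shows "tv_dist P Q \<le> (sum p F - measure P F) + (sum p F - measure Q F)"
    and "tv_dist P Q \<le> sum p F" and "tv_dist P Q \<le> 1"
proof -
  interpret P: prob_space P by (rule P)
  interpret Q: prob_space Q by (rule Q)
  have F': "{x} \<in> sets Q" if "x \<in> insert z F" for x using F(3)[OF that] sets by simp
  have ne: "sets P \<noteq> {}" using sets.top by blast
  have *: "\<bar>measure P A - measure Q A\<bar> \<le> (sum p F - measure P F) + (sum p F - measure Q F) \<and>
      \<bar>measure P A - measure Q A\<bar> \<le> sum p F" if A: "A \<in> sets P" "z \<notin> A" for A
  proof -
    have p1: "measure P {x} \<le> p x \<and> measure Q {x} \<le> p x" if "x \<in> F" for x using p that by blast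
    have p2: "measure Q {x} \<le> p x \<and> measure P {x} \<le> p x" if "x \<in> F" for x using p that by blast
    have A': "A \<in> sets Q" using A(1) sets by simp
    show ?thesis
      using measure_diff_le_atoms[OF P Q sets F p1 z(1) A]
        measure_diff_le_atoms[OF Q P sets[symmetric] F(1,2) F' p2 z(2) A' A(2)]
      by linarith
  qed
  have sp: "space P = space Q" using sets by (rule sets_eq_imp_space_eq)
  have **: "\<bar>measure P A - measure Q A\<bar> \<le> (sum p F - measure P F) + (sum p F - measure Q F) \<and>
      \<bar>measure P A - measure Q A\<bar> \<le> sum p F" if A: "A \<in> sets P" for A
  proof (cases "z \<in> A")
    case True
    have "measure P (space P - A) = 1 - measure P A" "measure Q (space P - A) = 1 - measure Q A"
      using P.prob_compl[OF A] Q.prob_compl[of A] A sets sp by simp_all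
    moreover have "space P - A \<in> sets P" using A by blast
    ultimately show ?thesis using *[of "space P - A"] True by (simp add: abs_minus_commute)
  qed (use * A in blast)
  show "tv_dist P Q \<le> (sum p F - measure P F) + (sum p F - measure Q F)" "tv_dist P Q \<le> sum p F"
    unfolding tv_dist_def using ** by (intro cSUP_least[OF ne]; blast)+
  show "tv_dist P Q \<le> 1"
    unfolding tv_dist_def
  proof (intro cSUP_least[OF ne])
    fix A show "\<bar>measure P A - measure Q A\<bar> \<le> 1"
      using P.prob_le_1[of A] Q.prob_le_1[of A] measure_nonneg[of P A] measure_nonneg[of Q A]
      by (simp only: abs_le_iff) linarith
  qed
qed

section \<open>Occurrences in a uniform permutation\<close>

lemma card_occ_eq_sum:
  "real (card (occ \<tau> m \<sigma> {1..n})) = (\<Sum>\<alpha> | \<alpha> \<subseteq> {1..n} \<and> card \<alpha> = m. of_bool (pat \<sigma> \<alpha> = \<tau>))"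
proof -
  have "occ \<tau> m \<sigma> {1..n} = {\<alpha> \<in> {\<alpha>. \<alpha> \<subseteq> {1..n} \<and> card \<alpha> = m}. pat \<sigma> \<alpha> = \<tau>}"
    by (auto simp: occ_def)
  moreover have "finite {\<alpha>. \<alpha> \<subseteq> {1..n} \<and> card \<alpha> = m}"
    by (rule finite_subset[of _ "Pow {1..n}"]) auto
  ultimately show ?thesis by (simp add: of_bool_def sum.If_cases Int_def)
qed

lemma sum_pat_eq:
  assumes "\<tau> permutes {1..m}" "\<alpha> \<subseteq> {1..n}" "card \<alpha> = m"
  shows "(\<Sum>\<sigma> | \<sigma> permutes {1..n}. of_bool (pat \<sigma> \<alpha> = \<tau>)) = fact n * (1 / fact m :: real)"
proof -
  have "(\<Sum>\<rho> | \<rho> permutes {1..m}. of_bool (\<rho> = \<tau>)) = (1 :: real)"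
    using assms(1) finite_permutations[of "{1..m}"] by (simp add: of_bool_def sum.delta)
  then show ?thesis using sum_pat[OF assms(2), of "\<lambda>\<rho>. of_bool (\<rho> = \<tau>)"] assms(3) by simp
qed

lemma sum_card_occ:
  assumes "\<tau> permutes {1..m}"
  shows "(\<Sum>\<sigma> | \<sigma> permutes {1..n}. real (card (occ \<tau> m \<sigma> {1..n}))) = fact n * lambda_mean n m"
proof -
  have "(\<Sum>\<sigma> | \<sigma> permutes {1..n}. real (card (occ \<tau> m \<sigma> {1..n}))) =
      (\<Sum>\<alpha> | \<alpha> \<subseteq> {1..n} \<and> card \<alpha> = m. \<Sum>\<sigma> | \<sigma> permutes {1..n}. of_bool (pat \<sigma> \<alpha> = \<tau>))"
    unfolding card_occ_eq_sum by (rule sum.swap)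
  also have "\<dots> = (\<Sum>\<alpha> | \<alpha> \<subseteq> {1..n} \<and> card \<alpha> = m. fact n * (1 / fact m :: real))"
    by (intro sum.cong refl sum_pat_eq assms) auto
  also have "\<dots> = fact n * lambda_mean n m" using n_subsets[of "{1..n}" m] by (simp add: lambda_mean_def)
  finally show ?thesis .
qed

lemma expectation_uniform:
  fixes f :: "(nat \<Rightarrow> nat) \<Rightarrow> real"
  assumes S: "S \<in> M \<rightarrow>\<^sub>M count_space {p. p permutes {1..n}}"
    and unif: "distr M (count_space {p. p permutes {1..n}}) S = uniform_count_measure {p. p permutes {1..n}}"
  shows "(\<integral>\<omega>. f (S \<omega>) \<partial>M) = (\<Sum>\<sigma> | \<sigma> permutes {1..n}. f \<sigma>) / fact n"
proof -
  let ?\<Omega> = "{p. p permutes {1..n}}"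
  have "finite ?\<Omega>" by (simp add: finite_permutations)
  moreover have "card ?\<Omega> = fact n" using card_permutations[of "{1..n}" n] by simp
  moreover have "(\<integral>\<omega>. f (S \<omega>) \<partial>M) = integral\<^sup>L (distr M (count_space ?\<Omega>) S) f"
    by (rule integral_distr[symmetric, OF S]) simp
  ultimately show ?thesis unfolding unif by (simp add: integral_uniform_count_measure)
qed

lemma law_uniform:
  assumes M: "prob_space M" and S: "S \<in> M \<rightarrow>\<^sub>M count_space {p. p permutes {1..n}}"
    and unif: "distr M (count_space {p. p permutes {1..n}}) S = uniform_count_measure {p. p permutes {1..n}}"
    and g: "\<And>\<sigma>. \<sigma> permutes {1..n} \<Longrightarrow> g \<sigma> \<in> space N"
  shows "prob_space (distr M N (\<lambda>\<omega>. g (S \<omega>)))"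
    and "A \<in> sets N \<Longrightarrow> measure (distr M N (\<lambda>\<omega>. g (S \<omega>))) A =
      (\<Sum>\<sigma> | \<sigma> permutes {1..n}. of_bool (g \<sigma> \<in> A)) / fact n"
proof -
  interpret M: prob_space M by (rule M)
  have m: "(\<lambda>\<omega>. g (S \<omega>)) \<in> M \<rightarrow>\<^sub>M N" by (intro measurable_compose[OF S]) (simp add: g)
  show "prob_space (distr M N (\<lambda>\<omega>. g (S \<omega>)))" by (rule M.prob_space_distr[OF m])
  assume A: "A \<in> sets N"
  have "measure (distr M N (\<lambda>\<omega>. g (S \<omega>))) A = M.expectation (indicator ((\<lambda>\<omega>. g (S \<omega>)) -` A \<inter> space M))"
    using measurable_sets[OF m A] by (simp add: measure_distr[OF m A])
  also have "\<dots> = M.expectation (\<lambda>\<omega>. of_bool (g (S \<omega>) \<in> A))"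
    by (rule Bochner_Integration.integral_cong) (auto simp: indicator_def)
  also have "\<dots> = (\<Sum>\<sigma> | \<sigma> permutes {1..n}. of_bool (g \<sigma> \<in> A)) / fact n"
    by (rule expectation_uniform[OF S unif])
  finally show "measure (distr M N (\<lambda>\<omega>. g (S \<omega>))) A =
      (\<Sum>\<sigma> | \<sigma> permutes {1..n}. of_bool (g \<sigma> \<in> A)) / fact n" .
qed

section \<open>Independent indicators\<close>

definition zero_vec :: "'i set \<Rightarrow> 'i \<Rightarrow> real" where
  "zero_vec J = (\<lambda>\<beta>\<in>J. 0)"

definition unit_vec :: "'i set \<Rightarrow> 'i \<Rightarrow> 'i \<Rightarrow> real" where
  "unit_vec J \<alpha> = (\<lambda>\<beta>\<in>J. of_bool (\<beta> = \<alpha>))"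

lemma restrict_eq_zero_vec: "restrict x J = zero_vec J \<longleftrightarrow> (\<forall>\<beta>\<in>J. x \<beta> = 0)"
  by (auto simp: zero_vec_def restrict_def fun_eq_iff)

lemma restrict_eq_unit_vec: "restrict x J = unit_vec J \<alpha> \<longleftrightarrow> (\<forall>\<beta>\<in>J. x \<beta> = of_bool (\<beta> = \<alpha>))"
  by (auto simp: unit_vec_def restrict_def fun_eq_iff)

lemma inj_unit_vec: "inj_on (unit_vec J) J"
proof (rule inj_onI)
  fix \<alpha> \<beta> assume "\<alpha> \<in> J" "\<beta> \<in> J" "unit_vec J \<alpha> = unit_vec J \<beta>"
  then have "unit_vec J \<alpha> \<alpha> = unit_vec J \<beta> \<alpha>" by simp
  then show "\<alpha> = \<beta>" using \<open>\<alpha> \<in> J\<close> by (simp add: unit_vec_def split: if_splits)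
qed

lemma zero_vec_neq: "zero_vec J \<notin> unit_vec J ` J"
proof
  assume "zero_vec J \<in> unit_vec J ` J"
  then obtain \<alpha> where "\<alpha> \<in> J" "zero_vec J = unit_vec J \<alpha>" by blast
  then have "zero_vec J \<alpha> = unit_vec J \<alpha> \<alpha>" "\<alpha> \<in> J" by simp_all
  then show False by (simp add: zero_vec_def unit_vec_def)
qed

lemma vecs_in_space: "zero_vec J \<in> J \<rightarrow>\<^sub>E {0, 1}" "unit_vec J \<alpha> \<in> J \<rightarrow>\<^sub>E {0, 1}"
  by (auto simp: zero_vec_def unit_vec_def)

text \<open>Only union bounds are needed, with pairwise independence for the term of order \<open>p\<^sup>2\<close>.\<close>

lemma indep_indicators_law:
  fixes B :: "'i \<Rightarrow> 'b \<Rightarrow> real" and p :: real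
  assumes N: "prob_space N" and J: "finite J"
    and ind: "prob_space.indep_vars N (\<lambda>_. count_space {0, 1}) B J"
    and p: "\<And>\<alpha>. \<alpha> \<in> J \<Longrightarrow> prob_space.expectation N (B \<alpha>) = p"
  defines "Q \<equiv> distr N (count_space (J \<rightarrow>\<^sub>E {0, 1})) (\<lambda>\<omega>. \<lambda>\<alpha>\<in>J. B \<alpha> \<omega>)"
  shows "prob_space Q"
    and "1 - card J * p \<le> measure Q {zero_vec J}"
    and "\<And>\<alpha>. \<alpha> \<in> J \<Longrightarrow> measure Q {unit_vec J \<alpha>} \<le> p"
    and "\<And>\<alpha>. \<alpha> \<in> J \<Longrightarrow> p - card J * p\<^sup>2 \<le> measure Q {unit_vec J \<alpha>}"
proof -
  interpret N: prob_space N by (rule N)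
  have B: "B \<alpha> \<in> N \<rightarrow>\<^sub>M count_space {0, 1}" if "\<alpha> \<in> J" for \<alpha>
    using ind that by (simp add: N.indep_vars_def)
  have B01: "B \<alpha> \<omega> \<in> {0, 1}" if "\<alpha> \<in> J" "\<omega> \<in> space N" for \<alpha> \<omega>
    using measurable_space[OF B[OF that(1)] that(2)] by simp
  define b where "b \<alpha> = B \<alpha> -` {1} \<inter> space N" for \<alpha>
  have b: "b \<alpha> \<in> sets N" if "\<alpha> \<in> J" for \<alpha>
    unfolding b_def using B[OF that] by (rule measurable_sets) simp
  have Bb: "B \<alpha> \<omega> = of_bool (\<omega> \<in> b \<alpha>)" if "\<alpha> \<in> J" "\<omega> \<in> space N" for \<alpha> \<omega>
    using B01[OF that] that by (auto simp: b_def)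
  have bp: "N.prob (b \<alpha>) = p" if "\<alpha> \<in> J" for \<alpha>
  proof -
    have "N.expectation (B \<alpha>) = N.expectation (indicator (b \<alpha>))"
      by (rule Bochner_Integration.integral_cong) (auto simp: Bb[OF that] indicator_def)
    then show ?thesis using p[OF that] b[OF that] by simp
  qed
  have bb: "N.prob (b \<alpha> \<inter> b \<beta>) = p\<^sup>2" if "\<alpha> \<in> J" "\<beta> \<in> J" "\<alpha> \<noteq> \<beta>" for \<alpha> \<beta>
  proof -
    have "N.prob (\<Inter>i\<in>{\<alpha>, \<beta>}. B i -` {1} \<inter> space N) = (\<Prod>i\<in>{\<alpha>, \<beta>}. N.prob (B i -` {1} \<inter> space N))"
      using that by (intro N.indep_varsD[OF ind]) auto
    then show ?thesis using that bp unfolding b_def[symmetric] by (simp add: power2_eq_square)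
  qed
  let ?S = "J \<rightarrow>\<^sub>E {0, 1 :: real}" and ?V = "\<lambda>\<omega>. \<lambda>\<alpha>\<in>J. B \<alpha> \<omega>"
  have V: "?V \<in> N \<rightarrow>\<^sub>M count_space ?S"
  proof (subst measurable_count_space_eq2)
    show "finite ?S" using J by (intro finite_PiE) auto
    show "?V \<in> space N \<rightarrow> ?S \<and> (\<forall>a\<in>?S. ?V -` {a} \<inter> space N \<in> sets N)"
    proof (intro conjI ballI)
      show "?V \<in> space N \<rightarrow> ?S" using B01 by auto
      fix a assume a: "a \<in> ?S"
      have "?V -` {a} \<inter> space N = {\<omega> \<in> space N. \<forall>\<alpha>\<in>J. B \<alpha> \<omega> = a \<alpha>}"
        using a by (auto simp: PiE_def extensional_def restrict_def fun_eq_iff)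
      also have "\<dots> \<in> sets N"
      proof (rule sets.sets_Collect_finite_All[OF _ J])
        fix \<alpha> assume "\<alpha> \<in> J"
        moreover have "{\<omega> \<in> space N. B \<alpha> \<omega> = a \<alpha>} = B \<alpha> -` {a \<alpha>} \<inter> space N" by auto
        ultimately show "{\<omega> \<in> space N. B \<alpha> \<omega> = a \<alpha>} \<in> sets N"
          using a measurable_sets[OF B, of \<alpha> "{a \<alpha>}"] by (auto simp: PiE_def Pi_def)
      qed
      finally show "?V -` {a} \<inter> space N \<in> sets N" .
    qed
  qed
  show "prob_space Q" unfolding Q_def by (rule N.prob_space_distr[OF V])
  have Qa: "measure Q {a} = N.prob {\<omega> \<in> space N. ?V \<omega> = a}" if "a \<in> ?S" for a
  proof -
    have "?V -` {a} \<inter> space N = {\<omega> \<in> space N. ?V \<omega> = a}" by auto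
    then show ?thesis unfolding Q_def using that by (subst measure_distr[OF V]) auto
  qed
  have U: "(\<Union>\<beta>\<in>K. b \<beta>) \<in> sets N" if "K \<subseteq> J" for K
    using that J b finite_subset by (intro sets.finite_UN) auto
  have "measure Q {zero_vec J} = N.prob (space N - (\<Union>\<beta>\<in>J. b \<beta>))"
    unfolding Qa[OF vecs_in_space(1)] restrict_eq_zero_vec using Bb by (intro arg_cong[of _ _ N.prob]) auto
  also have "\<dots> = 1 - N.prob (\<Union>\<beta>\<in>J. b \<beta>)" by (rule N.prob_compl[OF U[OF order_refl]])
  finally have "measure Q {zero_vec J} = 1 - N.prob (\<Union>\<beta>\<in>J. b \<beta>)" .
  moreover have "N.prob (\<Union>\<beta>\<in>J. b \<beta>) \<le> (\<Sum>\<beta>\<in>J. N.prob (b \<beta>))"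
    using J b by (intro N.finite_measure_subadditive_finite) auto
  ultimately show "1 - card J * p \<le> measure Q {zero_vec J}" using bp by simp
  fix \<alpha> assume \<alpha>: "\<alpha> \<in> J"
  have Q1: "measure Q {unit_vec J \<alpha>} = N.prob (b \<alpha> - (\<Union>\<beta>\<in>J - {\<alpha>}. b \<alpha> \<inter> b \<beta>))"
    unfolding Qa[OF vecs_in_space(2)] restrict_eq_unit_vec
  proof (rule arg_cong[of _ _ N.prob], intro set_eqI iffI)
    fix \<omega> assume "\<omega> \<in> {\<omega> \<in> space N. \<forall>\<beta>\<in>J. B \<beta> \<omega> = of_bool (\<beta> = \<alpha>)}"
    then have "\<omega> \<in> b \<beta> \<longleftrightarrow> \<beta> = \<alpha>" if "\<beta> \<in> J" for \<beta> using Bb[OF that, of \<omega>] that by auto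
    then show "\<omega> \<in> b \<alpha> - (\<Union>\<beta>\<in>J - {\<alpha>}. b \<alpha> \<inter> b \<beta>)" using \<alpha> by blast
  next
    fix \<omega> assume \<omega>: "\<omega> \<in> b \<alpha> - (\<Union>\<beta>\<in>J - {\<alpha>}. b \<alpha> \<inter> b \<beta>)"
    then have "\<omega> \<in> space N" by (simp add: b_def)
    moreover have "\<omega> \<in> b \<beta> \<longleftrightarrow> \<beta> = \<alpha>" if "\<beta> \<in> J" for \<beta> using that \<omega> by blast
    ultimately show "\<omega> \<in> {\<omega> \<in> space N. \<forall>\<beta>\<in>J. B \<beta> \<omega> = of_bool (\<beta> = \<alpha>)}" using Bb by simp
  qed
  have "N.prob (b \<alpha> - (\<Union>\<beta>\<in>J - {\<alpha>}. b \<alpha> \<inter> b \<beta>)) \<le> N.prob (b \<alpha>)"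
    using b[OF \<alpha>] by (intro N.finite_measure_mono) auto
  then show "measure Q {unit_vec J \<alpha>} \<le> p" unfolding Q1 bp[OF \<alpha>] .
  have i: "b \<alpha> \<inter> b \<beta> \<in> sets N" if "\<beta> \<in> J - {\<alpha>}" for \<beta> using b that \<alpha> by blast
  have "N.prob (\<Union>\<beta>\<in>J - {\<alpha>}. b \<alpha> \<inter> b \<beta>) \<le> (\<Sum>\<beta>\<in>J - {\<alpha>}. N.prob (b \<alpha> \<inter> b \<beta>))"
    using J i by (intro N.finite_measure_subadditive_finite) auto
  also have "\<dots> = (\<Sum>\<beta>\<in>J - {\<alpha>}. p\<^sup>2)" using bb \<alpha> by (intro sum.cong) auto
  also have "\<dots> \<le> (\<Sum>\<beta>\<in>J. p\<^sup>2)" using J by (intro sum_mono2) auto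
  finally have "N.prob (\<Union>\<beta>\<in>J - {\<alpha>}. b \<alpha> \<inter> b \<beta>) \<le> card J * p\<^sup>2" by simp
  moreover have "N.prob (b \<alpha> - (\<Union>\<beta>\<in>J - {\<alpha>}. b \<alpha> \<inter> b \<beta>)) =
      N.prob (b \<alpha>) - N.prob (\<Union>\<beta>\<in>J - {\<alpha>}. b \<alpha> \<inter> b \<beta>)"
    using J i b[OF \<alpha>] by (intro N.finite_measure_Diff sets.finite_UN) auto
  ultimately show "p - card J * p\<^sup>2 \<le> measure Q {unit_vec J \<alpha>}" unfolding Q1 bp[OF \<alpha>] by simp
qed

section \<open>The two bounds\<close>

text \<open>This is the expectation of the number \<open>W\<close> of occurrences on the event that \<open>W\<close> is at least \<open>2\<close>.\<close>

definition excess :: "nat \<Rightarrow> nat \<Rightarrow> (nat \<Rightarrow> nat) \<Rightarrow> real" where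
  "excess n m \<tau> = (\<Sum>\<sigma> | \<sigma> permutes {1..n}. real (card (occ \<tau> m \<sigma> {1..n})) *
     of_bool (2 \<le> card (occ \<tau> m \<sigma> {1..n}))) / fact n"

lemma excess_nonneg: "0 \<le> excess n m \<tau>"
  by (simp add: excess_def sum_nonneg)

lemma prob_occ_eq_1:
  assumes "\<tau> permutes {1..m}"
  shows "(\<Sum>\<sigma> | \<sigma> permutes {1..n}. of_bool (card (occ \<tau> m \<sigma> {1..n}) = 1)) / fact n
    = lambda_mean n m - excess n m \<tau>"
proof -
  let ?w = "\<lambda>\<sigma>. card (occ \<tau> m \<sigma> {1..n})"
  have "of_bool (?w \<sigma> = 1) = real (?w \<sigma>) - real (?w \<sigma>) * of_bool (2 \<le> ?w \<sigma>)" for \<sigma>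
    by (cases "?w \<sigma>"; cases "?w \<sigma> - 1") auto
  then have "(\<Sum>\<sigma> | \<sigma> permutes {1..n}. of_bool (?w \<sigma> = 1)) = fact n * lambda_mean n m - fact n * excess n m \<tau>"
    by (simp add: sum_subtractf sum_card_occ[OF assms] excess_def del: One_nat_def)
  then show ?thesis by (simp add: diff_divide_distrib)
qed

lemma prob_occ_eq_0:
  assumes "\<tau> permutes {1..m}"
  shows "1 - lambda_mean n m \<le> (\<Sum>\<sigma> | \<sigma> permutes {1..n}. of_bool (card (occ \<tau> m \<sigma> {1..n}) = 0)) / fact n"
proof -
  let ?w = "\<lambda>\<sigma>. card (occ \<tau> m \<sigma> {1..n})"
  have "card {\<sigma>. \<sigma> permutes {1..n}} = fact n" using card_permutations[of "{1..n}" n] by simp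
  then have "fact n - fact n * lambda_mean n m = (\<Sum>\<sigma> | \<sigma> permutes {1..n}. 1 - real (?w \<sigma>))"
    by (simp add: sum_subtractf sum_card_occ[OF assms] del: One_nat_def)
  also have "\<dots> \<le> (\<Sum>\<sigma> | \<sigma> permutes {1..n}. of_bool (?w \<sigma> = 0))"
    by (intro sum_mono) (auto simp: of_bool_def)
  finally show ?thesis by (simp add: field_simps)
qed

text \<open>If \<open>2 * d2 \<ge> \<lambda>\<close>, then \<open>d2\<close> alone makes the bound at least \<open>min 1 \<lambda>\<close>. Otherwise \<open>n < 2 * m\<close>, hence
\<open>d1 = \<lambda>\<^sup>2\<close>, and the excess is at most \<open>2 * d2\<close>. This settles \<open>\<lambda> \<le> 1\<close>; for \<open>\<lambda> > 1\<close> already \<open>d1 / \<lambda>\<close>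
exceeds \<open>1\<close>.\<close>

lemma le_two_D_bound:
  assumes m: "3 \<le> m" "m \<le> n" and \<tau>: "\<tau> permutes {1..m}"
    and t: "t \<le> excess n m \<tau> + (lambda_mean n m)\<^sup>2" "t \<le> lambda_mean n m" "t \<le> 1"
  shows "t \<le> 2 * D_bound n m \<tau>" and "0 \<le> D_bound n m \<tau>"
proof -
  define l where "l = lambda_mean n m"
  have l: "0 < l" using m by (simp add: l_def lambda_mean_def)
  have d1: "0 \<le> d1 n m"
    using binomial_right_mono[of "n - m" n m] by (simp add: d1_def)
  have d2: "0 \<le> d2 n m \<tau>" unfolding d2_def by (intro sum_nonneg) auto
  have D: "D_bound n m \<tau> = min 1 (inverse l) * (d1 n m + d2 n m \<tau>)" by (simp add: D_bound_def l_def)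
  have c: "0 \<le> min 1 (inverse l)" "min 1 (inverse l) * l = min l 1"
    using l by (auto simp: min_def field_simps)
  show "0 \<le> D_bound n m \<tau>" unfolding D using c(1) d1 d2 by simp
  show "t \<le> 2 * D_bound n m \<tau>"
  proof (cases "l \<le> 2 * d2 n m \<tau>")
    case True
    have "t \<le> min l 1" using t by (simp add: l_def)
    also have "\<dots> \<le> min 1 (inverse l) * (2 * (d1 n m + d2 n m \<tau>))"
      unfolding c(2)[symmetric] using True d1 c(1) by (intro mult_left_mono) auto
    finally show ?thesis unfolding D by (simp only: mult.left_commute)
  next
    case False
    then have small: "2 * d2 n m \<tau> < lambda_mean n m" by (simp add: l_def)
    have "n - m < m" using small_d2(1)[OF m \<tau> small] by linarith
    then have d1': "d1 n m = l\<^sup>2"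
      by (simp add: d1_def l_def lambda_mean_def power2_eq_square)
    have "excess n m \<tau> \<le> (fact n * (2 * d2 n m \<tau>)) / fact n"
      unfolding excess_def by (intro divide_right_mono small_d2(2)[OF m \<tau> small]) simp
    then have "t \<le> 2 * d2 n m \<tau> + l\<^sup>2" using t(1) by (simp add: l_def)
    show ?thesis
    proof (cases "l \<le> 1")
      case True
      then have "min 1 (inverse l) = 1" using l by (simp add: one_le_inverse)
      then have "D_bound n m \<tau> = d1 n m + d2 n m \<tau>" unfolding D by simp
      then show ?thesis using \<open>t \<le> 2 * d2 n m \<tau> + l\<^sup>2\<close> d1 d1' by linarith
    next
      case False
      have "1 \<le> min l 1 * l" using False by simp
      also have "\<dots> = min 1 (inverse l) * d1 n m" unfolding c(2)[symmetric] d1' by (simp add: power2_eq_square)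
      also have "\<dots> \<le> D_bound n m \<tau>" unfolding D using c(1) d2 by (intro mult_left_mono) auto
      finally show ?thesis using t(3) by simp
    qed
  qed
qed

text \<open>The two laws are compared at \<open>0\<close> and \<open>1\<close>. The probability of \<open>1\<close> misses the mean \<open>\<lambda>\<close> by the excess in one
case and by \<open>\<lambda> - \<lambda> * exp (- \<lambda>) \<le> \<lambda>\<^sup>2\<close> in the other.\<close>

lemma tv_dist_occ_poisson:
  assumes \<tau>: "\<tau> permutes {1..m}" and mn: "m \<le> n" and M: "prob_space M"
    and S: "S \<in> M \<rightarrow>\<^sub>M count_space {p. p permutes {1..n}}"
    and unif: "distr M (count_space {p. p permutes {1..n}}) S = uniform_count_measure {p. p permutes {1..n}}"
  defines "t \<equiv> tv_dist (distr M borel (\<lambda>\<omega>. real (card (occ \<tau> m (S \<omega>) {1..n}))))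
      (distr (measure_pmf (poisson_pmf (lambda_mean n m))) borel real)"
  shows "t \<le> excess n m \<tau> + (lambda_mean n m)\<^sup>2" "t \<le> lambda_mean n m" "t \<le> 1"
proof -
  define l where "l = lambda_mean n m"
  have l: "0 < l" using mn by (simp add: l_def lambda_mean_def)
  let ?P = "distr M borel (\<lambda>\<omega>. real (card (occ \<tau> m (S \<omega>) {1..n})))"
  let ?Q = "distr (measure_pmf (poisson_pmf l)) borel real"
  note law = law_uniform[OF M S unif, of "\<lambda>\<sigma>. real (card (occ \<tau> m \<sigma> {1..n}))" borel]
  have P: "prob_space ?P" by (rule law(1)) simp
  have P1: "measure ?P {1} = l - excess n m \<tau>"
    using law(2)[of "{1}"] prob_occ_eq_1[OF \<tau>, of n] by (simp add: l_def)
  have P0: "1 - l \<le> measure ?P {0}"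
    using law(2)[of "{0}"] prob_occ_eq_0[OF \<tau>, of n] by (simp add: l_def)
  have Q: "prob_space ?Q" by (intro prob_space.prob_space_distr measure_pmf.prob_space_axioms) simp
  have Qk: "measure ?Q {real k} = l ^ k / fact k * exp (- l)" for k
  proof -
    have "real -` {real k} = {k}" by auto
    then show ?thesis using l by (subst measure_distr) (auto simp: measure_pmf_single)
  qed
  have ex: "1 - l \<le> exp (- l)" using exp_ge_add_one_self[of "- l"] by simp
  have Q1: "l - l\<^sup>2 \<le> measure ?Q {1}"
    using Qk[of 1] mult_left_mono[OF ex, of l] l by (simp add: algebra_simps power2_eq_square)
  have "measure ?Q {1} \<le> l" using Qk[of 1] l by (simp add: mult_le_cancel_left1)
  moreover have "1 - l \<le> measure ?Q {0}" using Qk[of 0] ex by simp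
  moreover have "measure ?P {1} \<le> l" using P1 excess_nonneg[of n m \<tau>] by simp
  ultimately have *: "tv_dist ?P ?Q \<le> (l - measure ?P {1}) + (l - measure ?Q {1})" "tv_dist ?P ?Q \<le> l" "tv_dist ?P ?Q \<le> 1"
    using tv_dist_le_atoms[OF P Q, of "{1}" 0 "\<lambda>_. l"] P0 by simp_all
  then show "t \<le> excess n m \<tau> + (lambda_mean n m)\<^sup>2" "t \<le> lambda_mean n m" "t \<le> 1"
    using P1 Q1 unfolding t_def l_def[symmetric] by simp_all
qed

text \<open>The two laws are compared at the zero vector and at the unit vectors. The total probability of the
unit vectors misses \<open>\<lambda>\<close> by the excess in one case and by at most \<open>\<lambda>\<^sup>2\<close> in the other.\<close>

lemma tv_dist_indicators:
  fixes B :: "nat set \<Rightarrow> 'b \<Rightarrow> real"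
  assumes \<tau>: "\<tau> permutes {1..m}" and M: "prob_space M"
    and S: "S \<in> M \<rightarrow>\<^sub>M count_space {p. p permutes {1..n}}"
    and unif: "distr M (count_space {p. p permutes {1..n}}) S = uniform_count_measure {p. p permutes {1..n}}"
    and N: "prob_space N"
    and ind: "prob_space.indep_vars N (\<lambda>_. count_space {0, 1}) B {\<alpha>. \<alpha> \<subseteq> {1..n} \<and> card \<alpha> = m}"
    and EB: "\<And>\<alpha>. \<alpha> \<subseteq> {1..n} \<Longrightarrow> card \<alpha> = m \<Longrightarrow> prob_space.expectation N (B \<alpha>) = 1 / fact m"
  defines "J \<equiv> {\<alpha>. \<alpha> \<subseteq> {1..n} \<and> card \<alpha> = m}"
  defines "t \<equiv> tv_dist (distr M (count_space (J \<rightarrow>\<^sub>E {0, 1})) (\<lambda>\<omega>. \<lambda>\<alpha>\<in>J. of_bool (pat (S \<omega>) \<alpha> = \<tau>)))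
      (distr N (count_space (J \<rightarrow>\<^sub>E {0, 1})) (\<lambda>\<omega>. \<lambda>\<alpha>\<in>J. B \<alpha> \<omega>))"
  shows "t \<le> excess n m \<tau> + (lambda_mean n m)\<^sup>2" "t \<le> lambda_mean n m" "t \<le> 1"
proof -
  define l where "l = lambda_mean n m"
  define p where "p = (1 / fact m :: real)"
  let ?P = "distr M (count_space (J \<rightarrow>\<^sub>E {0, 1})) (\<lambda>\<omega>. \<lambda>\<alpha>\<in>J. of_bool (pat (S \<omega>) \<alpha> = \<tau>) :: real)"
  let ?Q = "distr N (count_space (J \<rightarrow>\<^sub>E {0, 1})) (\<lambda>\<omega>. \<lambda>\<alpha>\<in>J. B \<alpha> \<omega>)"
  let ?F = "unit_vec J ` J"
  have J: "finite J" unfolding J_def by (rule finite_subset[of _ "Pow {1..n}"]) auto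
  have lp: "card J * p = l" using n_subsets[of "{1..n}" m] by (simp add: J_def l_def lambda_mean_def p_def)
  have EB': "prob_space.expectation N (B \<alpha>) = p" if "\<alpha> \<in> J" for \<alpha>
    using EB that by (simp add: J_def p_def)
  note Q = indep_indicators_law[OF N J ind[folded J_def] EB']
  define g where "g \<sigma> = (\<lambda>\<alpha>\<in>J. of_bool (pat \<sigma> \<alpha> = \<tau>) :: real)" for \<sigma>
  have gs: "g \<sigma> \<in> space (count_space (J \<rightarrow>\<^sub>E {0, 1}))" for \<sigma> by (auto simp: g_def)
  note law = law_uniform[OF M S unif gs]
  have occ: "occ \<tau> m \<sigma> {1..n} = {\<alpha> \<in> J. pat \<sigma> \<alpha> = \<tau>}" for \<sigma> by (auto simp: occ_def J_def)
  have g0: "g \<sigma> = zero_vec J \<longleftrightarrow> card (occ \<tau> m \<sigma> {1..n}) = 0" for \<sigma>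
    unfolding g_def restrict_eq_zero_vec occ using J by auto
  have g1: "g \<sigma> = unit_vec J \<alpha> \<longleftrightarrow> occ \<tau> m \<sigma> {1..n} = {\<alpha>}" if "\<alpha> \<in> J" for \<sigma> \<alpha>
    unfolding g_def restrict_eq_unit_vec occ using that by auto
  have gF: "g \<sigma> \<in> ?F \<longleftrightarrow> card (occ \<tau> m \<sigma> {1..n}) = 1" for \<sigma>
  proof
    assume "card (occ \<tau> m \<sigma> {1..n}) = 1"
    then obtain \<alpha> where \<alpha>: "occ \<tau> m \<sigma> {1..n} = {\<alpha>}" using card_1_singletonE by blast
    then have "\<alpha> \<in> J" unfolding occ by blast
    then show "g \<sigma> \<in> ?F" using g1 \<alpha> by blast
  qed (use g1 in auto)
  have PF: "measure ?P ?F = l - excess n m \<tau>"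
    using law(2)[of ?F "\<lambda>\<sigma>. \<sigma>"] prob_occ_eq_1[OF \<tau>, of n] vecs_in_space(2)[of J] unfolding g_def[symmetric] gF
    by (auto simp: l_def)
  have P0: "1 - l \<le> measure ?P {zero_vec J}"
    using law(2)[of "{zero_vec J}" "\<lambda>\<sigma>. \<sigma>"] prob_occ_eq_0[OF \<tau>, of n] vecs_in_space(1)[of J]
    unfolding g_def[symmetric] by (simp add: g0 l_def)
  have Pp: "measure ?P {unit_vec J \<alpha>} \<le> p" if \<alpha>: "\<alpha> \<in> J" for \<alpha>
  proof -
    have "measure ?P {unit_vec J \<alpha>} = (\<Sum>\<sigma> | \<sigma> permutes {1..n}. of_bool (g \<sigma> = unit_vec J \<alpha>)) / fact n"
      using law(2)[of "{unit_vec J \<alpha>}" "\<lambda>\<sigma>. \<sigma>"] vecs_in_space(2)[of J \<alpha>] unfolding g_def[symmetric] by simp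
    also have "\<dots> \<le> (\<Sum>\<sigma> | \<sigma> permutes {1..n}. of_bool (pat \<sigma> \<alpha> = \<tau>)) / fact n"
    proof (intro divide_right_mono sum_mono)
      fix \<sigma> show "of_bool (g \<sigma> = unit_vec J \<alpha>) \<le> (of_bool (pat \<sigma> \<alpha> = \<tau>) :: real)"
        unfolding g1[OF \<alpha>] occ by auto
    qed simp
    also have "\<dots> = p" using sum_pat_eq[OF \<tau>, of \<alpha> n] \<alpha> by (simp add: J_def p_def)
    finally show ?thesis .
  qed
  have sumF: "(\<Sum>x\<in>?F. p) = l" using lp by (simp add: card_image[OF inj_unit_vec])
  have QF: "l - l\<^sup>2 \<le> measure ?Q ?F"
  proof -
    interpret Q: prob_space ?Q by (rule Q(1))
    have "l - l\<^sup>2 = (\<Sum>\<alpha>\<in>J. p - card J * p\<^sup>2)"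
      unfolding lp[symmetric] by (simp add: right_diff_distrib power2_eq_square mult_ac)
    also have "\<dots> \<le> (\<Sum>\<alpha>\<in>J. measure ?Q {unit_vec J \<alpha>})" by (intro sum_mono Q(4))
    also have "\<dots> = (\<Sum>x\<in>?F. measure ?Q {x})" by (simp add: sum.reindex[OF inj_unit_vec])
    also have "\<dots> = measure ?Q ?F"
      using J vecs_in_space(2)[of J] by (intro Q.finite_measure_eq_sum_singleton[symmetric]) auto
    finally show ?thesis .
  qed
  have PP: "prob_space ?P" using law(1)[of "\<lambda>\<sigma>. \<sigma>"] unfolding g_def .
  have pts: "{x} \<in> sets ?P" if "x \<in> insert (zero_vec J) ?F" for x
    using that vecs_in_space[of J] by auto
  have Pp': "measure ?P {x} \<le> p" and Qp': "measure ?Q {x} \<le> p" if "x \<in> ?F" for x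
    using that Pp Q(3) by blast+
  have sets: "sets ?P = sets ?Q" by simp
  have z: "1 - (\<Sum>x\<in>?F. p) \<le> measure ?P {zero_vec J}" "1 - (\<Sum>x\<in>?F. p) \<le> measure ?Q {zero_vec J}"
    unfolding sumF using P0 Q(2) lp by simp_all
  note * = tv_dist_le_atoms[OF PP Q(1) sets finite_imageI[OF J] zero_vec_neq pts Pp' Qp' z]
  show "t \<le> excess n m \<tau> + (lambda_mean n m)\<^sup>2"
    using *(1) PF QF unfolding sumF t_def l_def[symmetric] by simp
  show "t \<le> lambda_mean n m" "t \<le> 1"
    using *(2,3) unfolding sumF t_def l_def[symmetric] by simp_all
qed

theorem theorem3p6:
  fixes n m :: nat and \<tau> :: "nat \<Rightarrow> nat"
    and M :: "'a measure" and S :: "'a \<Rightarrow> nat \<Rightarrow> nat"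
    and J :: "nat set set" and X :: "nat set \<Rightarrow> 'a \<Rightarrow> real" and W :: "'a \<Rightarrow> real"
    and N :: "'b measure" and B :: "nat set \<Rightarrow> 'b \<Rightarrow> real"
    and Q :: "'c measure" and Y :: "'c \<Rightarrow> real"
  assumes "3 \<le> m" and "m \<le> n" and "\<tau> permutes {1..m}"
    and "prob_space M"
    and "S \<in> M \<rightarrow>\<^sub>M count_space {p. p permutes {1..n}}"
    and "distr M (count_space {p. p permutes {1..n}}) S = uniform_count_measure {p. p permutes {1..n}}"
    and J_def: "J = {\<alpha>. \<alpha> \<subseteq> {1..n} \<and> card \<alpha> = m}"
    and X_def: "X = (\<lambda>\<alpha> \<omega>. of_bool (red (subword (S \<omega>) \<alpha>) = \<tau>))"
    and W_def: "W = (\<lambda>\<omega>. \<Sum>\<alpha>\<in>J. X \<alpha> \<omega>)"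
    and "prob_space N"
    and "prob_space.indep_vars N (\<lambda>_. count_space {0, 1}) B J"
    and "\<And>\<alpha>. \<alpha> \<in> J \<Longrightarrow> prob_space.expectation N (B \<alpha>) = prob_space.expectation M (X \<alpha>)"
    and "prob_space Q"
    and "Y \<in> borel_measurable Q"
    and "distr Q borel Y = distr (measure_pmf (poisson_pmf (lambda_mean n m))) borel real"
  shows "tv_dist (distr M (count_space (J \<rightarrow>\<^sub>E {0, 1})) (\<lambda>\<omega>. \<lambda>\<alpha>\<in>J. X \<alpha> \<omega>))
                 (distr N (count_space (J \<rightarrow>\<^sub>E {0, 1})) (\<lambda>\<omega>. \<lambda>\<alpha>\<in>J. B \<alpha> \<omega>))
           \<le> 4 * D_bound n m \<tau> + 2 * lambda_mean n m / fact m
       \<and> prob_space.expectation M W = lambda_mean n m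
       \<and> tv_dist (distr M borel W) (distr Q borel Y) \<le> 2 * D_bound n m \<tau>"
proof -
  have J: "\<alpha> \<in> J \<longleftrightarrow> \<alpha> \<subseteq> {1..n} \<and> card \<alpha> = m" for \<alpha> by (simp add: J_def)
  note M = assms(4) and S = assms(5) and unif = assms(6)
  have EX: "prob_space.expectation M (X \<alpha>) = 1 / fact m" if "\<alpha> \<in> J" for \<alpha>
    using that sum_pat_eq[OF assms(3), of \<alpha> n]
      expectation_uniform[OF S unif, of "\<lambda>\<sigma>. of_bool (pat \<sigma> \<alpha> = \<tau>)"]
    unfolding X_def J by simp
  have W: "W = (\<lambda>\<omega>. real (card (occ \<tau> m (S \<omega>) {1..n})))"
    unfolding W_def X_def J_def card_occ_eq_sum ..
  have EW: "prob_space.expectation M W = lambda_mean n m"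
    unfolding W
    using expectation_uniform[OF S unif, of "\<lambda>\<sigma>. real (card (occ \<tau> m \<sigma> {1..n}))"] sum_card_occ[OF assms(3), of n]
    by simp
  have EB: "prob_space.expectation N (B \<alpha>) = 1 / fact m" if "\<alpha> \<subseteq> {1..n}" "card \<alpha> = m" for \<alpha>
    using EX assms(12) that unfolding J by simp
  note X = tv_dist_indicators[OF assms(3) M S unif assms(10) assms(11)[unfolded J_def] EB, folded J_def]
  note two_D = le_two_D_bound[OF assms(1-3)]
  have "tv_dist (distr M (count_space (J \<rightarrow>\<^sub>E {0, 1})) (\<lambda>\<omega>. \<lambda>\<alpha>\<in>J. X \<alpha> \<omega>))
                 (distr N (count_space (J \<rightarrow>\<^sub>E {0, 1})) (\<lambda>\<omega>. \<lambda>\<alpha>\<in>J. B \<alpha> \<omega>))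
           \<le> 2 * D_bound n m \<tau>"
    unfolding X_def by (rule two_D(1)[OF X])
  moreover have "0 \<le> D_bound n m \<tau>" by (rule two_D(2)[OF X])
  moreover have "0 \<le> 2 * lambda_mean n m / fact m" by (simp add: lambda_mean_def)
  moreover have "tv_dist (distr M borel W) (distr Q borel Y) \<le> 2 * D_bound n m \<tau>"
    unfolding W assms(15) by (rule two_D(1)[OF tv_dist_occ_poisson[OF assms(3,2) M S unif]])
  ultimately show ?thesis using EW by linarith
qed

end
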